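(* Let $C$ be a $C^\infty$-ring with operations $\phi_h$, let $\xi$ be a free $C$-module with finite basis $\theta^1,\dots,\theta^q$, and let $R=C[\theta^1,\dots,\theta^q]^{\pm}:=\bigwedge_C\xi$. Then the superring $R$ carries a natural $C^\infty$-superring structure defined as follows. For $h\in C^\infty(\mathbb{R}^k)$ and $F_j=f_j+N_j\in R_{\bar0}$ with $f_j\in\overline R= C$ and $N_j\in R_{\bar1}^2$ ($j=1,\dots,k$), define the $k$-ary operation $$\Phi_h(F_1,\dots,F_k):=\sum_{n\ge0}\frac1{n!}\sum_{j_1,\dots,j_n=1}^{k}\phi_{\partial_{j_1}\cdots\partial_{j_n}h}(f_1,\dots,f_k)\,N_{j_1}\cdots N_{j_n}.$$ This construction satisfies: (i) The sum is finite (terminating at $n=\lfloor q/2\rfloor$), and the collection $\{\Phi_h\}_{h\in C^\infty(\mathbb{R}^k),\,k\in\mathbb{N}}$ equips $R_{\bar0}$ with a $C^\infty$-ring structure. (ii) This $C^\infty$-ring structure is compatible with the underlying addition, ring multiplication and scalar multiplication on $R_{\bar0}$ induced by the exterior algebra $\bigwedge_C\xi$; that is, $\Phi_{x+y}=+$, $\Phi_{xy}=\cdot$, and $\Phi_{\lambda x}=\lambda(-)$ for every $\lambda\in\mathbb{R}$. In particular, $R=C[\theta^1,\dots,\theta^q]^\pm$ equipped with these operations is a $C^\infty$-superring.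
   Context: A $C^\infty$-ring is a set $C$ with operations $\phi_f:C^n\to C$ for all $n$ and all $f\in C^\infty(\mathbb{R}^n)$, such that (projections) $\phi_{p_i}(c_1,\dots,c_n)=c_i$ for the coordinate projection $p_i$, and (compositions) $\phi_{g(h_1,\dots,h_n)}(c)=\phi_g(\phi_{h_1}(c),\dots,\phi_{h_n}(c))$. It is in particular a commutative $\mathbb{R}$-algebra; modules over it are modules over this algebra. A superring is a unital $\mathbb{Z}_2$-graded ring $R=R_{\bar0}\oplus R_{\bar1}$ with $xy=(-1)^{|x||y|}yx$ for homogeneous $x,y$. A $C^\infty$-superring is a superring whose even part carries a $C^\infty$-ring structure compatible with its ring structure. $R_{\bar1}^2$ denotes the ideal of $R_{\bar0}$ generated by products of two odd elements. The superreduced ring is $\overline R=R/(R\,R_{\bar1})\cong R_{\bar0}/R_{\bar1}^2$; for $R=\bigwedge_C\xi$ it is identified with the degree-zero part $C\subset R_{\bar0}$, so $R_{\bar0}=C\oplus R_{\bar1}^2$ and every $F\in R_{\bar 0}$ is uniquely $f+N$ with $f\in C$, $N\in R_{\bar1}^2$. The $\mathbb{Z}_2$-grading of $\bigwedge_C\xi$ is by parity of exterior degree. *)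

theory Defs
  imports "HOL-Analysis.Analysis" "HOL-Algebra.Module" "HOL-Algebra.QuotRing"
begin

section \<open>Smooth functions of n real variables, with n a term\<close>

text \<open>
  A function on the n-dimensional space is represented by a function on \<^typ>\<open>nat \<Rightarrow> real\<close> that
  depends only on the coordinates with index below n (so the coordinates are numbered from 0).
  For such functions continuity for the product topology of \<^typ>\<open>nat \<Rightarrow> real\<close> is
  continuity on the n-dimensional space.
\<close>

type_synonym rfun = "(nat \<Rightarrow> real) \<Rightarrow> real"

definition pdiff :: "nat \<Rightarrow> rfun \<Rightarrow> rfun" where
  "pdiff j f = (\<lambda>x. deriv (\<lambda>t. f (x(j := t))) (x j))"

definition pdiffs :: "nat list \<Rightarrow> rfun \<Rightarrow> rfun" where
  "pdiffs js f = foldr pdiff js f"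

definition smooth :: "nat \<Rightarrow> rfun set" where
  "smooth n = {f.
     (\<forall>x y. (\<forall>i<n. x i = y i) \<longrightarrow> f x = f y) \<and>
     (\<forall>js \<in> lists {..<n}.
        continuous_on UNIV (pdiffs js f) \<and>
        (\<forall>j<n. \<forall>x. (\<lambda>t. pdiffs js f (x(j := t))) differentiable (at (x j))))}"


section \<open>Smooth rings\<close>

text \<open>
  The operation attached to a smooth function of n variables is applied to lists of length n:
  the arity is the length of the argument list.  In the composition axiom the values of the
  family \<open>h\<close> at indices from \<open>n\<close> on are irrelevant because \<open>g\<close> does not see those coordinates.
\<close>

locale cinf_ring =
  fixes C :: "'c set" and \<phi> :: "rfun \<Rightarrow> 'c list \<Rightarrow> 'c"
  assumes op_closed:
      "\<And>f cs. \<lbrakk>f \<in> smooth (length cs); cs \<in> lists C\<rbrakk> \<Longrightarrow> \<phi> f cs \<in> C"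
    and op_proj:
      "\<And>i cs. \<lbrakk>cs \<in> lists C; i < length cs\<rbrakk> \<Longrightarrow> \<phi> (\<lambda>x. x i) cs = cs ! i"
    and op_comp:
      "\<And>n g h cs. \<lbrakk>g \<in> smooth n; \<And>i. i < n \<Longrightarrow> h i \<in> smooth (length cs); cs \<in> lists C\<rbrakk>
        \<Longrightarrow> \<phi> (\<lambda>x. g (\<lambda>i. h i x)) cs = \<phi> g (map (\<lambda>i. \<phi> (h i) cs) [0..<n])"

definition cinf_cring :: "'c set \<Rightarrow> (rfun \<Rightarrow> 'c list \<Rightarrow> 'c) \<Rightarrow> 'c ring" where
  "cinf_cring C \<phi> =
    \<lparr>carrier = C,
     mult = (\<lambda>a b. \<phi> (\<lambda>x. x 0 * x 1) [a, b]),
     one = \<phi> (\<lambda>x. 1) [],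
     zero = \<phi> (\<lambda>x. 0) [],
     add = (\<lambda>a b. \<phi> (\<lambda>x. x 0 + x 1) [a, b])\<rparr>"

definition cinf_scale :: "(rfun \<Rightarrow> 'c list \<Rightarrow> 'c) \<Rightarrow> real \<Rightarrow> 'c \<Rightarrow> 'c" where
  "cinf_scale \<phi> r a = \<phi> (\<lambda>x. r * x 0) [a]"


section \<open>Superrings\<close>

locale superring = ring R for R (structure) +
  fixes R0 R1 :: "'a set"
  assumes even_subgroup: "additive_subgroup R0 R"
    and odd_subgroup: "additive_subgroup R1 R"
    and decomp: "\<And>x. x \<in> carrier R \<Longrightarrow> \<exists>a\<in>R0. \<exists>b\<in>R1. x = a \<oplus> b"
    and decomp_direct: "R0 \<inter> R1 = {\<zero>}"
    and even_even: "\<And>x y. \<lbrakk>x \<in> R0; y \<in> R0\<rbrakk> \<Longrightarrow> x \<otimes> y \<in> R0"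
    and even_odd: "\<And>x y. \<lbrakk>x \<in> R0; y \<in> R1\<rbrakk> \<Longrightarrow> x \<otimes> y \<in> R1"
    and odd_even: "\<And>x y. \<lbrakk>x \<in> R1; y \<in> R0\<rbrakk> \<Longrightarrow> x \<otimes> y \<in> R1"
    and odd_odd: "\<And>x y. \<lbrakk>x \<in> R1; y \<in> R1\<rbrakk> \<Longrightarrow> x \<otimes> y \<in> R0"
    and even_even_commute: "\<And>x y. \<lbrakk>x \<in> R0; y \<in> R0\<rbrakk> \<Longrightarrow> x \<otimes> y = y \<otimes> x"
    and even_odd_commute: "\<And>x y. \<lbrakk>x \<in> R0; y \<in> R1\<rbrakk> \<Longrightarrow> x \<otimes> y = y \<otimes> x"
    and odd_odd_commute: "\<And>x y. \<lbrakk>x \<in> R1; y \<in> R1\<rbrakk> \<Longrightarrow> x \<otimes> y = \<ominus> (y \<otimes> x)"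

locale cinf_superring = superring R R0 R1 + cinf_ring R0 \<Phi>
  for R (structure) and R0 R1 and \<Phi> +
  assumes add_compat: "\<And>x y. \<lbrakk>x \<in> R0; y \<in> R0\<rbrakk> \<Longrightarrow> \<Phi> (\<lambda>v. v 0 + v 1) [x, y] = x \<oplus> y"
    and mult_compat: "\<And>x y. \<lbrakk>x \<in> R0; y \<in> R0\<rbrakk> \<Longrightarrow> \<Phi> (\<lambda>v. v 0 * v 1) [x, y] = x \<otimes> y"

definition odd_square :: "('a, 'b) ring_scheme \<Rightarrow> 'a set \<Rightarrow> 'a set \<Rightarrow> 'a set" where
  "odd_square R R0 R1 = genideal (R\<lparr>carrier := R0\<rparr>) {x \<otimes>\<^bsub>R\<^esub> y | x y. x \<in> R1 \<and> y \<in> R1}"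


section \<open>The exterior algebra of a module\<close>

text \<open>
  The free associative unital algebra on a set \<open>X\<close> over \<open>A\<close>: finitely supported functions from
  words over \<open>X\<close> to \<open>A\<close>, with the product induced by concatenation of words.
\<close>

definition word_algebra :: "('c, 'z) ring_scheme \<Rightarrow> 'm set \<Rightarrow> ('m list \<Rightarrow> 'c) ring" where
  "word_algebra A X =
    \<lparr>carrier = {a. (\<forall>w. a w \<in> carrier A) \<and> finite {w. a w \<noteq> \<zero>\<^bsub>A\<^esub>} \<and>
                   {w. a w \<noteq> \<zero>\<^bsub>A\<^esub>} \<subseteq> lists X},
     mult = (\<lambda>a b w. \<Oplus>\<^bsub>A\<^esub>i\<in>{..length w}. a (take i w) \<otimes>\<^bsub>A\<^esub> b (drop i w)),
     one = (\<lambda>w. if w = [] then \<one>\<^bsub>A\<^esub> else \<zero>\<^bsub>A\<^esub>),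
     zero = (\<lambda>w. \<zero>\<^bsub>A\<^esub>),
     add = (\<lambda>a b w. a w \<oplus>\<^bsub>A\<^esub> b w)\<rparr>"

definition monomial :: "('c, 'z) ring_scheme \<Rightarrow> 'c \<Rightarrow> 'm list \<Rightarrow> 'm list \<Rightarrow> 'c" where
  "monomial A c w = (\<lambda>v. if v = w then c else \<zero>\<^bsub>A\<^esub>)"

text \<open>
  The two linearity relations turn the word algebra on the elements of \<open>M\<close> into the tensor
  algebra of \<open>M\<close>; the squares then turn the tensor algebra into the exterior algebra.
\<close>

definition exterior_relations ::
  "('c, 'z) ring_scheme \<Rightarrow> ('c, 'm, 'y) module_scheme \<Rightarrow> ('m list \<Rightarrow> 'c) set" where
  "exterior_relations A M =
    (let T = word_algebra A (carrier M); \<iota> = (\<lambda>x. monomial A \<one>\<^bsub>A\<^esub> [x]) in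
      {\<iota> (x \<oplus>\<^bsub>M\<^esub> y) \<ominus>\<^bsub>T\<^esub> (\<iota> x \<oplus>\<^bsub>T\<^esub> \<iota> y) | x y. x \<in> carrier M \<and> y \<in> carrier M} \<union>
      {\<iota> (c \<odot>\<^bsub>M\<^esub> x) \<ominus>\<^bsub>T\<^esub> monomial A c [x] | c x. c \<in> carrier A \<and> x \<in> carrier M} \<union>
      {\<iota> x \<otimes>\<^bsub>T\<^esub> \<iota> x | x. x \<in> carrier M})"

definition exterior_ideal ::
  "('c, 'z) ring_scheme \<Rightarrow> ('c, 'm, 'y) module_scheme \<Rightarrow> ('m list \<Rightarrow> 'c) set" where
  "exterior_ideal A M = genideal (word_algebra A (carrier M)) (exterior_relations A M)"

definition exterior_algebra ::
  "('c, 'z) ring_scheme \<Rightarrow> ('c, 'm, 'y) module_scheme \<Rightarrow> ('m list \<Rightarrow> 'c) set ring" where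
  "exterior_algebra A M = word_algebra A (carrier M) Quot exterior_ideal A M"

definition exterior_class ::
  "('c, 'z) ring_scheme \<Rightarrow> ('c, 'm, 'y) module_scheme \<Rightarrow> ('m list \<Rightarrow> 'c) \<Rightarrow> ('m list \<Rightarrow> 'c) set"
  where "exterior_class A M a = exterior_ideal A M +>\<^bsub>word_algebra A (carrier M)\<^esub> a"

text \<open>The structure map of the algebra, whose image is the degree-zero part.\<close>

definition exterior_scalar ::
  "('c, 'z) ring_scheme \<Rightarrow> ('c, 'm, 'y) module_scheme \<Rightarrow> 'c \<Rightarrow> ('m list \<Rightarrow> 'c) set" where
  "exterior_scalar A M c = exterior_class A M (monomial A c [])"

definition exterior_even ::
  "('c, 'z) ring_scheme \<Rightarrow> ('c, 'm, 'y) module_scheme \<Rightarrow> ('m list \<Rightarrow> 'c) set set" where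
  "exterior_even A M = exterior_class A M `
    {a \<in> carrier (word_algebra A (carrier M)). \<forall>w. a w \<noteq> \<zero>\<^bsub>A\<^esub> \<longrightarrow> even (length w)}"

definition exterior_odd ::
  "('c, 'z) ring_scheme \<Rightarrow> ('c, 'm, 'y) module_scheme \<Rightarrow> ('m list \<Rightarrow> 'c) set set" where
  "exterior_odd A M = exterior_class A M `
    {a \<in> carrier (word_algebra A (carrier M)). \<forall>w. a w \<noteq> \<zero>\<^bsub>A\<^esub> \<longrightarrow> odd (length w)}"

definition exterior_nil ::
  "('c, 'z) ring_scheme \<Rightarrow> ('c, 'm, 'y) module_scheme \<Rightarrow> ('m list \<Rightarrow> 'c) set set" where
  "exterior_nil A M = odd_square (exterior_algebra A M) (exterior_even A M) (exterior_odd A M)"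

definition free_basis ::
  "('c, 'z) ring_scheme \<Rightarrow> ('c, 'm, 'y) module_scheme \<Rightarrow> nat \<Rightarrow> (nat \<Rightarrow> 'm) \<Rightarrow> bool" where
  "free_basis A M q \<theta> \<longleftrightarrow>
    \<theta> \<in> {1..q} \<rightarrow> carrier M \<and>
    (\<forall>x\<in>carrier M. \<exists>!c. c \<in> {1..q} \<rightarrow>\<^sub>E carrier A \<and> x = (\<Oplus>\<^bsub>M\<^esub>i\<in>{1..q}. c i \<odot>\<^bsub>M\<^esub> \<theta> i))"


section \<open>The smooth operations on the even part of the exterior algebra\<close>

text \<open>The real scalar \<open>r\<close> acts as the element \<open>r \<cdot> 1\<close> of the smooth ring.\<close>

definition ext_scale ::
  "'c set \<Rightarrow> (rfun \<Rightarrow> 'c list \<Rightarrow> 'c) \<Rightarrow> ('c, 'm, 'y) module_scheme \<Rightarrow> real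
    \<Rightarrow> ('m list \<Rightarrow> 'c) set \<Rightarrow> ('m list \<Rightarrow> 'c) set" where
  "ext_scale C \<phi> M r F =
    (let A = cinf_cring C \<phi> in
      exterior_scalar A M (cinf_scale \<phi> r \<one>\<^bsub>A\<^esub>) \<otimes>\<^bsub>exterior_algebra A M\<^esub> F)"

definition ext_body ::
  "('c, 'z) ring_scheme \<Rightarrow> ('c, 'm, 'y) module_scheme \<Rightarrow> ('m list \<Rightarrow> 'c) set \<Rightarrow> 'c" where
  "ext_body A M F = (THE f. f \<in> carrier A \<and>
    (\<exists>N\<in>exterior_nil A M. F = exterior_scalar A M f \<oplus>\<^bsub>exterior_algebra A M\<^esub> N))"

definition ext_soul ::
  "('c, 'z) ring_scheme \<Rightarrow> ('c, 'm, 'y) module_scheme \<Rightarrow> ('m list \<Rightarrow> 'c) set \<Rightarrow> ('m list \<Rightarrow> 'c) set"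
  where "ext_soul A M F = (THE N. N \<in> exterior_nil A M \<and>
    (\<exists>f\<in>carrier A. F = exterior_scalar A M f \<oplus>\<^bsub>exterior_algebra A M\<^esub> N))"

text \<open>
  The degree n term of the Taylor expansion of \<open>h\<close> at \<open>fs = [f\<^sub>1, \<dots>, f\<^sub>k]\<close> in the
  direction \<open>Ns = [N\<^sub>1, \<dots>, N\<^sub>k]\<close>; the lists \<open>js\<close> are the multi-indices
  \<open>(j\<^sub>1, \<dots>, j\<^sub>n)\<close>, with entries numbered from 0.
\<close>

definition taylor_term ::
  "'c set \<Rightarrow> (rfun \<Rightarrow> 'c list \<Rightarrow> 'c) \<Rightarrow> ('c, 'm, 'y) module_scheme \<Rightarrow> rfun
    \<Rightarrow> 'c list \<Rightarrow> ('m list \<Rightarrow> 'c) set list \<Rightarrow> nat \<Rightarrow> ('m list \<Rightarrow> 'c) set" where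
  "taylor_term C \<phi> M h fs Ns n =
    (let A = cinf_cring C \<phi>; R = exterior_algebra A M in
      ext_scale C \<phi> M (1 / fact n)
        (\<Oplus>\<^bsub>R\<^esub>js\<in>{js \<in> lists {..<length fs}. length js = n}.
          exterior_scalar A M (\<phi> (pdiffs js h) fs) \<otimes>\<^bsub>R\<^esub>
          foldr (\<lambda>j P. (Ns ! j) \<otimes>\<^bsub>R\<^esub> P) js \<one>\<^bsub>R\<^esub>))"

text \<open>
  The sum over all \<open>n\<close> is the sum of its nonzero terms.  It is meaningful only if these are
  finitely many, since \<^const>\<open>finsum\<close> over an infinite index set is zero by convention.
\<close>

definition ext_op ::
  "'c set \<Rightarrow> (rfun \<Rightarrow> 'c list \<Rightarrow> 'c) \<Rightarrow> ('c, 'm, 'y) module_scheme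
    \<Rightarrow> rfun \<Rightarrow> ('m list \<Rightarrow> 'c) set list \<Rightarrow> ('m list \<Rightarrow> 'c) set" where
  "ext_op C \<phi> M h Fs =
    (let A = cinf_cring C \<phi>; R = exterior_algebra A M;
         t = taylor_term C \<phi> M h (map (ext_body A M) Fs) (map (ext_soul A M) Fs)
     in \<Oplus>\<^bsub>R\<^esub>n\<in>{n. t n \<noteq> \<zero>\<^bsub>R\<^esub>}. t n)"

end

theory Submission
  imports Defs "HOL-Algebra.Subrings"
begin

text \<open>
  Moving the nilpotent part of the arguments by a square-zero element \<open>d\<close>, in a direction \<open>c\<close>,
  changes the Taylor sum of \<open>h\<close> by \<open>d\<close> times the Taylor sums of the partial derivatives of \<open>h\<close>
  paired with \<open>c\<close>; this uses only the symmetry of second partial derivatives.  The ideal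
  generated by products of two odd elements is additively generated by square-zero elements (the
  classes of scaled words of positive even length), so every tuple of nilpotent parts is reached
  from zero by such moves.  Multiplicativity and the composition axiom hold at the zero tuple by
  the axioms for \<open>C\<close>, and they survive each move by the product rule and the chain rule.
  On the algebraic side, the exterior ideal is homogeneous for the parity of words, which gives
  the superring structure, and its elements have no constant term, which gives the splitting of an
  even element into body and nilpotent part.  Words longer than \<open>q\<close> vanish because they expand
  into words in the basis with a repeated letter.
\<close>

section \<open>Smooth functions\<close>

text \<open>The obstacle is the composition axiom: substituting one Taylor sum into another and
  comparing coefficients would call for the higher chain rule with all its multi-index
  combinatorics. A square-zero move by \<open>d\<close> calls only for the first-order chain rule,
  since every term containing \<open>d\<close> twice disappears; of the factorials only (n+1)/(n+1)!
  = 1/n! is used. The price is that a move relates a sum truncated at degree m+1 to sums of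
  derivatives truncated at degree m. This is harmless as soon as products of more than m nilpotent
  parts vanish. The value m = \<open>q div 2\<close> arises because nilpotent parts are built from
  words of length at least 2, so more than \<open>q div 2\<close> of them give words longer than q.
  The argument runs in an arbitrary commutative ring with a suitable ideal; the exterior algebra
  enters only when these properties are verified for its even part. That smooth functions compose is
  itself to be shown: smoothness is defined by iterated partial derivatives along coordinate lines,
  so the chain rule is derived from the mean value theorem.\<close>

lemma tendsto_fun_comp:
  fixes f :: rfun and w :: "'a \<Rightarrow> nat \<Rightarrow> real"
  assumes "continuous_on UNIV f" and "\<And>i. ((\<lambda>t. w t i) \<longlongrightarrow> w0 i) F"
  shows "((\<lambda>t. f (w t)) \<longlongrightarrow> f w0) F"
proof -
  have "limitin (product_topology (\<lambda>i. euclidean) UNIV) w w0 F"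
    using assms(2) by (subst limitin_componentwise) auto
  then have "(w \<longlongrightarrow> w0) F"
    by (simp add: euclidean_product_topology)
  then show ?thesis
    using assms(1) by (auto simp: continuous_on_def intro: tendsto_compose[of f w0])
qed

text \<open>Smoothness is a greatest fixed point: a set of local, continuous, partially
  differentiable functions that is closed under \<open>pdiff\<close> is never left by
  \<open>pdiffs js f\<close>. This avoids formulas for iterated derivatives.\<close>

lemma smooth_coinduct:
  assumes "f \<in> S"
    and loc: "\<And>f x y. f \<in> S \<Longrightarrow> (\<And>i. i < n \<Longrightarrow> x i = y i) \<Longrightarrow> f x = f y"
    and cont: "\<And>f. f \<in> S \<Longrightarrow> continuous_on UNIV f"
    and diff: "\<And>f j x. f \<in> S \<Longrightarrow> j < n \<Longrightarrow> (\<lambda>t. f (x(j := t))) differentiable (at (x j))"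
    and pd: "\<And>f j. f \<in> S \<Longrightarrow> j < n \<Longrightarrow> pdiff j f \<in> S"
  shows "f \<in> smooth n"
proof -
  have "pdiffs js f \<in> S" if "js \<in> lists {..<n}" for js
    using that by induction (auto simp: pdiffs_def \<open>f \<in> S\<close> pd)
  moreover have "\<forall>x y. (\<forall>i<n. x i = y i) \<longrightarrow> f x = f y"
    using loc[OF \<open>f \<in> S\<close>] by blast
  ultimately show ?thesis
    unfolding smooth_def by (blast intro: cont diff)
qed

lemma pdiffs_Nil [simp]: "pdiffs [] f = f"
  by (simp add: pdiffs_def)

text \<open>\<open>foldr\<close> applies the last index first, so appending an index differentiates
  the innermost function. Derivatives of \<open>pdiff j f\<close> thus become derivatives of
  \<open>f\<close>, and Taylor coefficients can recurse in the function.\<close>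

lemma pdiffs_snoc: "pdiffs (js @ [j]) f = pdiffs js (pdiff j f)"
  by (simp add: pdiffs_def)

lemma smooth_local: "f \<in> smooth n \<Longrightarrow> (\<And>i. i < n \<Longrightarrow> x i = y i) \<Longrightarrow> f x = f y"
  unfolding smooth_def by blast

lemma smooth_continuous: "f \<in> smooth n \<Longrightarrow> continuous_on UNIV f"
  unfolding smooth_def by (auto dest: bspec[of _ _ "[]"])

lemma smooth_differentiable:
  assumes "f \<in> smooth n" "j < n"
  shows "(\<lambda>t. f (x(j := t))) differentiable (at (x j))"
proof -
  have "[] \<in> lists {..<n}" by simp
  then have "(\<lambda>t. pdiffs [] f (x(j := t))) differentiable (at (x j))"
    using assms unfolding smooth_def by blast
  then show ?thesis by simp
qed

lemma smooth_pdiff: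
  assumes "f \<in> smooth n" "j < n"
  shows "pdiff j f \<in> smooth n"
proof -
  have "pdiff j f x = pdiff j f y" if "\<And>i. i < n \<Longrightarrow> x i = y i" for x y
  proof -
    have "f (x(j := t)) = f (y(j := t))" for t
      using that by (intro smooth_local[OF assms(1)]) auto
    then show ?thesis
      using that[OF assms(2)] by (simp add: pdiff_def)
  qed
  moreover have "continuous_on UNIV (pdiffs js (pdiff j f)) \<and>
      (\<forall>i<n. \<forall>x. (\<lambda>t. pdiffs js (pdiff j f) (x(i := t))) differentiable (at (x i)))"
    if "js \<in> lists {..<n}" for js
  proof -
    have "js @ [j] \<in> lists {..<n}"
      using that assms(2) by simp
    then show ?thesis
      using assms(1) unfolding smooth_def pdiffs_snoc[symmetric] by blast
  qed
  ultimately show ?thesis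
    unfolding smooth_def by blast
qed

lemma smooth_pdiffs: "f \<in> smooth n \<Longrightarrow> js \<in> lists {..<n} \<Longrightarrow> pdiffs js f \<in> smooth n"
  by (induction js) (auto simp: pdiffs_def smooth_pdiff)

section \<open>The chain rule for functions with continuous partial derivatives\<close>

lemma smooth_has_pdiff:
  assumes "f \<in> smooth n" "j < n"
  shows "((\<lambda>t. f (x(j := t))) has_real_derivative pdiff j f (x(j := s))) (at s)"
  using smooth_differentiable[OF assms, of "x(j := s)"]
  by (auto simp: pdiff_def real_differentiable_def dest: DERIV_imp_deriv)

text \<open>Only partial derivatives are available, so the coordinates are moved one at a time. By
  the mean value theorem each step is the increment of one coordinate times a partial derivative at
  an intermediate point, and continuity of that derivative gives the limit.\<close>

lemma smooth_chain_rule: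
  assumes g: "g \<in> smooth n"
    and y: "\<And>i. i < n \<Longrightarrow> (y i has_real_derivative y' i) (at t0)"
  shows "((\<lambda>t. g (\<lambda>i. y i t)) has_real_derivative
           (\<Sum>i<n. pdiff i g (\<lambda>i. y i t0) * y' i)) (at t0)"
proof -
  \<comment> \<open>The first \<open>k\<close> coordinates follow the curve and the others stay
    frozen at time \<open>t0\<close>; increasing \<open>k\<close> releases one more
    coordinate.\<close>
  have "((\<lambda>t. g (\<lambda>i. if i < k then y i t else y i t0)) has_real_derivative
           (\<Sum>i<k. pdiff i g (\<lambda>i. y i t0) * y' i)) (at t0)" if "k \<le> n" for k
    using that
  proof (induction k)
    case 0
    then show ?case by simp
  next
    case (Suc k)
    define u where "u t = (\<lambda>i. if i < k then y i t else y i t0)" for t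
    define d where "d t = g ((u t)(k := y k t)) - g (u t)" for t
    have uk: "(u t)(k := y k t0) = u t" for t
      by (auto simp: u_def)
    have u0: "u t0 = (\<lambda>i. y i t0)"
      by (auto simp: u_def)
    \<comment> \<open>The bound on \<open>z\<close>, rather than membership in an open interval,
      also covers \<open>y k t = y k t0\<close>, where there is no interval for the mean value
      theorem. It forces \<open>z\<close> to tend to \<open>y k t0\<close>.\<close>
    have "\<exists>z. \<bar>z - y k t0\<bar> \<le> \<bar>y k t - y k t0\<bar> \<and>
              d t = (y k t - y k t0) * pdiff k g ((u t)(k := z))" for t
    proof -
      have D: "((\<lambda>s. g ((u t)(k := s))) has_real_derivative pdiff k g ((u t)(k := s))) (at s)" for s
        using smooth_has_pdiff[OF g, of k] Suc.prems by simp
      consider "y k t = y k t0" | "y k t0 < y k t" | "y k t < y k t0" by linarith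
      then show ?thesis
      proof cases
        case 1
        then show ?thesis by (auto simp: d_def uk)
      next
        case 2
        obtain z where "y k t0 < z" "z < y k t"
          "g ((u t)(k := y k t)) - g ((u t)(k := y k t0)) = (y k t - y k t0) * pdiff k g ((u t)(k := z))"
          using MVT2[OF 2 D] by blast
        then show ?thesis by (intro exI[of _ z]) (auto simp: d_def uk)
      next
        case 3
        obtain z where "y k t < z" "z < y k t0"
          "g ((u t)(k := y k t0)) - g ((u t)(k := y k t)) = (y k t0 - y k t) * pdiff k g ((u t)(k := z))"
          using MVT2[OF 3 D] by blast
        then show ?thesis by (intro exI[of _ z]) (auto simp: d_def uk algebra_simps)
      qed
    qed
    then obtain z where z: "\<And>t. \<bar>z t - y k t0\<bar> \<le> \<bar>y k t - y k t0\<bar>"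
      and dz: "\<And>t. d t = (y k t - y k t0) * pdiff k g ((u t)(k := z t))"
      by metis
    have lim: "((\<lambda>t. y i t) \<longlongrightarrow> y i t0) (at t0)" if "i < n" for i
      using DERIV_isCont[OF y[OF that]] by (simp add: isCont_def)
    have "((\<lambda>t. y k t - y k t0) \<longlongrightarrow> 0) (at t0)"
      using lim[of k] Suc.prems by (simp add: LIM_zero)
    then have "((\<lambda>t. z t - y k t0) \<longlongrightarrow> 0) (at t0)"
      by (rule Lim_null_comparison[rotated, OF tendsto_rabs_zero]) (simp add: z)
    then have limz: "((\<lambda>t. z t) \<longlongrightarrow> y k t0) (at t0)"
      by (simp add: LIM_zero_iff)
    have "((\<lambda>t. pdiff k g ((u t)(k := z t))) \<longlongrightarrow> pdiff k g (\<lambda>i. y i t0)) (at t0)"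
    proof (rule tendsto_fun_comp[where f = "pdiff k g"])
      show "continuous_on UNIV (pdiff k g)"
        using Suc.prems by (intro smooth_continuous[OF smooth_pdiff[OF g]]) simp
      show "((\<lambda>t. ((u t)(k := z t)) i) \<longlongrightarrow> y i t0) (at t0)" for i
        using limz lim[of i] Suc.prems by (cases "i = k"; cases "i < k") (auto simp: u_def)
    qed
    moreover have "((\<lambda>t. (y k t - y k t0) / (t - t0)) \<longlongrightarrow> y' k) (at t0)"
      using y[of k] Suc.prems by (simp add: has_field_derivative_iff)
    ultimately have "((\<lambda>t. pdiff k g ((u t)(k := z t)) * ((y k t - y k t0) / (t - t0)))
        \<longlongrightarrow> pdiff k g (\<lambda>i. y i t0) * y' k) (at t0)"
      by (rule tendsto_mult)
    then have "(d has_real_derivative pdiff k g (\<lambda>i. y i t0) * y' k) (at t0)"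
      by (simp add: has_field_derivative_iff dz mult.commute)
    moreover have "((\<lambda>t. g (u t)) has_real_derivative (\<Sum>i<k. pdiff i g (\<lambda>i. y i t0) * y' i)) (at t0)"
      using Suc by (simp add: u_def)
    ultimately have "((\<lambda>t. g (u t) + d t) has_real_derivative
        (\<Sum>i<Suc k. pdiff i g (\<lambda>i. y i t0) * y' i)) (at t0)"
      by (auto intro: DERIV_add)
    moreover have "(u t)(k := y k t) = (\<lambda>i. if i < Suc k then y i t else y i t0)" for t
      by (auto simp: u_def)
    ultimately show ?case by (simp add: d_def)
  qed
  from this[of n] have "((\<lambda>t. g (\<lambda>i. if i < n then y i t else y i t0)) has_real_derivative
           (\<Sum>i<n. pdiff i g (\<lambda>i. y i t0) * y' i)) (at t0)" by simp
  \<comment> \<open>The coordinates from \<open>n\<close> on are still frozen, but \<open>g\<close>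
    does not see them.\<close>
  moreover have "g (\<lambda>i. if i < n then y i t else y i t0) = g (\<lambda>i. y i t)" for t
    by (rule smooth_local[OF g]) simp
  ultimately show ?thesis by simp
qed

section \<open>Symmetry of second partial derivatives\<close>

lemma smooth_second_difference:
  assumes f: "f \<in> smooth n" and ij: "i < n" "j < n" "i \<noteq> j" and h: "h > 0"
  shows "\<exists>s t. x i < s \<and> s < x i + h \<and> x j < t \<and> t < x j + h \<and>
    f (x(i := x i + h, j := x j + h)) - f (x(i := x i + h)) - (f (x(j := x j + h)) - f x) =
      h\<^sup>2 * pdiff j (pdiff i f) (x(i := s, j := t))"
proof -
  \<comment> \<open>The second difference is the increment of \<open>F\<close> over an interval of
    length \<open>h\<close>. The derivative of \<open>F\<close> is in turn an increment of
    \<open>G\<close> below, so two mean values produce h squared times a mixed derivative.\<close>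
  define F where "F s = f (x(j := x j + h, i := s)) - f (x(i := s))" for s
  have DF: "(F has_real_derivative pdiff i f (x(j := x j + h, i := s)) - pdiff i f (x(i := s))) (at s)" for s
    unfolding F_def by (intro DERIV_diff smooth_has_pdiff[OF f ij(1)])
  obtain s where s: "x i < s" "s < x i + h"
    "F (x i + h) - F (x i) = h * (pdiff i f (x(j := x j + h, i := s)) - pdiff i f (x(i := s)))"
    using MVT2[of "x i" "x i + h" F, OF _ DF] h by auto
  define G where "G t = pdiff i f (x(i := s, j := t))" for t
  have DG: "(G has_real_derivative pdiff j (pdiff i f) (x(i := s, j := t))) (at t)" for t
    unfolding G_def by (intro smooth_has_pdiff[OF smooth_pdiff[OF f ij(1)] ij(2)])
  obtain t where t: "x j < t" "t < x j + h"
    "G (x j + h) - G (x j) = h * pdiff j (pdiff i f) (x(i := s, j := t))"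
    using MVT2[of "x j" "x j + h" G, OF _ DG] h by auto
  have "x(i := s, j := x j) = x(i := s)" "x(j := x j + h, i := s) = x(i := s, j := x j + h)"
    "x(j := x j + h, i := x i) = x(j := x j + h)"
    "x(j := x j + h, i := x i + h) = x(i := x i + h, j := x j + h)"
    using ij by auto
  then show ?thesis
    using s t by (intro exI[of _ s] exI[of _ t]) (auto simp: F_def G_def power2_eq_square)
qed

text \<open>Both mixed derivatives are continuous and hence limits of the same second difference
  quotient, which is symmetric in \<open>i\<close> and \<open>j\<close>.\<close>

lemma pdiff_commute:
  assumes f: "f \<in> smooth n" and ij: "i < n" "j < n"
  shows "pdiff i (pdiff j f) = pdiff j (pdiff i f)"
proof (cases "i = j")
  case False
  \<comment> \<open>\<open>D h\<close> will be the mixed derivative at the intermediate point. It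
    equals the difference quotient only for positive \<open>h\<close>, which suffices for a limit
    from the right.\<close>
  have *: "\<exists>D. (D \<longlongrightarrow> pdiff j (pdiff i f) x) (at_right 0) \<and>
      (\<forall>h>0. D h = (f (x(i := x i + h, j := x j + h)) - f (x(i := x i + h)) -
        (f (x(j := x j + h)) - f x)) / h\<^sup>2)"
    if ij: "i < n" "j < n" "i \<noteq> j" for i j x
  proof -
    define P where "P h s t \<longleftrightarrow> x i < s \<and> s < x i + h \<and> x j < t \<and> t < x j + h \<and>
      f (x(i := x i + h, j := x j + h)) - f (x(i := x i + h)) - (f (x(j := x j + h)) - f x) =
      h\<^sup>2 * pdiff j (pdiff i f) (x(i := s, j := t))" for h s t
    have "\<exists>s t. h > 0 \<longrightarrow> P h s t" for h
      using smooth_second_difference[OF f ij, of h x] unfolding P_def by blast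
    then obtain s t where "\<And>h. h > 0 \<Longrightarrow> P h (s h) (t h)"
      by metis
    note st = this[unfolded P_def]
    have pos: "\<forall>\<^sub>F h in at_right (0::real). h > 0"
      by (simp add: eventually_at_right_less)
    have "((\<lambda>h. a + h) \<longlongrightarrow> a) (at_right 0)" for a :: real
      by (rule tendsto_eq_intros refl)+ simp
    then have "(s \<longlongrightarrow> x i) (at_right 0)" "(t \<longlongrightarrow> x j) (at_right 0)"
      by (auto intro!: tendsto_sandwich[of "\<lambda>_. x i" s _ "\<lambda>h. x i + h"]
          tendsto_sandwich[of "\<lambda>_. x j" t _ "\<lambda>h. x j + h"] eventually_mono[OF pos] dest: st)
    then have "((\<lambda>h. (x(i := s h, j := t h)) l) \<longlongrightarrow> x l) (at_right 0)" for l
      by (cases "l = j"; cases "l = i") auto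
    moreover have "continuous_on UNIV (pdiff j (pdiff i f))"
      using f ij smooth_continuous smooth_pdiff by blast
    ultimately have "((\<lambda>h. pdiff j (pdiff i f) (x(i := s h, j := t h))) \<longlongrightarrow>
        pdiff j (pdiff i f) x) (at_right 0)"
      by (rule tendsto_fun_comp[where f = "pdiff j (pdiff i f)", rotated])
    then show ?thesis
      using st by (intro exI[of _ "\<lambda>h. pdiff j (pdiff i f) (x(i := s h, j := t h))"]) auto
  qed
  show ?thesis
  proof
    fix x
    obtain D D' where D: "(D \<longlongrightarrow> pdiff j (pdiff i f) x) (at_right 0)"
      "(D' \<longlongrightarrow> pdiff i (pdiff j f) x) (at_right 0)"
      and "\<And>h. h > 0 \<Longrightarrow> D h = (f (x(i := x i + h, j := x j + h)) - f (x(i := x i + h)) -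
        (f (x(j := x j + h)) - f x)) / h\<^sup>2"
      "\<And>h. h > 0 \<Longrightarrow> D' h = (f (x(j := x j + h, i := x i + h)) - f (x(j := x j + h)) -
        (f (x(i := x i + h)) - f x)) / h\<^sup>2"
      using *[OF ij False, of x] *[OF ij(2,1) False[symmetric], of x] by blast
    \<comment> \<open>For distinct indices the two updates commute, so the quotients agree after a
      rearrangement.\<close>
    then have "D h = D' h" if "h > 0" for h
      using that False by (simp add: fun_upd_twist algebra_simps)
    then have "(D' \<longlongrightarrow> pdiff j (pdiff i f) x) (at_right 0)"
      by (intro Lim_transform_eventually[OF D(1)] eventually_mono[OF eventually_at_right_less]) simp
    then show "pdiff i (pdiff j f) x = pdiff j (pdiff i f) x"
      using D(2) tendsto_unique trivial_limit_at_right_real by blast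
  qed
qed simp

section \<open>Constants, coordinates, compositions, sums and products\<close>

lemma pdiff_const [simp]: "pdiff j (\<lambda>_. c) = (\<lambda>_. 0)"
  by (simp add: pdiff_def)

lemma smooth_const: "(\<lambda>_. c) \<in> smooth n"
  by (rule smooth_coinduct[of _ "{\<lambda>_. d |d. True}"]) auto

lemma pdiff_coord: "pdiff j (\<lambda>x. x i) = (\<lambda>_. if i = j then 1 else 0)"
  by (auto simp: pdiff_def fun_eq_iff)

lemma smooth_coord: "i < n \<Longrightarrow> (\<lambda>x. x i) \<in> smooth n"
proof (rule smooth_coinduct[of _ "insert (\<lambda>x. x i) {\<lambda>_. d |d. True}"])
  show "(\<lambda>t. f (x(j := t))) differentiable (at (x j))"
    if "f \<in> insert (\<lambda>x. x i) {\<lambda>_. d |d. True}" for f :: rfun and j x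
    using that by (cases "i = j") auto
qed (auto simp: pdiff_coord)

lemma comp_has_pdiff:
  assumes g: "g \<in> smooth m" and h: "\<And>i. i < m \<Longrightarrow> h i \<in> smooth n" and "j < n"
  shows "((\<lambda>t. g (\<lambda>i. h i (x(j := t)))) has_real_derivative
           (\<Sum>i<m. pdiff i g (\<lambda>i. h i x) * pdiff j (h i) x)) (at (x j))"
  using smooth_chain_rule[OF g, of "\<lambda>i t. h i (x(j := t))" "\<lambda>i. pdiff j (h i) x" "x j"]
    smooth_has_pdiff[OF h \<open>j < n\<close>, of _ x "x j"] by simp

lemma pdiff_comp:
  assumes "g \<in> smooth m" "\<And>i. i < m \<Longrightarrow> h i \<in> smooth n" "j < n"
  shows "pdiff j (\<lambda>x. g (\<lambda>i. h i x)) = (\<lambda>x. \<Sum>i<m. pdiff i g (\<lambda>i. h i x) * pdiff j (h i) x)"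
proof
  show "pdiff j (\<lambda>x. g (\<lambda>i. h i x)) x = (\<Sum>i<m. pdiff i g (\<lambda>i. h i x) * pdiff j (h i) x)" for x
    by (subst pdiff_def) (rule DERIV_imp_deriv[OF comp_has_pdiff[OF assms]])
qed

text \<open>
  Partial derivatives of a composition are sums of products of compositions, so this set, unlike
  the set of compositions alone, is closed under partial derivatives.
\<close>

inductive_set comp_closure :: "nat \<Rightarrow> rfun set" for n where
  comp: "g \<in> smooth m \<Longrightarrow> (\<And>i. i < m \<Longrightarrow> h i \<in> smooth n) \<Longrightarrow> (\<lambda>x. g (\<lambda>i. h i x)) \<in> comp_closure n"
| add: "f \<in> comp_closure n \<Longrightarrow> g \<in> comp_closure n \<Longrightarrow> (\<lambda>x. f x + g x) \<in> comp_closure n"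
| mult: "f \<in> comp_closure n \<Longrightarrow> g \<in> comp_closure n \<Longrightarrow> (\<lambda>x. f x * g x) \<in> comp_closure n"

lemma comp_closure_sum:
  "(\<And>i. i < (m::nat) \<Longrightarrow> f i \<in> comp_closure n) \<Longrightarrow> (\<lambda>x. \<Sum>i<m. f i x) \<in> comp_closure n"
proof (induction m)
  case 0
  \<comment> \<open>The empty sum has to be written as a composition, the only base case of the
    inductive set.\<close>
  have "(\<lambda>x. (\<lambda>_. 0) (\<lambda>i. (\<lambda>_ _. 0) i x)) \<in> comp_closure n"
    by (rule comp_closure.comp[OF smooth_const, of 0]) (rule smooth_const)
  then show ?case by simp
next
  case (Suc m)
  then have "(\<lambda>x. (\<Sum>i<m. f i x) + f m x) \<in> comp_closure n"
    by (intro comp_closure.add) auto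
  then show ?case by simp
qed

lemma smooth_comp_closure:
  assumes "f \<in> smooth n"
  shows "f \<in> comp_closure n"
  using comp_closure.comp[OF assms, of "\<lambda>i x. x i", OF smooth_coord] by simp

text \<open>Both claims are proved in one induction: \<open>deriv\<close> obeys the sum and product
  rules only where the parts are differentiable, so the first claim uses the second for the
  parts.\<close>

lemma comp_closure_pdiff:
  assumes "f \<in> comp_closure n" "j < n"
  shows "pdiff j f \<in> comp_closure n \<and> (\<forall>x. (\<lambda>t. f (x(j := t))) differentiable (at (x j)))"
  using assms
proof induction
  case (comp g m h)
  have *: "(\<lambda>x. pdiff i g (\<lambda>i. h i x) * pdiff j (h i) x) \<in> comp_closure n" if "i < m" for i
    by (rule comp_closure.mult[OF comp_closure.comp[OF smooth_pdiff[OF comp(1) that], of h, OF comp(2)]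
        smooth_comp_closure[OF smooth_pdiff[OF comp(2)[OF that] comp(3)]]])
  have S: "(\<lambda>x. \<Sum>i<m. pdiff i g (\<lambda>i. h i x) * pdiff j (h i) x) \<in> comp_closure n"
    by (rule comp_closure_sum) (rule *)
  have E: "pdiff j (\<lambda>x. g (\<lambda>i. h i x)) = (\<lambda>x. \<Sum>i<m. pdiff i g (\<lambda>i. h i x) * pdiff j (h i) x)"
    by (rule pdiff_comp) (fact comp)+
  have "pdiff j (\<lambda>x. g (\<lambda>i. h i x)) \<in> comp_closure n"
    unfolding E by (rule S)
  moreover have "(\<lambda>t. g (\<lambda>i. h i (x(j := t)))) differentiable (at (x j))" for x
    unfolding real_differentiable_def by (rule exI, rule comp_has_pdiff) (fact comp)+
  ultimately show ?case by (intro conjI allI)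
next
  case (add f g)
  have d: "(\<lambda>t. f (x(j := t))) differentiable (at (x j))" "(\<lambda>t. g (x(j := t))) differentiable (at (x j))" for x
    by (rule add.IH(1)[OF add.prems, THEN conjunct2, THEN spec], rule add.IH(2)[OF add.prems, THEN conjunct2, THEN spec])
  have E: "pdiff j (\<lambda>x. f x + g x) = (\<lambda>x. pdiff j f x + pdiff j g x)"
  proof
    fix x
    obtain a b where ab: "((\<lambda>t. f (x(j := t))) has_real_derivative a) (at (x j))"
      "((\<lambda>t. g (x(j := t))) has_real_derivative b) (at (x j))"
      using d[of x] by (auto simp: real_differentiable_def)
    show "pdiff j (\<lambda>x. f x + g x) x = pdiff j f x + pdiff j g x"
      using DERIV_imp_deriv[OF DERIV_add[OF ab]] ab[THEN DERIV_imp_deriv]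
      by (simp add: pdiff_def)
  qed
  have "pdiff j (\<lambda>x. f x + g x) \<in> comp_closure n"
    unfolding E by (intro comp_closure.add add.IH[OF add.prems, THEN conjunct1])
  moreover have "(\<lambda>t. f (x(j := t)) + g (x(j := t))) differentiable (at (x j))" for x
    by (rule differentiable_add[OF d])
  ultimately show ?case by (intro conjI allI)
next
  case (mult f g)
  have d: "(\<lambda>t. f (x(j := t))) differentiable (at (x j))" "(\<lambda>t. g (x(j := t))) differentiable (at (x j))" for x
    by (rule mult.IH(1)[OF mult.prems, THEN conjunct2, THEN spec], rule mult.IH(2)[OF mult.prems, THEN conjunct2, THEN spec])
  have E: "pdiff j (\<lambda>x. f x * g x) = (\<lambda>x. pdiff j f x * g x + pdiff j g x * f x)"
  proof
    fix x
    obtain a b where ab: "((\<lambda>t. f (x(j := t))) has_real_derivative a) (at (x j))"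
      "((\<lambda>t. g (x(j := t))) has_real_derivative b) (at (x j))"
      using d[of x] by (auto simp: real_differentiable_def)
    show "pdiff j (\<lambda>x. f x * g x) x = pdiff j f x * g x + pdiff j g x * f x"
      using DERIV_imp_deriv[OF DERIV_mult[OF ab]] ab[THEN DERIV_imp_deriv]
      by (simp add: pdiff_def)
  qed
  have "pdiff j (\<lambda>x. f x * g x) \<in> comp_closure n"
    unfolding E by (intro comp_closure.add comp_closure.mult mult.hyps mult.IH[OF mult.prems, THEN conjunct1])
  moreover have "(\<lambda>t. f (x(j := t)) * g (x(j := t))) differentiable (at (x j))" for x
    by (rule differentiable_mult[OF d])
  ultimately show ?case by (intro conjI allI)
qed

lemma comp_closure_smooth:
  assumes "f \<in> comp_closure n"
  shows "f \<in> smooth n"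
proof (rule smooth_coinduct[of _ "comp_closure n"])
  show "f x = f y" if "f \<in> comp_closure n" "\<And>i. i < n \<Longrightarrow> x i = y i" for f x y
    using that(1)
  proof induction
    case (comp g m h)
    show ?case
      by (rule smooth_local[OF comp(1)], rule smooth_local[OF comp(2)]) (assumption | rule that(2))+
  qed simp_all
  show "continuous_on UNIV f" if "f \<in> comp_closure n" for f
    using that
  proof induction
    case (comp g m h)
    \<comment> \<open>The functions \<open>h i\<close> with i \<ge> m are arbitrary and possibly
      discontinuous. Replacing them by 0 gives a continuous map into the product and does not change
      the value of \<open>g\<close>.\<close>
    define h' where "h' x = (\<lambda>i. if i < m then h i x else 0)" for x
    have eq: "g (\<lambda>i. h i x) = g (h' x)" for x
      by (rule smooth_local[OF comp(1)]) (simp add: h'_def)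
    have "continuous_on UNIV (\<lambda>x. h' x i)" for i
      using comp(2)[THEN smooth_continuous, of i] by (cases "i < m") (auto simp: h'_def)
    then have "continuous_on UNIV h'"
      by (rule continuous_on_coordinatewise_then_product)
    then show ?case
      unfolding eq by (rule continuous_on_compose2[OF smooth_continuous[OF comp(1)]]) simp
  qed (rule continuous_on_add continuous_on_mult; assumption)+
  show "(\<lambda>t. f (x(j := t))) differentiable (at (x j))" if "f \<in> comp_closure n" "j < n" for f j x
    by (rule comp_closure_pdiff[OF that, THEN conjunct2, THEN spec])
  show "pdiff j f \<in> comp_closure n" if "f \<in> comp_closure n" "j < n" for f j
    by (rule comp_closure_pdiff[OF that, THEN conjunct1])
qed (rule assms)

lemma smooth_comp:
  assumes "g \<in> smooth m" "\<And>i. i < m \<Longrightarrow> h i \<in> smooth n"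
  shows "(\<lambda>x. g (\<lambda>i. h i x)) \<in> smooth n"
  by (rule comp_closure_smooth, rule comp_closure.comp[OF assms(1)], rule assms(2))

lemma smooth_add: "f \<in> smooth n \<Longrightarrow> g \<in> smooth n \<Longrightarrow> (\<lambda>x. f x + g x) \<in> smooth n"
  by (rule comp_closure_smooth, rule comp_closure.add; rule smooth_comp_closure)

lemma smooth_mult: "f \<in> smooth n \<Longrightarrow> g \<in> smooth n \<Longrightarrow> (\<lambda>x. f x * g x) \<in> smooth n"
  by (rule comp_closure_smooth, rule comp_closure.mult; rule smooth_comp_closure)

lemma smooth_sum: "(\<And>i. i < (m::nat) \<Longrightarrow> f i \<in> smooth n) \<Longrightarrow> (\<lambda>x. \<Sum>i<m. f i x) \<in> smooth n"
  by (rule comp_closure_smooth, rule comp_closure_sum, rule smooth_comp_closure) blast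

lemma pdiff_add:
  assumes "f \<in> smooth n" "g \<in> smooth n" "j < n"
  shows "pdiff j (\<lambda>x. f x + g x) = (\<lambda>x. pdiff j f x + pdiff j g x)"
proof
  fix x
  show "pdiff j (\<lambda>x. f x + g x) x = pdiff j f x + pdiff j g x"
    using DERIV_imp_deriv[OF DERIV_add[OF smooth_has_pdiff[OF assms(1,3), of x "x j"]
      smooth_has_pdiff[OF assms(2,3), of x "x j"]]] by (simp add: pdiff_def)
qed

lemma pdiff_mult:
  assumes "f \<in> smooth n" "g \<in> smooth n" "j < n"
  shows "pdiff j (\<lambda>x. f x * g x) = (\<lambda>x. pdiff j f x * g x + f x * pdiff j g x)"
proof
  fix x
  show "pdiff j (\<lambda>x. f x * g x) x = pdiff j f x * g x + f x * pdiff j g x"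
    using DERIV_imp_deriv[OF DERIV_mult[OF smooth_has_pdiff[OF assms(1,3), of x "x j"]
      smooth_has_pdiff[OF assms(2,3), of x "x j"]]] by (simp add: pdiff_def)
qed

section \<open>Taylor expansions in a commutative ring\<close>

lemma (in abelian_monoid) finsum_swap:
  assumes "finite I" "finite K" "\<And>i j. i \<in> I \<Longrightarrow> j \<in> K \<Longrightarrow> f i j \<in> carrier G"
  shows "(\<Oplus>i\<in>I. \<Oplus>j\<in>K. f i j) = (\<Oplus>j\<in>K. \<Oplus>i\<in>I. f i j)"
  using assms(1,3)
proof (induction I rule: finite_induct)
  case empty
  then show ?case by simp
next
  case (insert i I)
  then have "(\<Oplus>i\<in>insert i I. \<Oplus>j\<in>K. f i j) = (\<Oplus>j\<in>K. f i j) \<oplus> (\<Oplus>j\<in>K. \<Oplus>i\<in>I. f i j)"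
    by (subst finsum_insert) (auto intro!: finsum_closed)
  also have "\<dots> = (\<Oplus>j\<in>K. f i j \<oplus> (\<Oplus>i\<in>I. f i j))"
    using insert by (intro finsum_addf[symmetric]) (auto intro!: finsum_closed)
  also have "\<dots> = (\<Oplus>j\<in>K. \<Oplus>i\<in>insert i I. f i j)"
    using insert by (intro finsum_cong') (auto intro!: finsum_closed)
  finally show ?case .
qed

text \<open>
  Splitting off the last index of each multi-index makes the degree n term, without the factor
  1/n!, recursive in \<open>h\<close>.  The homomorphism \<open>e\<close> is evaluation at the body of the arguments.
\<close>

primrec taylor_coeff ::
  "('b, 'z) ring_scheme \<Rightarrow> nat \<Rightarrow> (rfun \<Rightarrow> 'b) \<Rightarrow> (nat \<Rightarrow> 'b) \<Rightarrow> nat \<Rightarrow> rfun \<Rightarrow> 'b" where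
  "taylor_coeff B k e N 0 h = e h"
| "taylor_coeff B k e N (Suc n) h =
     (\<Oplus>\<^bsub>B\<^esub>j\<in>{..<k}. N j \<otimes>\<^bsub>B\<^esub> taylor_coeff B k e N n (pdiff j h))"

text \<open>\<open>B\<close> has no separate multiplication by reals: the factor 1/n! is the value
  of \<open>e\<close> at a constant function. The cutoff \<open>m\<close> is explicit because a
  shift of the direction relates two different cutoffs.\<close>

definition taylor_sum ::
  "('b, 'z) ring_scheme \<Rightarrow> nat \<Rightarrow> (rfun \<Rightarrow> 'b) \<Rightarrow> (nat \<Rightarrow> 'b) \<Rightarrow> nat \<Rightarrow> rfun \<Rightarrow> 'b" where
  "taylor_sum B k e N m h =
     (\<Oplus>\<^bsub>B\<^esub>n\<in>{..m}. e (\<lambda>_. 1 / fact n) \<otimes>\<^bsub>B\<^esub> taylor_coeff B k e N n h)"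

text \<open>A unital ring homomorphism from the smooth functions of \<open>k\<close> variables to
  \<open>B\<close>; its restriction to constants makes \<open>B\<close> a real algebra.\<close>

locale smooth_hom = cring B for B (structure) +
  fixes k :: nat and e :: "rfun \<Rightarrow> 'a"
  assumes e_closed [simp]: "h \<in> smooth k \<Longrightarrow> e h \<in> carrier B"
    and e_add: "f \<in> smooth k \<Longrightarrow> g \<in> smooth k \<Longrightarrow> e (\<lambda>x. f x + g x) = e f \<oplus> e g"
    and e_mult: "f \<in> smooth k \<Longrightarrow> g \<in> smooth k \<Longrightarrow> e (\<lambda>x. f x * g x) = e f \<otimes> e g"
    and e_one: "e (\<lambda>_. 1) = \<one>"
begin

abbreviation "coef \<equiv> taylor_coeff B k e"
abbreviation "tay \<equiv> taylor_sum B k e"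

lemma e_const_closed [simp]: "e (\<lambda>_. r) \<in> carrier B"
  by (simp add: smooth_const)

lemma e_zero: "e (\<lambda>_. 0) = \<zero>"
proof -
  have "e (\<lambda>_. 0) \<oplus> e (\<lambda>_. 0) = e (\<lambda>_. 0)"
    using e_add[OF smooth_const smooth_const, of 0 0] by simp
  then show ?thesis
    by (metis e_const_closed add.l_cancel_one' )
qed

lemma e_const_add: "e (\<lambda>_. a + b) = e (\<lambda>_. a) \<oplus> e (\<lambda>_. b)"
  using e_add[OF smooth_const smooth_const] by simp

lemma e_const_mult: "e (\<lambda>_. a * b) = e (\<lambda>_. a) \<otimes> e (\<lambda>_. b)"
  using e_mult[OF smooth_const smooth_const] by simp

lemma coef_closed [simp]:
  assumes "\<And>j. N j \<in> carrier B"
  shows "h \<in> smooth k \<Longrightarrow> coef N n h \<in> carrier B"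
  by (induction n arbitrary: h) (auto intro!: finsum_closed simp: assms smooth_pdiff)

lemma tay_closed [simp]: "(\<And>j. N j \<in> carrier B) \<Longrightarrow> h \<in> smooth k \<Longrightarrow> tay N m h \<in> carrier B"
  unfolding taylor_sum_def by (auto intro!: finsum_closed)

lemma tay_0: "(\<And>j. N j \<in> carrier B) \<Longrightarrow> h \<in> smooth k \<Longrightarrow> tay N 0 h = e h"
  unfolding taylor_sum_def by (simp add: e_one)

lemma tay_Suc: "(\<And>j. N j \<in> carrier B) \<Longrightarrow> h \<in> smooth k \<Longrightarrow>
    tay N (Suc m) h = e (\<lambda>_. 1 / fact (Suc m)) \<otimes> coef N (Suc m) h \<oplus> tay N m h"
  unfolding taylor_sum_def by (subst finsum_Suc) (auto simp del: taylor_coeff.simps)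

lemma coef_add:
  assumes "\<And>j. N j \<in> carrier B"
  shows "f \<in> smooth k \<Longrightarrow> g \<in> smooth k \<Longrightarrow> coef N n (\<lambda>x. f x + g x) = coef N n f \<oplus> coef N n g"
proof (induction n arbitrary: f g)
  case 0
  then show ?case by (simp add: e_add)
next
  case (Suc n)
  have "coef N (Suc n) (\<lambda>x. f x + g x) =
      (\<Oplus>j\<in>{..<k}. N j \<otimes> coef N n (pdiff j f) \<oplus> N j \<otimes> coef N n (pdiff j g))"
    unfolding taylor_coeff.simps
    using assms Suc by (intro finsum_cong') (auto simp: pdiff_add smooth_pdiff r_distr)
  also have "\<dots> = coef N (Suc n) f \<oplus> coef N (Suc n) g"
    unfolding taylor_coeff.simps using assms Suc by (intro finsum_addf) (auto simp: smooth_pdiff)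
  finally show ?case .
qed

lemma coef_const:
  assumes "\<And>j. N j \<in> carrier B"
  shows "coef N (Suc n) (\<lambda>_. c) = \<zero>"
proof -
  have "coef N n (\<lambda>_. 0) = \<zero>" for n
    by (induction n) (auto simp: e_zero assms intro!: add.finprod_one_eqI)
  then show ?thesis
    by (auto simp: assms intro!: add.finprod_one_eqI)
qed

lemma tay_add:
  assumes N: "\<And>j. N j \<in> carrier B" and fg: "f \<in> smooth k" "g \<in> smooth k"
  shows "tay N m (\<lambda>x. f x + g x) = tay N m f \<oplus> tay N m g"
  unfolding taylor_sum_def
  by (subst finsum_addf[symmetric]) (auto simp: N fg coef_add r_distr smooth_add intro!: finsum_cong')

lemma tay_const:
  assumes N: "\<And>j. N j \<in> carrier B"
  shows "tay N m (\<lambda>_. c) = e (\<lambda>_. c)"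
  by (induction m) (auto simp: N tay_0 tay_Suc smooth_const coef_const simp del: taylor_coeff.simps)

lemma tay_sum:
  assumes N: "\<And>j. N j \<in> carrier B"
  shows "(\<And>i. i < (n::nat) \<Longrightarrow> f i \<in> smooth k) \<Longrightarrow>
    tay N m (\<lambda>x. \<Sum>i<n. f i x) = (\<Oplus>i\<in>{..<n}. tay N m (f i))"
proof (induction n)
  case 0
  then show ?case by (simp add: tay_const N e_zero)
next
  case (Suc n)
  have "tay N m (\<lambda>x. \<Sum>i<Suc n. f i x) = tay N m (\<lambda>x. (\<Sum>i<n. f i x) + f n x)"
    by simp
  also have "\<dots> = (\<Oplus>i\<in>{..<n}. tay N m (f i)) \<oplus> tay N m (f n)"
    using Suc by (subst tay_add[OF N smooth_sum]) auto
  also have "\<dots> = (\<Oplus>i\<in>{..<Suc n}. tay N m (f i))"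
    using Suc.prems by (subst lessThan_Suc, subst finsum_insert) (auto simp: N a_comm finsum_closed)
  finally show ?case .
qed

text \<open>In a product of n+1 factors \<open>N j \<oplus> d \<otimes> c j\<close> only the terms
  with at most one \<open>d\<close> survive. That \<open>d\<close> may come from any of the n+1
  positions, and since partial derivatives commute all positions contribute the same, whence the
  factor \<open>real (Suc n)\<close>.\<close>

lemma coef_shift:
  assumes N: "\<And>j. N j \<in> carrier B" and c: "\<And>j. c j \<in> carrier B"
    and d: "d \<in> carrier B" "d \<otimes> d = \<zero>"
  shows "h \<in> smooth k \<Longrightarrow> coef (\<lambda>j. N j \<oplus> d \<otimes> c j) (Suc n) h =
    coef N (Suc n) h \<oplus> e (\<lambda>_. real (Suc n)) \<otimes> (d \<otimes> (\<Oplus>l\<in>{..<k}. c l \<otimes> coef N n (pdiff l h)))"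
proof (induction n arbitrary: h)
  case 0
  have "coef (\<lambda>j. N j \<oplus> d \<otimes> c j) (Suc 0) h =
      (\<Oplus>j\<in>{..<k}. N j \<otimes> e (pdiff j h) \<oplus> d \<otimes> (c j \<otimes> e (pdiff j h)))"
    unfolding taylor_coeff.simps
    using 0 by (intro finsum_cong') (auto simp: N c d smooth_pdiff l_distr m_assoc)
  also have "\<dots> = (\<Oplus>j\<in>{..<k}. N j \<otimes> e (pdiff j h)) \<oplus> (\<Oplus>j\<in>{..<k}. d \<otimes> (c j \<otimes> e (pdiff j h)))"
    using 0 by (intro finsum_addf) (auto simp: N c d smooth_pdiff)
  also have "(\<Oplus>j\<in>{..<k}. d \<otimes> (c j \<otimes> e (pdiff j h))) = d \<otimes> (\<Oplus>j\<in>{..<k}. c j \<otimes> e (pdiff j h))"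
    using 0 by (intro finsum_rdistr[symmetric]) (auto simp: N c d smooth_pdiff)
  finally show ?case
    using 0 by (simp add: e_one c d smooth_pdiff finsum_closed)
next
  case (Suc n)
  define D where "D n h = (\<Oplus>l\<in>{..<k}. c l \<otimes> coef N n (pdiff l h))" for n h
  have D_closed: "D n h \<in> carrier B" if "h \<in> smooth k" for n h
    unfolding D_def using that by (auto simp: N c smooth_pdiff intro!: finsum_closed)
  let ?s = "e (\<lambda>_. real (Suc n))"
  \<comment> \<open>The last summand takes \<open>d\<close> from the outermost factor, the one
    before it takes \<open>d\<close> from the inner factors; taking it from both gives
    \<open>d \<otimes> d\<close>.\<close>
  have expand: "(N j \<oplus> d \<otimes> c j) \<otimes> (x \<oplus> ?s \<otimes> (d \<otimes> y)) =
      (N j \<otimes> x \<oplus> ?s \<otimes> (d \<otimes> (N j \<otimes> y))) \<oplus> d \<otimes> (c j \<otimes> x)"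
    if "x \<in> carrier B" "y \<in> carrier B" for x y j
  proof -
    have "(u \<oplus> d \<otimes> v) \<otimes> (x \<oplus> s \<otimes> (d \<otimes> y)) =
      (u \<otimes> x \<oplus> s \<otimes> (d \<otimes> (u \<otimes> y))) \<oplus> d \<otimes> (v \<otimes> x) \<oplus> (d \<otimes> d) \<otimes> (v \<otimes> (s \<otimes> y))"
      if "u \<in> carrier B" "v \<in> carrier B" "s \<in> carrier B" for u v s
      using that \<open>x \<in> carrier B\<close> \<open>y \<in> carrier B\<close> d(1) by algebra
    from this[OF N[of j] c[of j] e_const_closed] show ?thesis
      using that N c d by simp
  qed
  \<comment> \<open>The shifted position is exchanged with the outermost one; this is where the
    symmetry of second derivatives enters.\<close>
  have swap: "(\<Oplus>j\<in>{..<k}. N j \<otimes> D n (pdiff j h)) = D (Suc n) h"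
  proof -
    have "(\<Oplus>j\<in>{..<k}. N j \<otimes> D n (pdiff j h)) =
        (\<Oplus>j\<in>{..<k}. \<Oplus>l\<in>{..<k}. N j \<otimes> (c l \<otimes> coef N n (pdiff l (pdiff j h))))"
      unfolding D_def using Suc.prems
      by (intro finsum_cong' finsum_rdistr) (auto simp: N c smooth_pdiff intro!: finsum_closed)
    also have "\<dots> = (\<Oplus>l\<in>{..<k}. \<Oplus>j\<in>{..<k}. N j \<otimes> (c l \<otimes> coef N n (pdiff l (pdiff j h))))"
      using Suc.prems by (intro finsum_swap) (auto simp: N c smooth_pdiff)
    also have "\<dots> = (\<Oplus>l\<in>{..<k}. \<Oplus>j\<in>{..<k}. c l \<otimes> (N j \<otimes> coef N n (pdiff j (pdiff l h))))"
      using Suc.prems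
      by (intro finsum_cong') (auto simp: N c smooth_pdiff m_lcomm pdiff_commute[of h k] intro!: finsum_closed)
    also have "\<dots> = D (Suc n) h"
      unfolding D_def taylor_coeff.simps using Suc.prems
      by (intro finsum_cong' finsum_rdistr[symmetric]) (auto simp: N c smooth_pdiff intro!: finsum_closed)
    finally show ?thesis .
  qed
  let ?x = "\<lambda>j. coef N (Suc n) (pdiff j h)"
  have cl: "?x j \<in> carrier B" "D n (pdiff j h) \<in> carrier B" if "j < k" for j
    using that Suc.prems by (auto simp: N D_closed smooth_pdiff simp del: taylor_coeff.simps)
  have "coef (\<lambda>j. N j \<oplus> d \<otimes> c j) (Suc (Suc n)) h =
      (\<Oplus>j\<in>{..<k}. (N j \<otimes> ?x j \<oplus> ?s \<otimes> (d \<otimes> (N j \<otimes> D n (pdiff j h)))) \<oplus> d \<otimes> (c j \<otimes> ?x j))"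
    unfolding taylor_coeff.simps(2)[of B k e _ "Suc n"]
  proof (intro finsum_cong')
    show "(N j \<oplus> d \<otimes> c j) \<otimes> coef (\<lambda>j. N j \<oplus> d \<otimes> c j) (Suc n) (pdiff j h) =
      (N j \<otimes> ?x j \<oplus> ?s \<otimes> (d \<otimes> (N j \<otimes> D n (pdiff j h)))) \<oplus> d \<otimes> (c j \<otimes> ?x j)"
      if "j \<in> {..<k}" for j
      using that Suc.IH[of "pdiff j h"] Suc.prems expand[OF cl, of j j j]
      by (simp add: smooth_pdiff D_def del: taylor_coeff.simps)
  qed (use cl N c d in auto)
  also have "\<dots> = (\<Oplus>j\<in>{..<k}. N j \<otimes> ?x j \<oplus> ?s \<otimes> (d \<otimes> (N j \<otimes> D n (pdiff j h)))) \<oplus>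
      (\<Oplus>j\<in>{..<k}. d \<otimes> (c j \<otimes> ?x j))"
    by (intro finsum_addf) (use cl N c d in auto)
  also have "(\<Oplus>j\<in>{..<k}. N j \<otimes> ?x j \<oplus> ?s \<otimes> (d \<otimes> (N j \<otimes> D n (pdiff j h)))) =
      (\<Oplus>j\<in>{..<k}. N j \<otimes> ?x j) \<oplus> (\<Oplus>j\<in>{..<k}. ?s \<otimes> (d \<otimes> (N j \<otimes> D n (pdiff j h))))"
    by (intro finsum_addf) (use cl N c d in auto)
  also have "(\<Oplus>j\<in>{..<k}. ?s \<otimes> (d \<otimes> (N j \<otimes> D n (pdiff j h)))) = ?s \<otimes> (\<Oplus>j\<in>{..<k}. d \<otimes> (N j \<otimes> D n (pdiff j h)))"
    by (intro finsum_rdistr[symmetric]) (use cl N c d in auto)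
  also have "(\<Oplus>j\<in>{..<k}. d \<otimes> (N j \<otimes> D n (pdiff j h))) = d \<otimes> (\<Oplus>j\<in>{..<k}. N j \<otimes> D n (pdiff j h))"
    by (intro finsum_rdistr[symmetric]) (use cl N c d in auto)
  also have "(\<Oplus>j\<in>{..<k}. d \<otimes> (c j \<otimes> ?x j)) = d \<otimes> (\<Oplus>j\<in>{..<k}. c j \<otimes> ?x j)"
    by (intro finsum_rdistr[symmetric]) (use cl N c d in auto)
  also have "(\<Oplus>j\<in>{..<k}. c j \<otimes> ?x j) = D (Suc n) h"
    by (simp only: D_def)
  also have "(\<Oplus>j\<in>{..<k}. N j \<otimes> ?x j) = coef N (Suc (Suc n)) h"
    by (simp only: taylor_coeff.simps(2)[of B k e _ "Suc n"])
  also note swap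
  \<comment> \<open>The inner positions contribute \<open>?s\<close> and the outermost one
    contributes 1.\<close>
  also have "e (\<lambda>_. real (Suc (Suc n))) = ?s \<oplus> \<one>"
    using e_const_add[of "real (Suc n)" 1] by (simp add: e_one add.commute)
  then have "coef N (Suc (Suc n)) h \<oplus> ?s \<otimes> (d \<otimes> D (Suc n) h) \<oplus> d \<otimes> D (Suc n) h =
      coef N (Suc (Suc n)) h \<oplus> e (\<lambda>_. real (Suc (Suc n))) \<otimes> (d \<otimes> D (Suc n) h)"
    using D_closed[OF Suc.prems] d N Suc.prems
    by (simp add: a_assoc l_distr del: taylor_coeff.simps)
  finally show ?case
    by (simp only: D_def)
qed

text \<open>The change of the term of degree n+1 consists of degree n terms of the derivatives, with
  the right factorials. Hence the cutoff on the derivatives is one lower.\<close>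

lemma tay_shift:
  assumes N: "\<And>j. N j \<in> carrier B" and c: "\<And>j. c j \<in> carrier B"
    and d: "d \<in> carrier B" "d \<otimes> d = \<zero>" and h: "h \<in> smooth k"
  shows "tay (\<lambda>j. N j \<oplus> d \<otimes> c j) (Suc m) h =
    tay N (Suc m) h \<oplus> d \<otimes> (\<Oplus>l\<in>{..<k}. c l \<otimes> tay N m (pdiff l h))"
proof -
  have N': "N j \<oplus> d \<otimes> c j \<in> carrier B" for j
    using N c d by simp
  let ?S = "\<lambda>m. d \<otimes> (\<Oplus>l\<in>{..<k}. c l \<otimes> tay N m (pdiff l h))"
  have cl: "tay N m (pdiff l h) \<in> carrier B" "coef N m (pdiff l h) \<in> carrier B" if "l < k" for m l
    using h N that by (auto simp: smooth_pdiff)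
  have E: "e (\<lambda>_. 1 / fact (Suc m)) \<otimes> coef (\<lambda>j. N j \<oplus> d \<otimes> c j) (Suc m) h =
      e (\<lambda>_. 1 / fact (Suc m)) \<otimes> coef N (Suc m) h \<oplus>
      d \<otimes> (\<Oplus>l\<in>{..<k}. c l \<otimes> (e (\<lambda>_. 1 / fact m) \<otimes> coef N m (pdiff l h)))" for m
  proof -
    let ?D = "\<Oplus>l\<in>{..<k}. c l \<otimes> coef N m (pdiff l h)"
    have D: "?D \<in> carrier B"
      by (intro finsum_closed) (use cl c in auto)
    have X: "coef N (Suc m) h \<in> carrier B"
      using N h by (rule coef_closed)
    have alg: "a \<otimes> (x \<oplus> b \<otimes> (d \<otimes> y)) = a \<otimes> x \<oplus> d \<otimes> ((a \<otimes> b) \<otimes> y)"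
      if "a \<in> carrier B" "b \<in> carrier B" "x \<in> carrier B" "y \<in> carrier B" for a b x y
      using that d(1) by algebra
    have "e (\<lambda>_. 1 / fact (Suc m)) \<otimes> coef (\<lambda>j. N j \<oplus> d \<otimes> c j) (Suc m) h =
        e (\<lambda>_. 1 / fact (Suc m)) \<otimes> coef N (Suc m) h \<oplus>
        d \<otimes> ((e (\<lambda>_. 1 / fact (Suc m)) \<otimes> e (\<lambda>_. real (Suc m))) \<otimes> ?D)"
      unfolding coef_shift[of N c d h m, OF N c d h]
      by (rule alg[OF _ _ X D]) simp_all
    \<comment> \<open>The number of positions turns 1/(m+1)! into 1/m!, so what multiplies
      \<open>d\<close> is again made of Taylor terms.\<close>
    also have "e (\<lambda>_. 1 / fact (Suc m)) \<otimes> e (\<lambda>_. real (Suc m)) = e (\<lambda>_. 1 / fact m)"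
      by (simp add: e_const_mult[symmetric] del: of_nat_Suc)
    also have "e (\<lambda>_. 1 / fact m) \<otimes> ?D = (\<Oplus>l\<in>{..<k}. e (\<lambda>_. 1 / fact m) \<otimes> (c l \<otimes> coef N m (pdiff l h)))"
      by (intro finsum_rdistr) (use cl c in auto)
    also have "\<dots> = (\<Oplus>l\<in>{..<k}. c l \<otimes> (e (\<lambda>_. 1 / fact m) \<otimes> coef N m (pdiff l h)))"
      by (intro finsum_cong') (use cl c m_lcomm in auto)
    finally show ?thesis .
  qed
  show ?thesis
  proof (induction m)
    case 0
    have "(\<Oplus>l\<in>{..<k}. c l \<otimes> (e (\<lambda>_. 1 / fact 0) \<otimes> coef N 0 (pdiff l h))) =
        (\<Oplus>l\<in>{..<k}. c l \<otimes> tay N 0 (pdiff l h))"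
      using h by (intro finsum_cong') (auto simp: N c smooth_pdiff tay_0 e_one)
    moreover have "(\<Oplus>l\<in>{..<k}. c l \<otimes> tay N 0 (pdiff l h)) \<in> carrier B"
      by (intro finsum_closed) (use cl c in auto)
    moreover have "coef N (Suc 0) h \<in> carrier B"
      using N h by (rule coef_closed)
    ultimately show ?case
      using N' N h d E[of 0]
      by (simp add: tay_Suc tay_0 a_ac del: taylor_coeff.simps)
  next
    case (Suc m)
    let ?F = "\<Oplus>l\<in>{..<k}. c l \<otimes> (e (\<lambda>_. 1 / fact (Suc m)) \<otimes> coef N (Suc m) (pdiff l h))"
    let ?G = "\<Oplus>l\<in>{..<k}. c l \<otimes> tay N m (pdiff l h)"
    have FG: "?F \<in> carrier B" "?G \<in> carrier B"
      using cl c by (auto intro!: finsum_closed simp del: taylor_coeff.simps)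
    have "(\<Oplus>l\<in>{..<k}. c l \<otimes> tay N (Suc m) (pdiff l h)) = (\<Oplus>l\<in>{..<k}.
        c l \<otimes> (e (\<lambda>_. 1 / fact (Suc m)) \<otimes> coef N (Suc m) (pdiff l h)) \<oplus> c l \<otimes> tay N m (pdiff l h))"
      using h cl c
      by (intro finsum_cong') (auto simp: N smooth_pdiff tay_Suc r_distr simp del: taylor_coeff.simps)
    also have "\<dots> = ?F \<oplus> ?G"
      using cl c by (intro finsum_addf) (auto simp del: taylor_coeff.simps)
    finally have S: "?S (Suc m) = d \<otimes> ?F \<oplus> d \<otimes> ?G"
      using FG d by (simp add: r_distr)
    have X: "coef N (Suc (Suc m)) h \<in> carrier B" "tay N (Suc m) h \<in> carrier B"
      using N h by (rule coef_closed, intro tay_closed)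
    have "tay (\<lambda>j. N j \<oplus> d \<otimes> c j) (Suc (Suc m)) h =
        e (\<lambda>_. 1 / fact (Suc (Suc m))) \<otimes> coef N (Suc (Suc m)) h \<oplus> d \<otimes> ?F \<oplus>
        (tay N (Suc m) h \<oplus> d \<otimes> ?G)"
      using tay_Suc[OF N' h, where m = "Suc m"] E[of "Suc m"] Suc.IH by simp
    also have "\<dots> = tay N (Suc (Suc m)) h \<oplus> ?S (Suc m)"
      unfolding S tay_Suc[OF N h, where m = "Suc m"]
      using FG d X by (simp add: a_ac del: taylor_coeff.simps)
    finally show ?case .
  qed
qed

text \<open>Terms of positive degree contain a component of the direction. This starts the
  inductions over square-zero moves, where only properties of \<open>e\<close> remain to be
  used.\<close>

lemma tay_zero_point:
  assumes "h \<in> smooth k"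
  shows "tay (\<lambda>_. \<zero>) m h = e h"
proof -
  have "coef (\<lambda>_. \<zero>) (Suc n) h = \<zero>" for n
    using assms by (auto simp: smooth_pdiff intro!: add.finprod_one_eqI)
  then show ?thesis
    using assms by (induction m) (auto simp: tay_0 tay_Suc simp del: taylor_coeff.simps)
qed

end

section \<open>Nilpotent extensions of smooth rings\<close>

text \<open>The last assumption says, in the form of an induction rule, that every element of
  \<open>J\<close> is a finite sum of square-zero elements of \<open>J\<close>. Nilpotency bounds
  products, not just powers, because a Taylor term multiplies different components.\<close>

locale nil_ideal = cring B for B (structure) +
  fixes J :: "'a set" and m :: nat
  assumes J_ideal: "ideal J B"
    and nilpotent: "set xs \<subseteq> J \<Longrightarrow> m < length xs \<Longrightarrow> foldr (\<otimes>) xs \<one> = \<zero>"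
    and square_zero_induct [consumes 1, case_names zero add]: "\<And>P x. \<lbrakk>x \<in> J; P \<zero>;
      \<And>x d. \<lbrakk>x \<in> J; P x; d \<in> J; d \<otimes> d = \<zero>\<rbrakk> \<Longrightarrow> P (x \<oplus> d)\<rbrakk> \<Longrightarrow> P x"
begin

sublocale J: ideal J B
  by (rule J_ideal)

text \<open>The components are built up one after another, each by square-zero increments; as the
  tail is zero, finitely many suffice. The increment is written as \<open>d\<close> times a unit
  vector so that the shift formula applies to it directly.\<close>

lemma square_zero_vec_induct:
  fixes N :: "nat \<Rightarrow> 'a"
  assumes N: "\<And>j. N j \<in> J" "\<And>j. k \<le> j \<Longrightarrow> N j = \<zero>"
    and zero: "P (\<lambda>_. \<zero>)"
    and step: "\<And>N d l. \<lbrakk>\<And>j. N j \<in> J; \<And>j. k \<le> j \<Longrightarrow> N j = \<zero>; P N; d \<in> J; d \<otimes> d = \<zero>; l < k\<rbrakk> \<Longrightarrow>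
      P (\<lambda>j. N j \<oplus> d \<otimes> (if j = l then \<one> else \<zero>))"
  shows "P N"
proof -
  have "P (\<lambda>j. if j < l then N j else \<zero>)" if "l \<le> k" for l
    using that
  proof (induction l)
    case 0
    then show ?case using zero by simp
  next
    case (Suc l)
    \<comment> \<open>Components below \<open>l\<close> have their final values, component
      \<open>l\<close> is under construction, and the later ones are still zero.\<close>
    have "P (\<lambda>j. if j < l then N j else if j = l then x else \<zero>)" if "x \<in> J" for x
      using that
    proof (induction rule: square_zero_induct)
      case zero
      have "(\<lambda>j. if j < l then N j else if j = l then \<zero> else \<zero>) = (\<lambda>j. if j < l then N j else \<zero>)"
        by auto
      then show ?case using Suc by simp
    next
      case (add x d)
      let ?M = "\<lambda>j. if j < l then N j else if j = l then x else \<zero>"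
      have "P (\<lambda>j. ?M j \<oplus> d \<otimes> (if j = l then \<one> else \<zero>))"
        using add N Suc.prems by (intro step) auto
      moreover have "(\<lambda>j. ?M j \<oplus> d \<otimes> (if j = l then \<one> else \<zero>)) =
          (\<lambda>j. if j < l then N j else if j = l then x \<oplus> d else \<zero>)"
        using add N by (auto simp: fun_eq_iff)
      ultimately show ?case by simp
    qed
    from this[OF N(1)[of l]] have "P (\<lambda>j. if j < l then N j else if j = l then N l else \<zero>)" .
    moreover have "(\<lambda>j. if j < l then N j else if j = l then N l else \<zero>) = (\<lambda>j. if j < Suc l then N j else \<zero>)"
      by (auto simp: fun_eq_iff less_Suc_eq)
    ultimately show ?case by simp
  qed
  from this[of k] have "P (\<lambda>j. if j < k then N j else \<zero>)" by simp
  moreover have "(\<lambda>j. if j < k then N j else \<zero>) = N"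
    using N by (auto simp: fun_eq_iff)
  ultimately show ?thesis by simp
qed

end

locale nil_smooth_hom = nil_ideal B J m + smooth_hom B k e
  for B (structure) and J m k e
begin

text \<open>The prefactor carries the induction: each unfolding transfers one factor
  \<open>N j\<close> into the list, so its length plus the remaining degree stays constant. At
  degree 0 the list alone exceeds the nilpotency bound.\<close>

lemma coef_vanish:
  assumes N: "\<And>j. N j \<in> J"
  shows "set xs \<subseteq> J \<Longrightarrow> m < length xs + n \<Longrightarrow> h \<in> smooth k \<Longrightarrow>
    foldr (\<otimes>) xs \<one> \<otimes> coef N n h = \<zero>"
proof (induction n arbitrary: xs h)
  case 0
  then show ?case by (simp add: nilpotent)
next
  case (Suc n)
  have F: "foldr (\<otimes>) ys \<one> \<in> carrier B" if "set ys \<subseteq> J" for ys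
    using that by (induction ys) auto
  have "foldr (\<otimes>) xs \<one> \<otimes> coef N (Suc n) h =
      (\<Oplus>j\<in>{..<k}. foldr (\<otimes>) xs \<one> \<otimes> (N j \<otimes> coef N n (pdiff j h)))"
    unfolding taylor_coeff.simps
    using Suc.prems N F by (intro finsum_rdistr) (auto simp: smooth_pdiff)
  also have "\<dots> = (\<Oplus>j\<in>{..<k}. foldr (\<otimes>) (N j # xs) \<one> \<otimes> coef N n (pdiff j h))"
    using Suc.prems N F by (intro finsum_cong') (auto simp: smooth_pdiff m_ac)
  also have "\<dots> = (\<Oplus>j\<in>{..<k}. \<zero>)"
    using Suc.prems N by (intro finsum_cong' Suc.IH) (auto simp: smooth_pdiff)
  finally show ?case by simp
qed

lemma coef_eq_0: "(\<And>j. N j \<in> J) \<Longrightarrow> m < n \<Longrightarrow> h \<in> smooth k \<Longrightarrow> coef N n h = \<zero>"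
  using coef_vanish[where xs = "[]"] by simp

lemma coef_Suc_in_J:
  assumes N: "\<And>j. N j \<in> J" and h: "h \<in> smooth k"
  shows "coef N (Suc n) h \<in> J"
proof -
  have *: "(\<Oplus>j\<in>I. f j) \<in> J" if "finite I" "\<And>j. j \<in> I \<Longrightarrow> f j \<in> J" for f and I :: "nat set"
    using that
  proof (induction I rule: finite_induct)
    case (insert i I)
    then show ?case by (subst finsum_insert) auto
  qed simp
  show ?thesis
    unfolding taylor_coeff.simps
  proof (rule *)
    show "N j \<otimes> coef N n (pdiff j h) \<in> J" if "j \<in> {..<k}" for j
      using N h that by (intro J.I_r_closed coef_closed) (auto simp: smooth_pdiff)
  qed simp
qed

text \<open>All terms of positive degree lie in \<open>J\<close>. So \<open>e h\<close> is the body
  of the Taylor sum and the difference is its nilpotent part, which is how a value is passed on to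
  another operation.\<close>

lemma tay_minus_in_J:
  assumes N: "\<And>j. N j \<in> J" and h: "h \<in> smooth k"
  shows "tay N n h \<ominus> e h \<in> J"
proof -
  have "\<exists>y\<in>J. tay N n h = e h \<oplus> y" for n
  proof (induction n)
    case 0
    then show ?case using N h by (intro bexI[of _ \<zero>]) (auto simp: tay_0)
  next
    case (Suc n)
    then obtain y where y: "y \<in> J" "tay N n h = e h \<oplus> y" by auto
    let ?z = "e (\<lambda>_. 1 / fact (Suc n)) \<otimes> coef N (Suc n) h"
    have z: "?z \<in> J"
      using coef_Suc_in_J[OF N h, where n = n] by (intro J.I_l_closed) auto
    have "tay N (Suc n) h = ?z \<oplus> (e h \<oplus> y)"
      using N h y by (simp add: tay_Suc del: taylor_coeff.simps)
    also have "\<dots> = e h \<oplus> (?z \<oplus> y)"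
      using J.Icarr[OF z] J.Icarr[OF y(1)] h by (simp add: a_lcomm del: taylor_coeff.simps)
    finally show ?case using y z by blast
  qed
  then obtain y where y: "y \<in> J" "tay N n h = e h \<oplus> y" by blast
  then have "tay N n h \<ominus> e h = y"
    using J.Icarr[of y] e_closed[OF h] by (simp add: minus_eq a_ac r_neg)
  with y show ?thesis by simp
qed

text \<open>The term of degree m+1 vanishes by nilpotency. This absorbs the loss of one degree in
  \<open>tay_shift\<close>: both sides of the shift formula may use the cutoff
  \<open>m\<close>.\<close>

lemma tay_stable:
  assumes N: "\<And>j. N j \<in> J" and h: "h \<in> smooth k"
  shows "tay N (Suc m) h = tay N m h"
  using N h coef_eq_0[of N "Suc m" h] by (simp add: tay_Suc del: taylor_coeff.simps)

lemma nil_tay_shift: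
  assumes N: "\<And>j. N j \<in> J" and c: "\<And>j. c j \<in> carrier B"
    and d: "d \<in> J" "d \<otimes> d = \<zero>" and h: "h \<in> smooth k"
  shows "tay (\<lambda>j. N j \<oplus> d \<otimes> c j) m h =
    tay N m h \<oplus> d \<otimes> (\<Oplus>l\<in>{..<k}. c l \<otimes> tay N m (pdiff l h))"
proof -
  have "tay (\<lambda>j. N j \<oplus> d \<otimes> c j) (Suc m) h = tay (\<lambda>j. N j \<oplus> d \<otimes> c j) m h"
    using N c d by (intro tay_stable h) (simp add: J.I_r_closed)
  then show ?thesis
    using tay_shift[of N c d h m, OF J.Icarr[OF N] c J.Icarr[OF d(1)] d(2) h]
      tay_stable[of N h, OF N h] by simp
qed

lemma nil_tay_shift_single:
  assumes N: "\<And>j. N j \<in> J" and d: "d \<in> J" "d \<otimes> d = \<zero>" and h: "h \<in> smooth k" and l: "l < k"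
  shows "tay (\<lambda>j. N j \<oplus> d \<otimes> (if j = l then \<one> else \<zero>)) m h =
    tay N m h \<oplus> d \<otimes> tay N m (pdiff l h)"
proof -
  have cl: "tay N m (pdiff j h) \<in> carrier B" if "j < k" for j
    using that N h by (simp add: smooth_pdiff)
  have "(\<Oplus>j\<in>{..<k}. (if j = l then \<one> else \<zero>) \<otimes> tay N m (pdiff j h)) =
      (\<Oplus>j\<in>{..<k}. if l = j then tay N m (pdiff j h) else \<zero>)"
    using cl by (intro finsum_cong') auto
  also have "\<dots> = tay N m (pdiff l h)"
    using cl l by (intro finsum_singleton) auto
  finally show ?thesis
    using nil_tay_shift[OF N _ d h, of "\<lambda>j. if j = l then \<one> else \<zero>"] by simp
qed

text \<open>Under a square-zero move a Taylor sum changes by a first-order term, and the product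
  rule is exactly the rule for multiplying such expansions. The quantifiers over \<open>f\<close>
  and \<open>g\<close> stay inside the induction because the step uses the claim for their
  derivatives.\<close>

lemma tay_mult:
  assumes N: "\<And>j. N j \<in> J" "\<And>j. k \<le> j \<Longrightarrow> N j = \<zero>"
  shows "\<forall>f\<in>smooth k. \<forall>g\<in>smooth k. tay N m (\<lambda>x. f x * g x) = tay N m f \<otimes> tay N m g"
  using N
proof (rule square_zero_vec_induct)
  show "\<forall>f\<in>smooth k. \<forall>g\<in>smooth k. tay (\<lambda>_. \<zero>) m (\<lambda>x. f x * g x) = tay (\<lambda>_. \<zero>) m f \<otimes> tay (\<lambda>_. \<zero>) m g"
    by (simp add: tay_zero_point smooth_mult e_mult)
next
  fix N d l
  assume N: "\<And>j. N j \<in> J" "\<And>j. k \<le> j \<Longrightarrow> N j = \<zero>" and d: "d \<in> J" "d \<otimes> d = \<zero>" and l: "l < k"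
    and IH: "\<forall>f\<in>smooth k. \<forall>g\<in>smooth k. tay N m (\<lambda>x. f x * g x) = tay N m f \<otimes> tay N m g"
  let ?N = "\<lambda>j. N j \<oplus> d \<otimes> (if j = l then \<one> else \<zero>)"
  have NB: "N j \<in> carrier B" for j
    using N by simp
  show "\<forall>f\<in>smooth k. \<forall>g\<in>smooth k. tay ?N m (\<lambda>x. f x * g x) = tay ?N m f \<otimes> tay ?N m g"
  proof (intro ballI)
    fix f g assume fg: "f \<in> smooth k" "g \<in> smooth k"
    have "tay ?N m (\<lambda>x. f x * g x) = tay N m (\<lambda>x. f x * g x) \<oplus>
        d \<otimes> tay N m (\<lambda>x. pdiff l f x * g x + f x * pdiff l g x)"
      using nil_tay_shift_single[OF N(1) d smooth_mult[OF fg] l] pdiff_mult[OF fg l] by simp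
    also have "\<dots> = tay N m f \<otimes> tay N m g \<oplus>
        d \<otimes> (tay N m (pdiff l f) \<otimes> tay N m g \<oplus> tay N m f \<otimes> tay N m (pdiff l g))"
      using IH fg l NB by (simp add: tay_add smooth_mult smooth_pdiff)
    also have "\<dots> = (tay N m f \<oplus> d \<otimes> tay N m (pdiff l f)) \<otimes> (tay N m g \<oplus> d \<otimes> tay N m (pdiff l g))"
    proof -
      \<comment> \<open>\<open>algebra\<close> proves the expansion with its quadratic term
        displayed; the hypothesis on \<open>d\<close> then deletes that term.\<close>
      have "(a \<oplus> d \<otimes> a') \<otimes> (b \<oplus> d \<otimes> b') = a \<otimes> b \<oplus> d \<otimes> (a' \<otimes> b \<oplus> a \<otimes> b') \<oplus> (d \<otimes> d) \<otimes> (a' \<otimes> b')"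
        if "a \<in> carrier B" "a' \<in> carrier B" "b \<in> carrier B" "b' \<in> carrier B" for a a' b b'
        using that J.Icarr[OF d(1)] by algebra
      then show ?thesis
        using fg l NB J.Icarr[OF d(1)] by (simp add: d(2) smooth_pdiff)
    qed
    finally show "tay ?N m (\<lambda>x. f x * g x) = tay ?N m f \<otimes> tay ?N m g"
      using nil_tay_shift_single[OF N(1) d _ l] fg by simp
  qed
qed

text \<open>The derivatives of a coordinate are the constants 0 and 1, so a move in component
  \<open>l\<close> changes its Taylor sum by \<open>d\<close> if \<open>i = l\<close> and not at all
  otherwise. The projection axiom rests on this.\<close>

lemma tay_coord:
  assumes N: "\<And>j. N j \<in> J" "\<And>j. k \<le> j \<Longrightarrow> N j = \<zero>" and i: "i < k"
  shows "tay N m (\<lambda>x. x i) = e (\<lambda>x. x i) \<oplus> N i"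
proof -
  have h: "(\<lambda>x. x i) \<in> smooth k"
    using i by (rule smooth_coord)
  show ?thesis
    using N
  proof (rule square_zero_vec_induct)
    show "tay (\<lambda>_. \<zero>) m (\<lambda>x. x i) = e (\<lambda>x. x i) \<oplus> \<zero>"
      using h by (simp add: tay_zero_point)
  next
    fix N d l
    assume N: "\<And>j. N j \<in> J" "\<And>j. k \<le> j \<Longrightarrow> N j = \<zero>" and d: "d \<in> J" "d \<otimes> d = \<zero>" and l: "l < k"
      and IH: "tay N m (\<lambda>x. x i) = e (\<lambda>x. x i) \<oplus> N i"
    have "tay N m (pdiff l (\<lambda>x. x i)) = (if i = l then \<one> else \<zero>)"
      using N by (simp add: pdiff_coord tay_const e_one e_zero)
    then show "tay (\<lambda>j. N j \<oplus> d \<otimes> (if j = l then \<one> else \<zero>)) m (\<lambda>x. x i) =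
        e (\<lambda>x. x i) \<oplus> (N i \<oplus> d \<otimes> (if i = l then \<one> else \<zero>))"
      using nil_tay_shift_single[OF N(1) d h l] IH N d h by (simp add: a_assoc)
  qed
qed

end

text \<open>\<open>\<iota>\<close> is asked to respect sum, product and unit: smooth operations on
  \<open>B\<close> are what is to be constructed. Composed with evaluation in \<open>C\<close> it
  yields homomorphisms \<open>e\<close> as above.\<close>

locale cinf_nil_extension = nil_ideal B J m + cinf_ring C \<phi>
  for B (structure) and J m and C :: "'c set" and \<phi> +
  fixes \<iota> :: "'c \<Rightarrow> 'a"
  assumes iota_closed [simp]: "c \<in> C \<Longrightarrow> \<iota> c \<in> carrier B"
    and iota_add: "\<lbrakk>c \<in> C; d \<in> C\<rbrakk> \<Longrightarrow> \<iota> (\<phi> (\<lambda>x. x 0 + x 1) [c, d]) = \<iota> c \<oplus> \<iota> d"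
    and iota_mult: "\<lbrakk>c \<in> C; d \<in> C\<rbrakk> \<Longrightarrow> \<iota> (\<phi> (\<lambda>x. x 0 * x 1) [c, d]) = \<iota> c \<otimes> \<iota> d"
    and iota_one: "\<iota> (\<phi> (\<lambda>_. 1) []) = \<one>"
begin

definition ev :: "'c list \<Rightarrow> rfun \<Rightarrow> 'a" where
  "ev fs h = \<iota> (\<phi> h fs)"

text \<open>The composition axiom with inner functions \<open>f\<close> and \<open>g\<close>: it
  turns pointwise sums and products of functions into sums and products of their values in
  \<open>C\<close>.\<close>

lemma op_binary:
  assumes "fs \<in> lists C" "f \<in> smooth (length fs)" "g \<in> smooth (length fs)"
    and b: "(\<lambda>x. b (x 0) (x 1)) \<in> smooth 2"
  shows "\<phi> (\<lambda>x. b (f x) (g x)) fs = \<phi> (\<lambda>x. b (x 0) (x 1)) [\<phi> f fs, \<phi> g fs]"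
proof -
  let ?h = "\<lambda>i::nat. if i = 0 then f else g"
  have "\<phi> (\<lambda>x. b (?h 0 x) (?h 1 x)) fs = \<phi> (\<lambda>x. b (x 0) (x 1)) (map (\<lambda>i. \<phi> (?h i) fs) [0..<2])"
    using op_comp[of "\<lambda>x. b (x 0) (x 1)" 2 ?h fs] assms by auto
  then show ?thesis
    by (simp add: upt_rec)
qed

text \<open>A constant factors through the space of no variables, so the composition axiom removes
  the arguments.\<close>

lemma op_const:
  assumes "fs \<in> lists C"
  shows "\<phi> (\<lambda>_. r) fs = \<phi> (\<lambda>_. r) []"
  using op_comp[of "\<lambda>_. r" 0 "\<lambda>_ _. 0" fs] assms by (simp add: smooth_const)

lemma ev_hom:
  assumes fs: "fs \<in> lists C"
  shows "nil_smooth_hom B J m (length fs) (ev fs)"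
proof unfold_locales
  show "ev fs h \<in> carrier B" if "h \<in> smooth (length fs)" for h
    using that fs by (simp add: ev_def op_closed)
  show "ev fs (\<lambda>x. f x + g x) = ev fs f \<oplus> ev fs g"
    if "f \<in> smooth (length fs)" "g \<in> smooth (length fs)" for f g
    unfolding ev_def
    by (subst op_binary[OF fs that, of "(+)"])
      (use that fs in \<open>auto intro!: smooth_add smooth_coord simp: iota_add[unfolded One_nat_def] op_closed\<close>)
  show "ev fs (\<lambda>x. f x * g x) = ev fs f \<otimes> ev fs g"
    if "f \<in> smooth (length fs)" "g \<in> smooth (length fs)" for f g
    unfolding ev_def
    by (subst op_binary[OF fs that, of "(*)"])
      (use that fs in \<open>auto intro!: smooth_mult smooth_coord simp: iota_mult[unfolded One_nat_def] op_closed\<close>)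
  show "ev fs (\<lambda>_. 1) = \<one>"
    by (simp add: ev_def op_const[OF fs] iota_one)
qed

abbreviation taylor :: "'c list \<Rightarrow> (nat \<Rightarrow> 'a) \<Rightarrow> rfun \<Rightarrow> 'a" where
  "taylor fs N h \<equiv> taylor_sum B (length fs) (ev fs) N m h"

text \<open>Both sides change in the same way under a square-zero move of \<open>N\<close>. On the
  left the change is \<open>d\<close> times the Taylor sum of a derivative of the composite. On the
  right the nilpotent parts of the inner values move by \<open>d \<otimes> c i\<close>, with
  \<open>c i\<close> the Taylor sum of the derivative of \<open>h i\<close>. The chain rule together
  with additivity and multiplicativity of Taylor sums identifies the two changes.\<close>

lemma taylor_comp:
  assumes fs: "fs \<in> lists C" and g: "g \<in> smooth n"
    and h: "\<And>i. i < n \<Longrightarrow> h i \<in> smooth (length fs)"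
    and N: "\<And>j. N j \<in> J" "\<And>j. length fs \<le> j \<Longrightarrow> N j = \<zero>"
  shows "taylor fs N (\<lambda>x. g (\<lambda>i. h i x)) =
    taylor (map (\<lambda>i. \<phi> (h i) fs) [0..<n])
      (\<lambda>i. if i < n then taylor fs N (h i) \<ominus> ev fs (h i) else \<zero>) g"
proof -
  let ?gs = "map (\<lambda>i. \<phi> (h i) fs) [0..<n]"
  let ?k = "length fs"
  have gs: "?gs \<in> lists C"
    using op_closed[OF h fs] by auto
  interpret F: nil_smooth_hom B J m ?k "ev fs"
    by (rule ev_hom[OF fs])
  interpret G: nil_smooth_hom B J m n "ev ?gs"
    using ev_hom[OF gs] by simp
  \<comment> \<open>This is the composition axiom of \<open>C\<close>, the content of the claim at
    the zero direction.\<close>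
  have ev_comp: "ev ?gs f = ev fs (\<lambda>x. f (\<lambda>i. h i x))" if "f \<in> smooth n" for f
    unfolding ev_def by (subst op_comp[OF that h fs]) auto
  define S where "S N i = (if i < n then taylor fs N (h i) \<ominus> ev fs (h i) else \<zero>)" for N i
  have S_J: "S N i \<in> J" if "\<And>j. N j \<in> J" for N i
    using F.tay_minus_in_J[OF that h] by (simp add: S_def)
  \<comment> \<open>The outer function varies in the induction because the step uses the claim for
    its partial derivatives.\<close>
  have "\<forall>g\<in>smooth n. taylor fs N (\<lambda>x. g (\<lambda>i. h i x)) = taylor ?gs (S N) g"
    using N
  proof (rule square_zero_vec_induct)
    have S0: "S (\<lambda>_. \<zero>) = (\<lambda>_. \<zero>)"
      using h by (auto simp: S_def F.tay_zero_point r_neg minus_eq)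
    show "\<forall>g\<in>smooth n. taylor fs (\<lambda>_. \<zero>) (\<lambda>x. g (\<lambda>i. h i x)) = taylor ?gs (S (\<lambda>_. \<zero>)) g"
    proof
      fix g assume g: "g \<in> smooth n"
      have "(\<lambda>x. g (\<lambda>i. h i x)) \<in> smooth ?k"
        using g h by (rule smooth_comp)
      then show "taylor fs (\<lambda>_. \<zero>) (\<lambda>x. g (\<lambda>i. h i x)) = taylor ?gs (S (\<lambda>_. \<zero>)) g"
        by (simp only: S0 F.tay_zero_point G.tay_zero_point g ev_comp length_map length_upt minus_nat.diff_0)
    qed
  next
    fix N d l
    assume N: "\<And>j. N j \<in> J" "\<And>j. ?k \<le> j \<Longrightarrow> N j = \<zero>" and d: "d \<in> J" "d \<otimes> d = \<zero>" and l: "l < ?k"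
      and IH: "\<forall>g\<in>smooth n. taylor fs N (\<lambda>x. g (\<lambda>i. h i x)) = taylor ?gs (S N) g"
    let ?N = "\<lambda>j. N j \<oplus> d \<otimes> (if j = l then \<one> else \<zero>)"
    have NB: "N j \<in> carrier B" for j
      using N by simp
    have M: "\<forall>f\<in>smooth ?k. \<forall>g\<in>smooth ?k. taylor fs N (\<lambda>x. f x * g x) = taylor fs N f \<otimes> taylor fs N g"
      using N by (rule F.tay_mult)
    define c where "c i = (if i < n then taylor fs N (pdiff l (h i)) else \<zero>)" for i
    have c: "c i \<in> carrier B" for i
      using h l NB by (simp add: c_def smooth_pdiff)
    \<comment> \<open>The body \<open>ev fs (h i)\<close> does not depend on \<open>N\<close>, so
      only the Taylor sum of \<open>h i\<close> moves.\<close>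
    have S_shift: "S ?N i = S N i \<oplus> d \<otimes> c i" for i
      using F.nil_tay_shift_single[OF N(1) d h l, of i] h[of i] l NB J.Icarr[OF d(1)]
      by (simp add: S_def c_def smooth_pdiff minus_eq a_ac)
    show "\<forall>g\<in>smooth n. taylor fs ?N (\<lambda>x. g (\<lambda>i. h i x)) = taylor ?gs (S ?N) g"
    proof
      fix g assume g: "g \<in> smooth n"
      have gh: "(\<lambda>x. g (\<lambda>i. h i x)) \<in> smooth ?k"
        using g h by (rule smooth_comp)
      have dgh: "(\<lambda>x. pdiff i g (\<lambda>i. h i x)) \<in> smooth ?k" if "i < n" for i
        using smooth_pdiff[OF g that] h by (rule smooth_comp)
      have dh: "pdiff l (h i) \<in> smooth ?k" if "i < n" for i
        using h[OF that] l by (rule smooth_pdiff)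
      have "taylor fs N (pdiff l (\<lambda>x. g (\<lambda>i. h i x))) =
          taylor fs N (\<lambda>x. \<Sum>i<n. pdiff i g (\<lambda>i. h i x) * pdiff l (h i) x)"
        by (subst pdiff_comp[of g n h ?k l]) (assumption | rule g l h refl)+
      also have "\<dots> = (\<Oplus>i\<in>{..<n}. taylor fs N (\<lambda>x. pdiff i g (\<lambda>i. h i x) * pdiff l (h i) x))"
        by (rule F.tay_sum[OF NB]) (rule smooth_mult[OF dgh dh])
      also have "\<dots> = (\<Oplus>i\<in>{..<n}. c i \<otimes> taylor ?gs (S N) (pdiff i g))"
      proof (rule finsum_cong')
        show "(\<lambda>i. c i \<otimes> taylor ?gs (S N) (pdiff i g)) \<in> {..<n} \<rightarrow> carrier B"
          using c S_J[OF N(1)] g by (auto simp: smooth_pdiff)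
        show "taylor fs N (\<lambda>x. pdiff i g (\<lambda>i. h i x) * pdiff l (h i) x) =
            c i \<otimes> taylor ?gs (S N) (pdiff i g)" if "i \<in> {..<n}" for i
        proof -
          have i: "i < n" using that by simp
          have "taylor fs N (\<lambda>x. pdiff i g (\<lambda>i. h i x) * pdiff l (h i) x) =
              taylor fs N (\<lambda>x. pdiff i g (\<lambda>i. h i x)) \<otimes> taylor fs N (pdiff l (h i))"
            by (rule M[rule_format, OF dgh[OF i] dh[OF i]])
          also have "taylor fs N (\<lambda>x. pdiff i g (\<lambda>i. h i x)) = taylor ?gs (S N) (pdiff i g)"
            by (rule IH[rule_format, OF smooth_pdiff[OF g i]])
          finally show ?thesis
            using i c[of i] S_J[OF N(1)] g by (simp add: c_def m_comm smooth_pdiff)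
        qed
      qed simp
      finally have D: "taylor fs N (pdiff l (\<lambda>x. g (\<lambda>i. h i x))) =
        (\<Oplus>i\<in>{..<n}. c i \<otimes> taylor ?gs (S N) (pdiff i g))" .
      have "taylor fs ?N (\<lambda>x. g (\<lambda>i. h i x)) =
          taylor fs N (\<lambda>x. g (\<lambda>i. h i x)) \<oplus> d \<otimes> taylor fs N (pdiff l (\<lambda>x. g (\<lambda>i. h i x)))"
        by (rule F.nil_tay_shift_single[OF N(1) d gh l])
      also have "\<dots> = taylor ?gs (S N) g \<oplus> d \<otimes> (\<Oplus>i\<in>{..<n}. c i \<otimes> taylor ?gs (S N) (pdiff i g))"
        using IH g D by simp
      \<comment> \<open>One move of the argument displaces all inner values at once, hence the shift
        formula is applied in the general direction \<open>c\<close> and not along a unit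
        vector.\<close>
      also have "\<dots> = taylor ?gs (\<lambda>i. S N i \<oplus> d \<otimes> c i) g"
        using G.nil_tay_shift[OF S_J[OF N(1)] c d g] by simp
      finally show "taylor fs ?N (\<lambda>x. g (\<lambda>i. h i x)) = taylor ?gs (S ?N) g"
        unfolding ext[of "S ?N", OF S_shift] .
    qed
  qed
  from this[rule_format, OF g] show ?thesis
    unfolding S_def .
qed

end

text \<open>The equations for \<open>body\<close> and \<open>soul\<close> encode uniqueness of the
  splitting: from any presentation \<open>\<iota> c \<oplus> y\<close> both parts can be read
  off.\<close>

locale cinf_split_extension = cinf_nil_extension B J m C \<phi> \<iota>
  for B (structure) and J m and C :: "'c set" and \<phi> and \<iota> +
  fixes body :: "'a \<Rightarrow> 'c" and soul :: "'a \<Rightarrow> 'a"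
  assumes body_closed: "x \<in> carrier B \<Longrightarrow> body x \<in> C"
    and soul_in_J: "x \<in> carrier B \<Longrightarrow> soul x \<in> J"
    and body_soul: "x \<in> carrier B \<Longrightarrow> x = \<iota> (body x) \<oplus> soul x"
    and body_eq: "\<lbrakk>c \<in> C; y \<in> J\<rbrakk> \<Longrightarrow> body (\<iota> c \<oplus> y) = c"
    and soul_eq: "\<lbrakk>c \<in> C; y \<in> J\<rbrakk> \<Longrightarrow> soul (\<iota> c \<oplus> y) = y"
begin

text \<open>The souls are extended by zero because the induction over moves concerns families that
  vanish from the arity on.\<close>

definition soul_vec :: "'a list \<Rightarrow> nat \<Rightarrow> 'a" where
  "soul_vec Fs = (\<lambda>j. if j < length Fs then soul (Fs ! j) else \<zero>)"

definition nil_op :: "rfun \<Rightarrow> 'a list \<Rightarrow> 'a" where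
  "nil_op h Fs = taylor (map body Fs) (soul_vec Fs) h"

lemma soul_vec_in_J: "Fs \<in> lists (carrier B) \<Longrightarrow> soul_vec Fs j \<in> J"
  by (auto simp: soul_vec_def intro!: soul_in_J)

lemma soul_vec_zero: "length Fs \<le> j \<Longrightarrow> soul_vec Fs j = \<zero>"
  by (simp add: soul_vec_def)

lemma map_body: "Fs \<in> lists (carrier B) \<Longrightarrow> map body Fs \<in> lists C"
  by (auto intro!: body_closed)

lemma nil_op_hom:
  "Fs \<in> lists (carrier B) \<Longrightarrow> nil_smooth_hom B J m (length Fs) (ev (map body Fs))"
  using ev_hom[OF map_body] by simp

lemma nil_op_closed:
  assumes "Fs \<in> lists (carrier B)" "h \<in> smooth (length Fs)"
  shows "nil_op h Fs \<in> carrier B"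
proof -
  interpret nil_smooth_hom B J m "length Fs" "ev (map body Fs)"
    using assms(1) by (rule nil_op_hom)
  show ?thesis
    using assms soul_vec_in_J by (simp add: nil_op_def)
qed

lemma nil_op_proj:
  assumes Fs: "Fs \<in> lists (carrier B)" and i: "i < length Fs"
  shows "nil_op (\<lambda>x. x i) Fs = Fs ! i"
proof -
  interpret nil_smooth_hom B J m "length Fs" "ev (map body Fs)"
    using Fs by (rule nil_op_hom)
  have "nil_op (\<lambda>x. x i) Fs = ev (map body Fs) (\<lambda>x. x i) \<oplus> soul_vec Fs i"
    using tay_coord[OF soul_vec_in_J[OF Fs] soul_vec_zero i] by (simp add: nil_op_def)
  also have "\<dots> = \<iota> (body (Fs ! i)) \<oplus> soul (Fs ! i)"
    using op_proj[OF map_body[OF Fs], of i] i by (simp add: ev_def soul_vec_def)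
  also have "\<dots> = Fs ! i"
    using Fs i by (intro body_soul[symmetric]) auto
  finally show ?thesis .
qed

lemma nil_op_add:
  assumes Fs: "Fs \<in> lists (carrier B)" and "f \<in> smooth (length Fs)" "g \<in> smooth (length Fs)"
  shows "nil_op (\<lambda>x. f x + g x) Fs = nil_op f Fs \<oplus> nil_op g Fs"
proof -
  interpret nil_smooth_hom B J m "length Fs" "ev (map body Fs)"
    using Fs by (rule nil_op_hom)
  show ?thesis
    using tay_add[OF J.Icarr[OF soul_vec_in_J[OF Fs]] assms(2,3)] by (simp add: nil_op_def)
qed

lemma nil_op_mult:
  assumes Fs: "Fs \<in> lists (carrier B)" and fg: "f \<in> smooth (length Fs)" "g \<in> smooth (length Fs)"
  shows "nil_op (\<lambda>x. f x * g x) Fs = nil_op f Fs \<otimes> nil_op g Fs"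
proof -
  interpret nil_smooth_hom B J m "length Fs" "ev (map body Fs)"
    using Fs by (rule nil_op_hom)
  have "\<forall>f\<in>smooth (length Fs). \<forall>g\<in>smooth (length Fs). tay (soul_vec Fs) m (\<lambda>x. f x * g x) =
      tay (soul_vec Fs) m f \<otimes> tay (soul_vec Fs) m g"
    using soul_vec_in_J[OF Fs] soul_vec_zero by (rule tay_mult)
  from this[rule_format, OF fg] show ?thesis
    by (simp add: nil_op_def)
qed

lemma nil_op_const:
  assumes Fs: "Fs \<in> lists (carrier B)"
  shows "nil_op (\<lambda>_. r) Fs = \<iota> (\<phi> (\<lambda>_. r) [])"
proof -
  interpret nil_smooth_hom B J m "length Fs" "ev (map body Fs)"
    using Fs by (rule nil_op_hom)
  show ?thesis
    using tay_const[OF J.Icarr[OF soul_vec_in_J[OF Fs]]] op_const[OF map_body[OF Fs]]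
    by (simp add: nil_op_def ev_def)
qed

text \<open>By uniqueness of the splitting, an inner value has as body the operation of
  \<open>C\<close> on the bodies, and as soul its Taylor sum minus that body. With these data the
  outer operation is the right-hand side of \<open>taylor_comp\<close>.\<close>

lemma nil_op_comp:
  assumes Fs: "Fs \<in> lists (carrier B)" and g: "g \<in> smooth n"
    and h: "\<And>i. i < n \<Longrightarrow> h i \<in> smooth (length Fs)"
  shows "nil_op (\<lambda>x. g (\<lambda>i. h i x)) Fs = nil_op g (map (\<lambda>i. nil_op (h i) Fs) [0..<n])"
proof -
  let ?fs = "map body Fs" and ?N = "soul_vec Fs"
  interpret nil_smooth_hom B J m "length Fs" "ev ?fs"
    using Fs by (rule nil_op_hom)
  let ?S = "\<lambda>i. taylor ?fs ?N (h i) \<ominus> ev ?fs (h i)"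
  have c: "\<phi> (h i) ?fs \<in> C" if "i < n" for i
    using h[OF that] map_body[OF Fs] by (intro op_closed) auto
  have S: "?S i \<in> J" if "i < n" for i
    using tay_minus_in_J[OF soul_vec_in_J[OF Fs] h[OF that]] by simp
  have split: "nil_op (h i) Fs = \<iota> (\<phi> (h i) ?fs) \<oplus> ?S i" if "i < n" for i
  proof -
    have "a = b \<oplus> (a \<ominus> b)" if "a \<in> carrier B" "b \<in> carrier B" for a b
      using that by algebra
    from this[OF tay_closed[OF J.Icarr[OF soul_vec_in_J[OF Fs]] h[OF that]] e_closed[OF h[OF that]]]
    show ?thesis
      by (simp add: nil_op_def ev_def)
  qed
  have bs: "body (nil_op (h i) Fs) = \<phi> (h i) ?fs" "soul (nil_op (h i) Fs) = ?S i" if "i < n" for i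
    unfolding split[OF that] by (rule body_eq[OF c[OF that] S[OF that]], rule soul_eq[OF c[OF that] S[OF that]])
  have E1: "map body (map (\<lambda>i. nil_op (h i) Fs) [0..<n]) = map (\<lambda>i. \<phi> (h i) ?fs) [0..<n]"
    by (simp add: bs)
  have E2: "soul_vec (map (\<lambda>i. nil_op (h i) Fs) [0..<n]) = (\<lambda>i. if i < n then ?S i else \<zero>)"
    by (rule ext) (simp add: soul_vec_def bs)
  have "taylor ?fs ?N (\<lambda>x. g (\<lambda>i. h i x)) =
    taylor (map (\<lambda>i. \<phi> (h i) ?fs) [0..<n]) (\<lambda>i. if i < n then ?S i else \<zero>) g"
    by (rule taylor_comp[OF map_body[OF Fs] g])
      (simp_all add: h soul_vec_in_J[OF Fs] soul_vec_zero)
  then show ?thesis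
    unfolding nil_op_def[of g] E1 E2 unfolding nil_op_def .
qed

lemma nil_op_plus: "F \<in> carrier B \<Longrightarrow> G \<in> carrier B \<Longrightarrow> nil_op (\<lambda>x. x 0 + x 1) [F, G] = F \<oplus> G"
  using nil_op_add[of "[F, G]" "\<lambda>x. x 0" "\<lambda>x. x 1"] nil_op_proj[of "[F, G]" 0] nil_op_proj[of "[F, G]" 1]
  by (simp add: smooth_coord)

lemma nil_op_times: "F \<in> carrier B \<Longrightarrow> G \<in> carrier B \<Longrightarrow> nil_op (\<lambda>x. x 0 * x 1) [F, G] = F \<otimes> G"
  using nil_op_mult[of "[F, G]" "\<lambda>x. x 0" "\<lambda>x. x 1"] nil_op_proj[of "[F, G]" 0] nil_op_proj[of "[F, G]" 1]
  by (simp add: smooth_coord)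

lemma nil_op_scale: "F \<in> carrier B \<Longrightarrow> nil_op (\<lambda>x. r * x 0) [F] = \<iota> (\<phi> (\<lambda>_. r) []) \<otimes> F"
  using nil_op_mult[of "[F]" "\<lambda>_. r" "\<lambda>x. x 0"] nil_op_proj[of "[F]" 0] nil_op_const[of "[F]" r]
  by (simp add: smooth_coord smooth_const)

end

section \<open>The word algebra\<close>

text \<open>Two cuts of a word can be indexed by the second cut and then the first, or by the
  lengths of the first two pieces. Equality of the two sums is what associativity of the word
  product comes down to.\<close>

lemma (in abelian_monoid) finsum_triangle:
  assumes "\<And>i j. t i j \<in> carrier G"
  shows "(\<Oplus>i\<in>{..n::nat}. \<Oplus>j\<in>{..i}. t j (i - j)) = (\<Oplus>j\<in>{..n}. \<Oplus>l\<in>{..n - j}. t j l)"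
proof (induction n)
  case 0
  then show ?case using assms by simp
next
  case (Suc n)
  have "(\<Oplus>j\<in>{..Suc n}. \<Oplus>l\<in>{..Suc n - j}. t j l) =
      t (Suc n) 0 \<oplus> (\<Oplus>j\<in>{..n}. \<Oplus>l\<in>{..Suc n - j}. t j l)"
    using assms by (subst finsum_Suc) (auto intro!: finsum_closed)
  also have "(\<Oplus>j\<in>{..n}. \<Oplus>l\<in>{..Suc n - j}. t j l) =
      (\<Oplus>j\<in>{..n}. t j (Suc n - j) \<oplus> (\<Oplus>l\<in>{..n - j}. t j l))"
  proof (intro finsum_cong')
    show "(\<Oplus>l\<in>{..Suc n - j}. t j l) = t j (Suc n - j) \<oplus> (\<Oplus>l\<in>{..n - j}. t j l)" if "j \<in> {..n}" for j
      using that assms finsum_Suc[of "t j" "n - j"] by (simp add: Suc_diff_le)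
  qed (use assms in \<open>auto intro!: finsum_closed\<close>)
  also have "\<dots> = (\<Oplus>j\<in>{..n}. t j (Suc n - j)) \<oplus> (\<Oplus>j\<in>{..n}. \<Oplus>l\<in>{..n - j}. t j l)"
    using assms by (intro finsum_addf) (auto intro!: finsum_closed)
  also have "t (Suc n) 0 \<oplus> \<dots> = (\<Oplus>j\<in>{..Suc n}. t j (Suc n - j)) \<oplus> (\<Oplus>j\<in>{..n}. \<Oplus>l\<in>{..n - j}. t j l)"
    using assms by (subst finsum_Suc) (auto simp: a_assoc intro!: finsum_closed)
  also have "\<dots> = (\<Oplus>i\<in>{..Suc n}. \<Oplus>j\<in>{..i}. t j (i - j))"
    using assms finsum_Suc[of "\<lambda>i. \<Oplus>j\<in>{..i}. t j (i - j)" n] by (simp add: Suc.IH Pi_def finsum_closed)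
  finally show ?case by simp
qed

text \<open>The submodule spanned by the words in \<open>S\<close>. Parity, positive degree and the
  filtration by length are all choices of \<open>S\<close>, so one set of closure properties serves
  them all.\<close>

definition word_span :: "('c, 'z) ring_scheme \<Rightarrow> 'm set \<Rightarrow> 'm list set \<Rightarrow> ('m list \<Rightarrow> 'c) set" where
  "word_span A X S = {a \<in> carrier (word_algebra A X). \<forall>w. a w \<noteq> \<zero>\<^bsub>A\<^esub> \<longrightarrow> w \<in> S}"

locale words = cring A for A (structure) +
  fixes X :: "'m set"
begin

abbreviation "T \<equiv> word_algebra A X"

lemma T_carrier: "a \<in> carrier T \<longleftrightarrow>
    (\<forall>w. a w \<in> carrier A) \<and> finite {w. a w \<noteq> \<zero>} \<and> {w. a w \<noteq> \<zero>} \<subseteq> lists X"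
  by (simp add: word_algebra_def)

lemma T_coeff: "a \<in> carrier T \<Longrightarrow> a w \<in> carrier A"
  by (simp add: T_carrier)

lemma T_mult: "(a \<otimes>\<^bsub>T\<^esub> b) w = (\<Oplus>i\<in>{..length w}. a (take i w) \<otimes> b (drop i w))"
  by (simp add: word_algebra_def)

lemma T_add: "(a \<oplus>\<^bsub>T\<^esub> b) w = a w \<oplus> b w"
  by (simp add: word_algebra_def)

lemma T_zero: "\<zero>\<^bsub>T\<^esub> w = \<zero>"
  by (simp add: word_algebra_def)

lemma T_one: "\<one>\<^bsub>T\<^esub> w = (if w = [] then \<one> else \<zero>)"
  by (simp add: word_algebra_def)

lemma T_mult_support:
  assumes "(a \<otimes>\<^bsub>T\<^esub> b) w \<noteq> \<zero>" "a \<in> carrier T" "b \<in> carrier T"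
  shows "\<exists>u v. w = u @ v \<and> a u \<noteq> \<zero> \<and> b v \<noteq> \<zero>"
proof (rule ccontr)
  assume *: "\<not> ?thesis"
  note [simp] = T_coeff[OF assms(2)] T_coeff[OF assms(3)]
  have "a (take i w) \<otimes> b (drop i w) = \<zero>" for i
  proof -
    have "a (take i w) = \<zero> \<or> b (drop i w) = \<zero>"
      using * append_take_drop_id by metis
    then show ?thesis using assms by auto
  qed
  then have "(a \<otimes>\<^bsub>T\<^esub> b) w = \<zero>"
    by (simp add: T_mult)
  with assms show False by simp
qed

lemma T_mult_closed:
  assumes "a \<in> carrier T" "b \<in> carrier T"
  shows "a \<otimes>\<^bsub>T\<^esub> b \<in> carrier T"
proof -
  note [simp] = T_coeff[OF assms(1)] T_coeff[OF assms(2)]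
  have "{w. (a \<otimes>\<^bsub>T\<^esub> b) w \<noteq> \<zero>} \<subseteq> (\<lambda>(u, v). u @ v) ` ({w. a w \<noteq> \<zero>} \<times> {w. b w \<noteq> \<zero>})"
    using T_mult_support[OF _ assms] by fast
  moreover have "finite ((\<lambda>(u, v). u @ v) ` ({w. a w \<noteq> \<zero>} \<times> {w. b w \<noteq> \<zero>}))"
    using assms by (auto simp: T_carrier)
  moreover have "(\<lambda>(u, v). u @ v) ` ({w. a w \<noteq> \<zero>} \<times> {w. b w \<noteq> \<zero>}) \<subseteq> lists X"
    using assms by (fastforce simp: T_carrier)
  moreover have "(a \<otimes>\<^bsub>T\<^esub> b) w \<in> carrier A" for w
    using assms by (auto simp: T_mult intro!: finsum_closed)
  ultimately show ?thesis
    unfolding T_carrier by (meson finite_subset order_trans)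
qed

text \<open>The support is bounded by the union of two admissible ones. This covers sums, negatives
  and restrictions to a set of words.\<close>

lemma T_support_closed:
  assumes "\<And>w. a w \<in> carrier A" "b \<in> carrier T" "c \<in> carrier T"
    "\<And>w. b w = \<zero> \<Longrightarrow> c w = \<zero> \<Longrightarrow> a w = \<zero>"
  shows "a \<in> carrier T"
proof -
  have "{w. a w \<noteq> \<zero>} \<subseteq> {w. b w \<noteq> \<zero>} \<union> {w. c w \<noteq> \<zero>}"
    using assms(4) by auto
  moreover have "finite ({w. b w \<noteq> \<zero>} \<union> {w. c w \<noteq> \<zero>})" "{w. b w \<noteq> \<zero>} \<union> {w. c w \<noteq> \<zero>} \<subseteq> lists X"
    using assms(2,3) by (auto simp: T_carrier)
  ultimately show ?thesis
    unfolding T_carrier using assms(1) by (meson finite_subset order_trans)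
qed

lemma T_zero_closed: "\<zero>\<^bsub>T\<^esub> \<in> carrier T"
  by (simp add: T_carrier T_zero)

lemma T_add_closed: "a \<in> carrier T \<Longrightarrow> b \<in> carrier T \<Longrightarrow> a \<oplus>\<^bsub>T\<^esub> b \<in> carrier T"
  by (rule T_support_closed[of _ a b]) (auto simp: T_add T_coeff[of a] T_coeff[of b])

lemma T_ring: "ring T"
proof (rule ringI)
  show "abelian_group T"
  proof (rule abelian_groupI)
    show "\<exists>y\<in>carrier T. y \<oplus>\<^bsub>T\<^esub> x = \<zero>\<^bsub>T\<^esub>" if "x \<in> carrier T" for x
    proof
      show "(\<lambda>w. \<ominus> x w) \<in> carrier T"
        by (rule T_support_closed[of _ x x]) (use that in \<open>auto simp: T_coeff[of x]\<close>)
      show "(\<lambda>w. \<ominus> x w) \<oplus>\<^bsub>T\<^esub> x = \<zero>\<^bsub>T\<^esub>"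
        using that by (auto simp: T_add T_zero l_neg T_coeff[of x])
    qed
    show "x \<oplus>\<^bsub>T\<^esub> y \<oplus>\<^bsub>T\<^esub> z = x \<oplus>\<^bsub>T\<^esub> (y \<oplus>\<^bsub>T\<^esub> z)"
      if "x \<in> carrier T" "y \<in> carrier T" "z \<in> carrier T" for x y z
      using that[THEN T_coeff] by (simp add: fun_eq_iff T_add a_assoc)
    show "x \<oplus>\<^bsub>T\<^esub> y = y \<oplus>\<^bsub>T\<^esub> x" if "x \<in> carrier T" "y \<in> carrier T" for x y
      using that[THEN T_coeff] by (simp add: fun_eq_iff T_add a_comm)
    show "\<zero>\<^bsub>T\<^esub> \<oplus>\<^bsub>T\<^esub> x = x" if "x \<in> carrier T" for x
      using that[THEN T_coeff] by (simp add: fun_eq_iff T_add T_zero)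
  qed (auto simp: T_zero_closed T_add_closed)
  show "monoid T"
  proof (rule monoidI)
    show "\<one>\<^bsub>T\<^esub> \<in> carrier T"
      by (auto simp: T_carrier T_one)
    fix x y z
    assume x: "x \<in> carrier T"
    note [simp] = T_coeff[OF x]
    show "\<one>\<^bsub>T\<^esub> \<otimes>\<^bsub>T\<^esub> x = x"
    proof
      fix w
      have "(\<one>\<^bsub>T\<^esub> \<otimes>\<^bsub>T\<^esub> x) w = (\<Oplus>i\<in>{..length w}. if 0 = i then x (drop i w) else \<zero>)"
        unfolding T_mult using x by (intro finsum_cong') (auto simp: T_one)
      also have "\<dots> = x w"
        using x by (subst finsum_singleton) auto
      finally show "(\<one>\<^bsub>T\<^esub> \<otimes>\<^bsub>T\<^esub> x) w = x w" .
    qed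
    show "x \<otimes>\<^bsub>T\<^esub> \<one>\<^bsub>T\<^esub> = x"
    proof
      fix w
      have "(x \<otimes>\<^bsub>T\<^esub> \<one>\<^bsub>T\<^esub>) w = (\<Oplus>i\<in>{..length w}. if length w = i then x (take i w) else \<zero>)"
        unfolding T_mult using x by (intro finsum_cong') (auto simp: T_one)
      also have "\<dots> = x w"
        using x by (subst finsum_singleton) auto
      finally show "(x \<otimes>\<^bsub>T\<^esub> \<one>\<^bsub>T\<^esub>) w = x w" .
    qed
    assume y: "y \<in> carrier T"
    note [simp] = T_coeff[OF y]
    show "x \<otimes>\<^bsub>T\<^esub> y \<in> carrier T"
      using x y by (rule T_mult_closed)
    assume z: "z \<in> carrier T"
    note [simp] = T_coeff[OF z]
    show "(x \<otimes>\<^bsub>T\<^esub> y) \<otimes>\<^bsub>T\<^esub> z = x \<otimes>\<^bsub>T\<^esub> (y \<otimes>\<^bsub>T\<^esub> z)"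
    proof
      fix w
      \<comment> \<open>\<open>j\<close> and \<open>l\<close> are the lengths of the first two
        pieces when \<open>w\<close> is cut into three.\<close>
      define t where "t j l = x (take j w) \<otimes> (y (take l (drop j w)) \<otimes> z (drop (j + l) w))" for j l
      have t: "t j l \<in> carrier A" for j l
        using x y z by (simp add: t_def)
      have "((x \<otimes>\<^bsub>T\<^esub> y) \<otimes>\<^bsub>T\<^esub> z) w =
          (\<Oplus>i\<in>{..length w}. (\<Oplus>j\<in>{..i}. x (take j w) \<otimes> y (drop j (take i w))) \<otimes> z (drop i w))"
        unfolding T_mult using x y z
        by (intro finsum_cong') (auto simp: min_def take_take intro!: finsum_closed arg_cong2[of _ _ _ _ "(\<otimes>)"] finsum_cong')
      also have "\<dots> = (\<Oplus>i\<in>{..length w}. \<Oplus>j\<in>{..i}. t j (i - j))"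
      proof (rule finsum_cong')
        show "(\<Oplus>j\<in>{..i}. x (take j w) \<otimes> y (drop j (take i w))) \<otimes> z (drop i w) = (\<Oplus>j\<in>{..i}. t j (i - j))"
          for i
          using x y z
          by (subst finsum_ldistr) (auto simp: t_def drop_take m_assoc intro!: finsum_cong')
      qed (auto simp: t intro!: finsum_closed)
      also have "\<dots> = (\<Oplus>j\<in>{..length w}. \<Oplus>l\<in>{..length w - j}. t j l)"
        using t by (rule finsum_triangle)
      also have "\<dots> = (x \<otimes>\<^bsub>T\<^esub> (y \<otimes>\<^bsub>T\<^esub> z)) w"
        unfolding T_mult length_drop
      proof (rule finsum_cong')
        show "(\<Oplus>l\<in>{..length w - j}. t j l) =
          x (take j w) \<otimes> (\<Oplus>l\<in>{..length w - j}. y (take l (drop j w)) \<otimes> z (drop l (drop j w)))" for j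
          using x y z
          by (subst finsum_rdistr) (auto simp: t_def add.commute intro!: finsum_cong')
      qed (use x y z in \<open>auto intro!: finsum_closed\<close>)
      finally show "((x \<otimes>\<^bsub>T\<^esub> y) \<otimes>\<^bsub>T\<^esub> z) w = (x \<otimes>\<^bsub>T\<^esub> (y \<otimes>\<^bsub>T\<^esub> z)) w" .
    qed
  qed
  fix x y z
  assume xyz: "x \<in> carrier T" "y \<in> carrier T" "z \<in> carrier T"
  note [simp] = xyz[THEN T_coeff]
  show "(x \<oplus>\<^bsub>T\<^esub> y) \<otimes>\<^bsub>T\<^esub> z = x \<otimes>\<^bsub>T\<^esub> z \<oplus>\<^bsub>T\<^esub> y \<otimes>\<^bsub>T\<^esub> z"
  proof
    fix w
    have "((x \<oplus>\<^bsub>T\<^esub> y) \<otimes>\<^bsub>T\<^esub> z) w =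
        (\<Oplus>i\<in>{..length w}. x (take i w) \<otimes> z (drop i w) \<oplus> y (take i w) \<otimes> z (drop i w))"
      unfolding T_mult T_add using xyz by (intro finsum_cong') (auto simp: l_distr)
    then show "((x \<oplus>\<^bsub>T\<^esub> y) \<otimes>\<^bsub>T\<^esub> z) w = (x \<otimes>\<^bsub>T\<^esub> z \<oplus>\<^bsub>T\<^esub> y \<otimes>\<^bsub>T\<^esub> z) w"
      using xyz by (simp add: T_mult T_add Pi_def)
  qed
  show "z \<otimes>\<^bsub>T\<^esub> (x \<oplus>\<^bsub>T\<^esub> y) = z \<otimes>\<^bsub>T\<^esub> x \<oplus>\<^bsub>T\<^esub> z \<otimes>\<^bsub>T\<^esub> y"
  proof
    fix w
    have "(z \<otimes>\<^bsub>T\<^esub> (x \<oplus>\<^bsub>T\<^esub> y)) w =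
        (\<Oplus>i\<in>{..length w}. z (take i w) \<otimes> x (drop i w) \<oplus> z (take i w) \<otimes> y (drop i w))"
      unfolding T_mult T_add using xyz by (intro finsum_cong') (auto simp: r_distr)
    then show "(z \<otimes>\<^bsub>T\<^esub> (x \<oplus>\<^bsub>T\<^esub> y)) w = (z \<otimes>\<^bsub>T\<^esub> x \<oplus>\<^bsub>T\<^esub> z \<otimes>\<^bsub>T\<^esub> y) w"
      using xyz by (simp add: T_mult T_add Pi_def)
  qed
qed

sublocale T: ring T
  by (rule T_ring)

lemma T_uminus: "a \<in> carrier T \<Longrightarrow> \<ominus>\<^bsub>T\<^esub> a = (\<lambda>w. \<ominus> a w)"
proof (rule T.minus_equality)
  assume a: "a \<in> carrier T"
  note [simp] = T_coeff[OF a]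
  show "(\<lambda>w. \<ominus> a w) \<oplus>\<^bsub>T\<^esub> a = \<zero>\<^bsub>T\<^esub>"
    by (auto simp: T_add T_zero l_neg)
  show "(\<lambda>w. \<ominus> a w) \<in> carrier T"
    by (rule T_support_closed[of _ a a]) (use a in auto)
qed

lemma T_minus: "a \<in> carrier T \<Longrightarrow> b \<in> carrier T \<Longrightarrow> (a \<ominus>\<^bsub>T\<^esub> b) w = a w \<ominus> b w"
  by (simp add: T.minus_eq T_add T_uminus minus_eq)

lemma monomial_closed: "c \<in> carrier A \<Longrightarrow> w \<in> lists X \<Longrightarrow> monomial A c w \<in> carrier T"
  by (auto simp: T_carrier monomial_def)

lemma monomial_mult:
  assumes "c \<in> carrier A" "d \<in> carrier A"
  shows "monomial A c v \<otimes>\<^bsub>T\<^esub> monomial A d w = monomial A (c \<otimes> d) (v @ w)"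
proof
  fix u
  \<comment> \<open>Of all cuts of \<open>u\<close> only the one at \<open>length v\<close> can give
    a nonzero product; in this form the sum collapses to a single term.\<close>
  have eq: "monomial A c v (take i u) \<otimes> monomial A d w (drop i u) =
      (if length v = i then if u = v @ w then c \<otimes> d else \<zero> else \<zero>)" if "i \<le> length u" for i
  proof (cases "take i u = v \<and> drop i u = w")
    case True
    then have "u = v @ w" "length v = i"
      using that by auto
    then show ?thesis using True by (simp add: monomial_def)
  next
    case False
    then have "\<not> (length v = i \<and> u = v @ w)" by auto
    then show ?thesis using False assms by (auto simp: monomial_def)
  qed
  have "(monomial A c v \<otimes>\<^bsub>T\<^esub> monomial A d w) u =
      (\<Oplus>i\<in>{..length u}. if length v = i then if u = v @ w then c \<otimes> d else \<zero> else \<zero>)"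
    unfolding T_mult using assms eq by (intro finsum_cong') auto
  also have "\<dots> = (if u = v @ w then c \<otimes> d else \<zero>)"
  proof (cases "u = v @ w")
    case True
    then show ?thesis
      using assms by (subst finsum_singleton) auto
  next
    case False
    then have "(\<lambda>i. if length v = i then if u = v @ w then c \<otimes> d else \<zero> else \<zero>) = (\<lambda>i. \<zero>)"
      by auto
    then show ?thesis using False by simp
  qed
  finally show "(monomial A c v \<otimes>\<^bsub>T\<^esub> monomial A d w) u = monomial A (c \<otimes> d) (v @ w) u"
    by (simp add: monomial_def)
qed

lemma monomial_add: "c \<in> carrier A \<Longrightarrow> d \<in> carrier A \<Longrightarrow>
    monomial A c w \<oplus>\<^bsub>T\<^esub> monomial A d w = monomial A (c \<oplus> d) w"
  by (auto simp: T_add monomial_def)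

lemma T_one_monomial: "\<one>\<^bsub>T\<^esub> = monomial A \<one> []"
  by (auto simp: T_one monomial_def)

lemma scalar_monomial_mult:
  assumes "c \<in> carrier A" "a \<in> carrier T"
  shows "(monomial A c [] \<otimes>\<^bsub>T\<^esub> a) w = c \<otimes> a w" "(a \<otimes>\<^bsub>T\<^esub> monomial A c []) w = a w \<otimes> c"
proof -
  note [simp] = T_coeff[OF assms(2)]
  have "(monomial A c [] \<otimes>\<^bsub>T\<^esub> a) w = (\<Oplus>i\<in>{..length w}. if 0 = i then c \<otimes> a (drop i w) else \<zero>)"
    unfolding T_mult using assms by (intro finsum_cong') (auto simp: monomial_def)
  also have "\<dots> = c \<otimes> a w"
    using assms by (subst finsum_singleton) auto
  finally show "(monomial A c [] \<otimes>\<^bsub>T\<^esub> a) w = c \<otimes> a w" .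
  have "(a \<otimes>\<^bsub>T\<^esub> monomial A c []) w = (\<Oplus>i\<in>{..length w}. if length w = i then a (take i w) \<otimes> c else \<zero>)"
    unfolding T_mult using assms by (intro finsum_cong') (auto simp: monomial_def)
  also have "\<dots> = a w \<otimes> c"
    using assms by (subst finsum_singleton) auto
  finally show "(a \<otimes>\<^bsub>T\<^esub> monomial A c []) w = a w \<otimes> c" .
qed

section \<open>Submodules spanned by words\<close>

lemma word_spanD: "a \<in> word_span A X S \<Longrightarrow> a \<in> carrier T"
  by (simp add: word_span_def)

lemma word_span_zero: "\<zero>\<^bsub>T\<^esub> \<in> word_span A X S"
  by (simp add: word_span_def T_zero)

lemma word_span_add:
  assumes "a \<in> word_span A X S" "b \<in> word_span A X S"
  shows "a \<oplus>\<^bsub>T\<^esub> b \<in> word_span A X S"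
proof -
  have "w \<in> S" if "(a \<oplus>\<^bsub>T\<^esub> b) w \<noteq> \<zero>" for w
  proof -
    have "a w \<noteq> \<zero> \<or> b w \<noteq> \<zero>"
      using that by (auto simp: T_add)
    then show ?thesis
      using assms by (auto simp: word_span_def)
  qed
  then show ?thesis
    using assms by (auto simp: word_span_def)
qed

lemma word_span_uminus: "a \<in> word_span A X S \<Longrightarrow> \<ominus>\<^bsub>T\<^esub> a \<in> word_span A X S"
  using T.a_inv_closed[of a] by (auto simp: word_span_def T_uminus) (metis minus_zero)

lemma word_span_mono: "S \<subseteq> S' \<Longrightarrow> word_span A X S \<subseteq> word_span A X S'"
  by (auto simp: word_span_def)

lemma word_span_mult:
  assumes "a \<in> word_span A X S" "b \<in> word_span A X S'" "\<And>u v. u \<in> S \<Longrightarrow> v \<in> S' \<Longrightarrow> u @ v \<in> S''"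
  shows "a \<otimes>\<^bsub>T\<^esub> b \<in> word_span A X S''"
  using T_mult_support[of a b] assms by (fastforce simp: word_span_def)

lemma word_span_monomial: "c \<in> carrier A \<Longrightarrow> w \<in> lists X \<Longrightarrow> w \<in> S \<Longrightarrow> monomial A c w \<in> word_span A X S"
  using monomial_closed by (auto simp: word_span_def monomial_def)

lemma word_span_subgroup: "additive_subgroup (word_span A X S) T"
proof (intro additive_subgroup.intro T.add.subgroupI)
  show "word_span A X S \<subseteq> carrier T"
    by (auto simp: word_span_def)
  show "word_span A X S \<noteq> {}"
    using word_span_zero by blast
  show "\<ominus>\<^bsub>T\<^esub> a \<in> word_span A X S" if "a \<in> word_span A X S" for a
    using that by (rule word_span_uminus)
  show "a \<oplus>\<^bsub>T\<^esub> b \<in> word_span A X S" if "a \<in> word_span A X S" "b \<in> word_span A X S" for a b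
    using that by (rule word_span_add)
qed

text \<open>Induction on the finite support: one word is deleted and added back as a monomial.
  Claims about classes thereby reduce to scaled words.\<close>

lemma word_span_induct [consumes 1, case_names zero add]:
  assumes "a \<in> word_span A X S" and zero: "P \<zero>\<^bsub>T\<^esub>"
    and add: "\<And>a c w. \<lbrakk>a \<in> word_span A X S; P a; c \<in> carrier A; w \<in> lists X; w \<in> S\<rbrakk> \<Longrightarrow>
      P (a \<oplus>\<^bsub>T\<^esub> monomial A c w)"
  shows "P a"
proof -
  have "P a" if "finite F" "{w. a w \<noteq> \<zero>} = F" "a \<in> word_span A X S" for F a
    using that
  proof (induction F arbitrary: a rule: finite_induct)
    case empty
    then have "a = \<zero>\<^bsub>T\<^esub>" by (auto simp: T_zero fun_eq_iff)
    then show ?case using zero by simp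
  next
    case (insert w F)
    let ?b = "a(w := \<zero>)"
    have aT: "a \<in> carrier T"
      using insert.prems(2) by (rule word_spanD)
    note [simp] = T_coeff[OF aT]
    have "?b \<in> carrier T"
      by (rule T_support_closed[of _ a a]) (use aT in \<open>auto\<close>)
    then have b: "?b \<in> word_span A X S"
      using insert.prems(2) by (auto simp: word_span_def)
    have "{v. ?b v \<noteq> \<zero>} = {v. a v \<noteq> \<zero>} - {w}" by auto
    then have "{v. ?b v \<noteq> \<zero>} = F"
      using insert by auto
    then have "P ?b"
      using insert.IH b by blast
    moreover have "a w \<noteq> \<zero>" using insert.prems(1) by blast
    ultimately have "P (?b \<oplus>\<^bsub>T\<^esub> monomial A (a w) w)"
      using b aT insert.prems(2) by (intro add) (auto simp: T_carrier word_span_def)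
    moreover have "?b \<oplus>\<^bsub>T\<^esub> monomial A (a w) w = a"
      using aT by (auto simp: T_add monomial_def)
    ultimately show ?case by simp
  qed
  then show ?thesis
    using assms(1) by (auto simp: word_span_def T_carrier)
qed

end

section \<open>The exterior algebra\<close>

locale exterior = module A M + words A "carrier M"
  for A :: "('c, 'z) ring_scheme" and M :: "('c, 'm, 'y) module_scheme"
begin

abbreviation "E \<equiv> exterior_algebra A M"
abbreviation "cls \<equiv> exterior_class A M"
abbreviation "scal \<equiv> exterior_scalar A M"

text \<open>The exterior product of the letters of \<open>w\<close>.\<close>

definition ext_word :: "'m list \<Rightarrow> ('m list \<Rightarrow> 'c) set" where
  "ext_word w = cls (monomial A \<one>\<^bsub>A\<^esub> w)"

lemma exterior_relations_closed: "exterior_relations A M \<subseteq> carrier T"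
proof -
  have m: "monomial A c [x] \<in> carrier T" if "c \<in> carrier A" "x \<in> carrier M" for c x
    using that by (intro monomial_closed) auto
  show ?thesis
    unfolding exterior_relations_def Let_def
    by (auto intro!: T.minus_closed T.a_closed T.m_closed m)
qed

lemma exterior_ideal_ideal: "ideal (exterior_ideal A M) T"
  unfolding exterior_ideal_def using exterior_relations_closed by (rule T.genideal_ideal)

lemma exterior_ideal_minimal: "ideal K T \<Longrightarrow> exterior_relations A M \<subseteq> K \<Longrightarrow> exterior_ideal A M \<subseteq> K"
  unfolding exterior_ideal_def by (rule T.genideal_minimal)

lemma exterior_relations_in_ideal: "exterior_relations A M \<subseteq> exterior_ideal A M"
  unfolding exterior_ideal_def using exterior_relations_closed by (rule T.genideal_self)

sublocale I: ideal "exterior_ideal A M" T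
  by (rule exterior_ideal_ideal)

lemma cls_hom: "ring_hom_ring T E cls"
proof -
  have "cls = (+>\<^bsub>T\<^esub>) (exterior_ideal A M)"
    by (rule ext) (simp add: exterior_class_def)
  then show ?thesis
    using I.rcos_ring_hom_ring by (simp add: exterior_algebra_def)
qed

sublocale E: ring E
  using cls_hom by (rule ring_hom_ring.axioms(2))

sublocale cls: ring_hom_ring T E cls
  by (rule cls_hom)

lemma E_carrier: "carrier E = cls ` carrier T"
  by (auto simp: exterior_algebra_def FactRing_def A_RCOSETS_defs exterior_class_def a_r_coset_def)

lemma cls_eq_iff: "a \<in> carrier T \<Longrightarrow> b \<in> carrier T \<Longrightarrow> cls a = cls b \<longleftrightarrow> a \<ominus>\<^bsub>T\<^esub> b \<in> exterior_ideal A M"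
  using T.quotient_eq_iff_same_a_r_cos[OF exterior_ideal_ideal] by (simp add: exterior_class_def)

lemma cls_eq_zero_iff: "a \<in> carrier T \<Longrightarrow> cls a = \<zero>\<^bsub>E\<^esub> \<longleftrightarrow> a \<in> exterior_ideal A M"
  using cls_eq_iff[of a "\<zero>\<^bsub>T\<^esub>"] by (simp add: T.minus_eq)

lemma scal_closed: "c \<in> carrier A \<Longrightarrow> scal c \<in> carrier E"
  by (simp add: exterior_scalar_def monomial_closed)

lemma scal_add: "c \<in> carrier A \<Longrightarrow> d \<in> carrier A \<Longrightarrow> scal (c \<oplus>\<^bsub>A\<^esub> d) = scal c \<oplus>\<^bsub>E\<^esub> scal d"
  by (simp add: exterior_scalar_def monomial_closed monomial_add[symmetric])

lemma scal_mult: "c \<in> carrier A \<Longrightarrow> d \<in> carrier A \<Longrightarrow> scal (c \<otimes>\<^bsub>A\<^esub> d) = scal c \<otimes>\<^bsub>E\<^esub> scal d"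
  using monomial_mult[of c d "[]" "[]"]
  by (simp add: exterior_scalar_def monomial_closed flip: cls.hom_mult)

lemma scal_one: "scal \<one>\<^bsub>A\<^esub> = \<one>\<^bsub>E\<^esub>"
  by (simp add: exterior_scalar_def T_one_monomial[symmetric])

lemma ext_word_closed: "w \<in> lists (carrier M) \<Longrightarrow> ext_word w \<in> carrier E"
  unfolding ext_word_def by (intro cls.hom_closed monomial_closed) auto

lemma ext_word_Nil: "ext_word [] = \<one>\<^bsub>E\<^esub>"
  by (simp add: ext_word_def T_one_monomial[symmetric])

lemma ext_word_append:
  "v \<in> lists (carrier M) \<Longrightarrow> w \<in> lists (carrier M) \<Longrightarrow> ext_word (v @ w) = ext_word v \<otimes>\<^bsub>E\<^esub> ext_word w"
  unfolding ext_word_def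
  by (subst cls.hom_mult[symmetric]) (auto simp: monomial_mult intro!: monomial_closed)

lemma cls_monomial:
  "c \<in> carrier A \<Longrightarrow> w \<in> lists (carrier M) \<Longrightarrow> cls (monomial A c w) = scal c \<otimes>\<^bsub>E\<^esub> ext_word w"
  unfolding ext_word_def exterior_scalar_def
  by (subst cls.hom_mult[symmetric]) (auto simp: monomial_mult intro!: monomial_closed)

lemma scal_central:
  assumes "c \<in> carrier A" "r \<in> carrier E"
  shows "scal c \<otimes>\<^bsub>E\<^esub> r = r \<otimes>\<^bsub>E\<^esub> scal c"
proof -
  obtain a where a: "a \<in> carrier T" "r = cls a"
    using assms by (auto simp: E_carrier)
  have "monomial A c [] \<otimes>\<^bsub>T\<^esub> a = a \<otimes>\<^bsub>T\<^esub> monomial A c []"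
    using assms a T_coeff[OF a(1)] by (auto simp: scalar_monomial_mult m_comm)
  then show ?thesis
    using assms a by (simp add: exterior_scalar_def monomial_closed flip: cls.hom_mult)
qed

lemma ext_word_add:
  assumes "x \<in> carrier M" "y \<in> carrier M"
  shows "ext_word [x \<oplus>\<^bsub>M\<^esub> y] = ext_word [x] \<oplus>\<^bsub>E\<^esub> ext_word [y]"
proof -
  let ?m = "\<lambda>x. monomial A \<one>\<^bsub>A\<^esub> [x]"
  have "?m (x \<oplus>\<^bsub>M\<^esub> y) \<ominus>\<^bsub>T\<^esub> (?m x \<oplus>\<^bsub>T\<^esub> ?m y) \<in> exterior_ideal A M"
    by (rule subsetD[OF exterior_relations_in_ideal], unfold exterior_relations_def Let_def,
        rule UnI1, rule UnI1, rule CollectI, rule exI[of _ x], rule exI[of _ y])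
      (intro conjI refl assms)
  moreover have "?m x \<in> carrier T" if "x \<in> carrier M" for x
    using that by (intro monomial_closed) auto
  ultimately show ?thesis
    using assms by (simp add: ext_word_def cls_eq_iff flip: cls.hom_add)
qed

lemma ext_word_smult:
  assumes "c \<in> carrier A" "x \<in> carrier M"
  shows "ext_word [c \<odot>\<^bsub>M\<^esub> x] = scal c \<otimes>\<^bsub>E\<^esub> ext_word [x]"
proof -
  let ?m = "\<lambda>x. monomial A \<one>\<^bsub>A\<^esub> [x]"
  have "?m (c \<odot>\<^bsub>M\<^esub> x) \<ominus>\<^bsub>T\<^esub> monomial A c [x] \<in> exterior_ideal A M"
    by (rule subsetD[OF exterior_relations_in_ideal], unfold exterior_relations_def Let_def,
        rule UnI1, rule UnI2, rule CollectI, rule exI[of _ c], rule exI[of _ x])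
      (intro conjI refl assms)
  moreover have "monomial A d [x] \<in> carrier T" if "d \<in> carrier A" "x \<in> carrier M" for d x
    using that by (intro monomial_closed) auto
  ultimately have "ext_word [c \<odot>\<^bsub>M\<^esub> x] = cls (monomial A c [x])"
    using assms by (simp add: ext_word_def cls_eq_iff)
  then show ?thesis
    using assms by (simp add: cls_monomial)
qed

lemma ext_word_square:
  assumes "x \<in> carrier M"
  shows "ext_word [x] \<otimes>\<^bsub>E\<^esub> ext_word [x] = \<zero>\<^bsub>E\<^esub>"
proof -
  let ?m = "monomial A \<one>\<^bsub>A\<^esub> [x]"
  have "?m \<otimes>\<^bsub>T\<^esub> ?m \<in> exterior_ideal A M"
    by (rule subsetD[OF exterior_relations_in_ideal], unfold exterior_relations_def Let_def,
        rule UnI2, rule CollectI, rule exI[of _ x])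
      (intro conjI refl assms)
  moreover have "?m \<in> carrier T"
    using assms by (intro monomial_closed) auto
  ultimately show ?thesis
    by (simp add: ext_word_def cls_eq_zero_iff flip: cls.hom_mult)
qed

text \<open>Polarization: the squares of the sum of \<open>x\<close> and \<open>y\<close>, of
  \<open>x\<close> and of \<open>y\<close> all vanish, so the two mixed products add up to
  zero.\<close>

lemma ext_word_anticommute:
  assumes "x \<in> carrier M" "y \<in> carrier M"
  shows "ext_word [x] \<otimes>\<^bsub>E\<^esub> ext_word [y] = \<ominus>\<^bsub>E\<^esub> (ext_word [y] \<otimes>\<^bsub>E\<^esub> ext_word [x])"
proof -
  let ?x = "ext_word [x]" and ?y = "ext_word [y]"
  have c: "?x \<in> carrier E" "?y \<in> carrier E"
    using assms by (auto intro!: ext_word_closed)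
  have "(?x \<oplus>\<^bsub>E\<^esub> ?y) \<otimes>\<^bsub>E\<^esub> (?x \<oplus>\<^bsub>E\<^esub> ?y) = \<zero>\<^bsub>E\<^esub>"
    using ext_word_square[of "x \<oplus>\<^bsub>M\<^esub> y"] assms by (simp add: ext_word_add)
  then have "?x \<otimes>\<^bsub>E\<^esub> ?y \<oplus>\<^bsub>E\<^esub> ?y \<otimes>\<^bsub>E\<^esub> ?x = \<zero>\<^bsub>E\<^esub>"
    using c assms by (simp add: E.l_distr E.r_distr ext_word_square E.a_comm)
  then show ?thesis
    using c by (intro E.minus_equality[symmetric]) auto
qed

section \<open>Signs, commutation and vanishing of words\<close>

definition sg :: "nat \<Rightarrow> ('m list \<Rightarrow> 'c) set \<Rightarrow> ('m list \<Rightarrow> 'c) set" where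
  "sg n r = (if even n then r else \<ominus>\<^bsub>E\<^esub> r)"

lemma sg_sg: "r \<in> carrier E \<Longrightarrow> sg m (sg n r) = sg (m + n) r"
  by (simp add: sg_def)

lemma sg_mult:
  "r \<in> carrier E \<Longrightarrow> s \<in> carrier E \<Longrightarrow> sg n r \<otimes>\<^bsub>E\<^esub> s = sg n (r \<otimes>\<^bsub>E\<^esub> s)"
  "r \<in> carrier E \<Longrightarrow> s \<in> carrier E \<Longrightarrow> r \<otimes>\<^bsub>E\<^esub> sg n s = sg n (r \<otimes>\<^bsub>E\<^esub> s)"
  by (simp_all add: sg_def E.l_minus E.r_minus)

lemma sg_add: "r \<in> carrier E \<Longrightarrow> s \<in> carrier E \<Longrightarrow> sg n (r \<oplus>\<^bsub>E\<^esub> s) = sg n r \<oplus>\<^bsub>E\<^esub> sg n s"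
  by (simp add: sg_def E.minus_add)

lemma ext_word_Cons:
  "x \<in> carrier M \<Longrightarrow> w \<in> lists (carrier M) \<Longrightarrow> ext_word (x # w) = ext_word [x] \<otimes>\<^bsub>E\<^esub> ext_word w"
  using ext_word_append[of "[x]" w] by simp

lemma ext_word_commute_letter:
  assumes x: "x \<in> carrier M"
  shows "w \<in> lists (carrier M) \<Longrightarrow>
    ext_word [x] \<otimes>\<^bsub>E\<^esub> ext_word w = sg (length w) (ext_word w \<otimes>\<^bsub>E\<^esub> ext_word [x])"
proof (induction w)
  case Nil
  then show ?case using ext_word_closed[of "[x]"] x by (simp add: ext_word_Nil sg_def)
next
  case (Cons y w)
  then have y: "y \<in> carrier M" and w: "w \<in> lists (carrier M)" by auto
  let ?x = "ext_word [x]" and ?y = "ext_word [y]" and ?w = "ext_word w"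
  have c: "?x \<in> carrier E" "?y \<in> carrier E" "?w \<in> carrier E"
    using x y w by (auto intro!: ext_word_closed)
  have "?x \<otimes>\<^bsub>E\<^esub> (?y \<otimes>\<^bsub>E\<^esub> ?w) = sg 1 (?y \<otimes>\<^bsub>E\<^esub> (?x \<otimes>\<^bsub>E\<^esub> ?w))"
    using c ext_word_anticommute[OF x y] by (simp add: sg_def E.l_minus flip: E.m_assoc)
  also have "\<dots> = sg (Suc (length w)) (?y \<otimes>\<^bsub>E\<^esub> ?w \<otimes>\<^bsub>E\<^esub> ?x)"
    using c Cons.IH[OF w] by (simp add: sg_mult sg_sg E.m_assoc)
  finally show ?case
    using ext_word_Cons[OF y w] by simp
qed

lemma ext_word_commute:
  assumes w: "w \<in> lists (carrier M)"
  shows "v \<in> lists (carrier M) \<Longrightarrow>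
    ext_word v \<otimes>\<^bsub>E\<^esub> ext_word w = sg (length v * length w) (ext_word w \<otimes>\<^bsub>E\<^esub> ext_word v)"
proof (induction v)
  case Nil
  then show ?case using ext_word_closed[OF w] by (simp add: ext_word_Nil sg_def)
next
  case (Cons x v)
  then have x: "x \<in> carrier M" and v: "v \<in> lists (carrier M)" by auto
  let ?x = "ext_word [x]" and ?v = "ext_word v" and ?w = "ext_word w"
  have c: "?x \<in> carrier E" "?v \<in> carrier E" "?w \<in> carrier E"
    using x v w by (auto intro!: ext_word_closed)
  have "?x \<otimes>\<^bsub>E\<^esub> ?v \<otimes>\<^bsub>E\<^esub> ?w = sg (length v * length w) (?x \<otimes>\<^bsub>E\<^esub> ?w \<otimes>\<^bsub>E\<^esub> ?v)"
    using c Cons.IH[OF v] by (simp add: sg_mult E.m_assoc)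
  also have "\<dots> = sg (length v * length w + length w) (?w \<otimes>\<^bsub>E\<^esub> (?x \<otimes>\<^bsub>E\<^esub> ?v))"
    using c ext_word_commute_letter[OF x w] by (simp add: sg_mult sg_sg E.m_assoc)
  finally show ?case
    using ext_word_Cons[OF x v] by (simp add: add.commute)
qed

text \<open>Moving the first \<open>x\<close> past \<open>v\<close> costs only a sign and brings the
  equal letters together, where their square vanishes.\<close>

lemma ext_word_repeat:
  assumes "x \<in> carrier M" "u \<in> lists (carrier M)" "v \<in> lists (carrier M)" "w \<in> lists (carrier M)"
  shows "ext_word (u @ [x] @ v @ [x] @ w) = \<zero>\<^bsub>E\<^esub>"
proof -
  let ?x = "ext_word [x]" and ?u = "ext_word u" and ?v = "ext_word v" and ?w = "ext_word w"
  have c: "?x \<in> carrier E" "?u \<in> carrier E" "?v \<in> carrier E" "?w \<in> carrier E"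
    using assms by (auto intro!: ext_word_closed)
  have "?x \<otimes>\<^bsub>E\<^esub> (?v \<otimes>\<^bsub>E\<^esub> (?x \<otimes>\<^bsub>E\<^esub> ?w)) = (?x \<otimes>\<^bsub>E\<^esub> ?v) \<otimes>\<^bsub>E\<^esub> (?x \<otimes>\<^bsub>E\<^esub> ?w)"
    using c by (simp add: E.m_assoc)
  also have "\<dots> = sg (length v) (?v \<otimes>\<^bsub>E\<^esub> ((?x \<otimes>\<^bsub>E\<^esub> ?x) \<otimes>\<^bsub>E\<^esub> ?w))"
    using c ext_word_commute_letter[OF assms(1,3)] by (simp add: sg_mult E.m_assoc)
  also have "\<dots> = \<zero>\<^bsub>E\<^esub>"
    using c ext_word_square[OF assms(1)] by (simp add: sg_def)
  finally show ?thesis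
    using assms c by (simp add: ext_word_append ext_word_Cons[of x "v @ x # w"] ext_word_Cons[of x w])
qed

lemma ext_word_self:
  assumes "w \<in> lists (carrier M)" "w \<noteq> []"
  shows "ext_word w \<otimes>\<^bsub>E\<^esub> ext_word w = \<zero>\<^bsub>E\<^esub>"
proof -
  obtain x v where w: "w = x # v"
    using assms(2) by (cases w) auto
  have "ext_word w \<otimes>\<^bsub>E\<^esub> ext_word w = ext_word ([] @ [x] @ v @ [x] @ v)"
    using assms(1) w by (subst ext_word_append[symmetric]) auto
  also have "\<dots> = \<zero>\<^bsub>E\<^esub>"
    using assms(1) w by (intro ext_word_repeat) auto
  finally show ?thesis .
qed

lemma ext_word_finsum:
  assumes "finite K" "c \<in> K \<rightarrow> carrier A" "\<theta> \<in> K \<rightarrow> carrier M"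
  shows "ext_word [\<Oplus>\<^bsub>M\<^esub>i\<in>K. c i \<odot>\<^bsub>M\<^esub> \<theta> i] = (\<Oplus>\<^bsub>E\<^esub>i\<in>K. scal (c i) \<otimes>\<^bsub>E\<^esub> ext_word [\<theta> i])"
  using assms
proof (induction K rule: finite_induct)
  case empty
  \<comment> \<open>The letter zero is not the empty word. Its class z satisfies z + z = z by
    additivity and is therefore zero.\<close>
  have "ext_word [\<zero>\<^bsub>M\<^esub>] \<oplus>\<^bsub>E\<^esub> ext_word [\<zero>\<^bsub>M\<^esub>] = ext_word [\<zero>\<^bsub>M\<^esub>]"
    using ext_word_add[of "\<zero>\<^bsub>M\<^esub>" "\<zero>\<^bsub>M\<^esub>"] by simp
  then have "ext_word [\<zero>\<^bsub>M\<^esub>] = \<zero>\<^bsub>E\<^esub>"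
    using E.add.l_cancel_one'[of "ext_word [\<zero>\<^bsub>M\<^esub>]" "ext_word [\<zero>\<^bsub>M\<^esub>]"] by (auto simp: ext_word_closed)
  then show ?case by simp
next
  case (insert i K)
  then have c: "c i \<in> carrier A" "\<theta> i \<in> carrier M" "c \<in> K \<rightarrow> carrier A" "\<theta> \<in> K \<rightarrow> carrier M"
    by auto
  have S: "(\<Oplus>\<^bsub>M\<^esub>i\<in>K. c i \<odot>\<^bsub>M\<^esub> \<theta> i) \<in> carrier M"
    using c by (intro M.finsum_closed) (auto simp: Pi_def smult_closed)
  have "(\<Oplus>\<^bsub>M\<^esub>i\<in>insert i K. c i \<odot>\<^bsub>M\<^esub> \<theta> i) = c i \<odot>\<^bsub>M\<^esub> \<theta> i \<oplus>\<^bsub>M\<^esub> (\<Oplus>\<^bsub>M\<^esub>i\<in>K. c i \<odot>\<^bsub>M\<^esub> \<theta> i)"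
    using insert.hyps c by (intro M.finsum_insert) (auto simp: Pi_def smult_closed)
  moreover have "(\<Oplus>\<^bsub>E\<^esub>i\<in>insert i K. scal (c i) \<otimes>\<^bsub>E\<^esub> ext_word [\<theta> i]) =
      scal (c i) \<otimes>\<^bsub>E\<^esub> ext_word [\<theta> i] \<oplus>\<^bsub>E\<^esub> (\<Oplus>\<^bsub>E\<^esub>i\<in>K. scal (c i) \<otimes>\<^bsub>E\<^esub> ext_word [\<theta> i])"
    using insert.hyps c by (intro E.finsum_insert) (auto simp: Pi_def scal_closed ext_word_closed)
  ultimately show ?case
    using insert.IH c S by (simp add: ext_word_add ext_word_smult smult_closed)
qed

text \<open>The letters of \<open>w\<close> are expanded in the basis and transferred to
  \<open>u\<close> one at a time. In the end all letters are among at most q basis vectors, and more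
  than q such letters contain a repetition.\<close>

lemma ext_word_vanish:
  assumes \<theta>: "\<theta> \<in> {1..q} \<rightarrow> carrier M"
    and span: "\<And>x. x \<in> carrier M \<Longrightarrow> \<exists>c. c \<in> {1..q} \<rightarrow> carrier A \<and> x = (\<Oplus>\<^bsub>M\<^esub>i\<in>{1..q}. c i \<odot>\<^bsub>M\<^esub> \<theta> i)"
  shows "w \<in> lists (carrier M) \<Longrightarrow> u \<in> lists (\<theta> ` {1..q}) \<Longrightarrow> q < length u + length w \<Longrightarrow>
    ext_word u \<otimes>\<^bsub>E\<^esub> ext_word w = \<zero>\<^bsub>E\<^esub>"
proof (induction w arbitrary: u)
  case Nil
  have uM: "u \<in> lists (carrier M)"
    using Nil.prems(2) \<theta> by auto
  have "card (set u) \<le> card (\<theta> ` {1..q})"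
    using Nil.prems(2) by (intro card_mono) auto
  also have "\<dots> \<le> q"
    using card_image_le[of "{1..q}" \<theta>] by simp
  finally have "\<not> distinct u"
    using Nil.prems(3) by (auto dest: distinct_card)
  then obtain xs ys zs y where u: "u = xs @ [y] @ ys @ [y] @ zs"
    using not_distinct_decomp by blast
  then have "ext_word u = \<zero>\<^bsub>E\<^esub>"
    using uM ext_word_repeat[of y xs ys zs] by auto
  then show ?case by (simp add: ext_word_Nil)
next
  case (Cons x w)
  then have x: "x \<in> carrier M" and w: "w \<in> lists (carrier M)" by auto
  have uM: "u \<in> lists (carrier M)"
    using Cons.prems(2) \<theta> by auto
  obtain c where c: "c \<in> {1..q} \<rightarrow> carrier A" "x = (\<Oplus>\<^bsub>M\<^esub>i\<in>{1..q}. c i \<odot>\<^bsub>M\<^esub> \<theta> i)"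
    using span[OF x] by blast
  have ci: "scal (c i) \<in> carrier E" "ext_word [\<theta> i] \<in> carrier E" "\<theta> i \<in> carrier M" "c i \<in> carrier A"
    if "i \<in> {1..q}" for i
    using that c \<theta> by (auto simp: Pi_def intro!: scal_closed ext_word_closed)
  have U: "ext_word u \<in> carrier E" "ext_word w \<in> carrier E"
    using uM w by (auto intro: ext_word_closed)
  have "ext_word u \<otimes>\<^bsub>E\<^esub> ext_word (x # w) =
      (ext_word u \<otimes>\<^bsub>E\<^esub> (\<Oplus>\<^bsub>E\<^esub>i\<in>{1..q}. scal (c i) \<otimes>\<^bsub>E\<^esub> ext_word [\<theta> i])) \<otimes>\<^bsub>E\<^esub> ext_word w"
    using ext_word_Cons[OF x w] ext_word_finsum[OF _ c(1) \<theta>] ext_word_closed[of "[x]"] U x c(2)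
    by (simp add: E.m_assoc)
  also have "\<dots> = (\<Oplus>\<^bsub>E\<^esub>i\<in>{1..q}. ext_word u \<otimes>\<^bsub>E\<^esub> (scal (c i) \<otimes>\<^bsub>E\<^esub> ext_word [\<theta> i])) \<otimes>\<^bsub>E\<^esub> ext_word w"
    using U ci by (subst E.finsum_rdistr) auto
  also have "\<dots> = (\<Oplus>\<^bsub>E\<^esub>i\<in>{1..q}. ext_word u \<otimes>\<^bsub>E\<^esub> (scal (c i) \<otimes>\<^bsub>E\<^esub> ext_word [\<theta> i]) \<otimes>\<^bsub>E\<^esub> ext_word w)"
    using U ci by (intro E.finsum_ldistr) auto
  also have "\<dots> = (\<Oplus>\<^bsub>E\<^esub>i\<in>{1..q}. \<zero>\<^bsub>E\<^esub>)"
  proof (rule E.finsum_cong')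
    fix i assume i: "i \<in> {1..q}"
    have "ext_word u \<otimes>\<^bsub>E\<^esub> (scal (c i) \<otimes>\<^bsub>E\<^esub> ext_word [\<theta> i]) \<otimes>\<^bsub>E\<^esub> ext_word w =
        scal (c i) \<otimes>\<^bsub>E\<^esub> (ext_word u \<otimes>\<^bsub>E\<^esub> ext_word [\<theta> i]) \<otimes>\<^bsub>E\<^esub> ext_word w"
      using U ci[OF i] scal_central[of "c i" "ext_word u"] by (simp flip: E.m_assoc)
    also have "\<dots> = scal (c i) \<otimes>\<^bsub>E\<^esub> (ext_word (u @ [\<theta> i]) \<otimes>\<^bsub>E\<^esub> ext_word w)"
      using U ci[OF i] uM by (simp add: ext_word_append E.m_assoc)
    also have "ext_word (u @ [\<theta> i]) \<otimes>\<^bsub>E\<^esub> ext_word w = \<zero>\<^bsub>E\<^esub>"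
      using Cons.prems i w by (intro Cons.IH) auto
    finally show "ext_word u \<otimes>\<^bsub>E\<^esub> (scal (c i) \<otimes>\<^bsub>E\<^esub> ext_word [\<theta> i]) \<otimes>\<^bsub>E\<^esub> ext_word w = \<zero>\<^bsub>E\<^esub>"
      using ci[OF i] by simp
  qed auto
  finally show ?case by simp
qed

end

section \<open>Parity and the nilpotent ideal\<close>

text \<open>\<open>p = True\<close> selects the even part. With a Boolean index the parity of a
  product of parts is simply \<open>p = r\<close>.\<close>

definition parity_part :: "('c, 'z) ring_scheme \<Rightarrow> bool \<Rightarrow> ('m list \<Rightarrow> 'c) \<Rightarrow> 'm list \<Rightarrow> 'c" where
  "parity_part A p a = (\<lambda>w. if even (length w) = p then a w else \<zero>\<^bsub>A\<^esub>)"

context words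
begin

abbreviation "ppart \<equiv> parity_part A"

lemma part_closed: "a \<in> carrier T \<Longrightarrow> ppart p a \<in> carrier T"
  by (rule T_support_closed[of _ a a]) (auto simp: parity_part_def T_coeff[of a])

lemma part_span: "a \<in> carrier T \<Longrightarrow> ppart p a \<in> word_span A X {w. even (length w) = p}"
  using part_closed[of a p] by (auto simp: word_span_def parity_part_def)

lemma part_split: "a \<in> carrier T \<Longrightarrow> a = ppart True a \<oplus>\<^bsub>T\<^esub> ppart False a"
  using T_coeff[of a] by (auto simp: fun_eq_iff T_add parity_part_def)

lemma part_uminus: "a \<in> carrier T \<Longrightarrow> ppart p (\<ominus>\<^bsub>T\<^esub> a) = \<ominus>\<^bsub>T\<^esub> ppart p a"
  using part_closed[of a p] by (auto simp: fun_eq_iff T_uminus parity_part_def)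

lemma part_add: "ppart p (a \<oplus>\<^bsub>T\<^esub> b) = ppart p a \<oplus>\<^bsub>T\<^esub> ppart p b"
  by (auto simp: fun_eq_iff T_add parity_part_def)

lemma part_span_same:
  assumes "a \<in> word_span A X {w. even (length w) = p}"
  shows "ppart p a = a"
proof -
  have "a w = \<zero>" if "even (length w) \<noteq> p" for w
    using that assms unfolding word_span_def by blast
  then show ?thesis by (simp add: fun_eq_iff parity_part_def)
qed

lemma part_span_other:
  assumes "a \<in> word_span A X {w. even (length w) \<noteq> p}"
  shows "ppart p a = \<zero>\<^bsub>T\<^esub>"
proof -
  have "a w = \<zero>" if "even (length w) = p" for w
    using that assms unfolding word_span_def by blast
  then show ?thesis by (simp add: fun_eq_iff parity_part_def T_zero)
qed

lemma part_mult:
  assumes "a \<in> carrier T" "b \<in> carrier T"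
  shows "ppart True (a \<otimes>\<^bsub>T\<^esub> b) = ppart True a \<otimes>\<^bsub>T\<^esub> ppart True b \<oplus>\<^bsub>T\<^esub> ppart False a \<otimes>\<^bsub>T\<^esub> ppart False b"
proof -
  have c: "ppart p a \<in> carrier T" "ppart p b \<in> carrier T" for p
    using assms by (auto simp: part_closed)
  have span: "ppart p a \<otimes>\<^bsub>T\<^esub> ppart r b \<in> word_span A X {w. even (length w) = (p = r)}" for p r
    using part_span[OF assms(1)] part_span[OF assms(2)] by (rule word_span_mult) auto
  have "a \<otimes>\<^bsub>T\<^esub> b = (ppart True a \<oplus>\<^bsub>T\<^esub> ppart False a) \<otimes>\<^bsub>T\<^esub> (ppart True b \<oplus>\<^bsub>T\<^esub> ppart False b)"
    using part_split[OF assms(1)] part_split[OF assms(2)] by simp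
  also have "\<dots> = (ppart True a \<otimes>\<^bsub>T\<^esub> ppart True b \<oplus>\<^bsub>T\<^esub> ppart False a \<otimes>\<^bsub>T\<^esub> ppart False b) \<oplus>\<^bsub>T\<^esub>
      (ppart True a \<otimes>\<^bsub>T\<^esub> ppart False b \<oplus>\<^bsub>T\<^esub> ppart False a \<otimes>\<^bsub>T\<^esub> ppart True b)"
    using c by (simp add: T.l_distr T.r_distr T.a_ac)
  finally have eq: "a \<otimes>\<^bsub>T\<^esub> b = (ppart True a \<otimes>\<^bsub>T\<^esub> ppart True b \<oplus>\<^bsub>T\<^esub> ppart False a \<otimes>\<^bsub>T\<^esub> ppart False b) \<oplus>\<^bsub>T\<^esub>
      (ppart True a \<otimes>\<^bsub>T\<^esub> ppart False b \<oplus>\<^bsub>T\<^esub> ppart False a \<otimes>\<^bsub>T\<^esub> ppart True b)" .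
  have "ppart True a \<otimes>\<^bsub>T\<^esub> ppart True b \<oplus>\<^bsub>T\<^esub> ppart False a \<otimes>\<^bsub>T\<^esub> ppart False b \<in> word_span A X {w. even (length w) = True}"
    using span[of True True] span[of False False] by (intro word_span_add) simp_all
  moreover have "ppart True a \<otimes>\<^bsub>T\<^esub> ppart False b \<oplus>\<^bsub>T\<^esub> ppart False a \<otimes>\<^bsub>T\<^esub> ppart True b \<in> word_span A X {w. even (length w) \<noteq> True}"
    using span[of True False] span[of False True] by (intro word_span_add) simp_all
  ultimately show ?thesis
    using c unfolding eq part_add[of True "_ \<oplus>\<^bsub>T\<^esub> _" "_ \<oplus>\<^bsub>T\<^esub> _"]
    by (simp only: part_span_same part_span_other) (simp add: T.r_zero)
qed

end

context exterior
begin

text \<open>The linearity relations live in degree 1 and the squares in degree 2. Two properties of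
  the ideal follow from this: compatibility with parity and the absence of constant terms.\<close>

lemma exterior_relations_homogeneous:
  "exterior_relations A M \<subseteq>
    word_span A (carrier M) {w. length w = 1} \<union> word_span A (carrier M) {w. length w = 2}"
proof -
  have m: "monomial A c [x] \<in> word_span A (carrier M) {w. length w = 1}"
    if "c \<in> carrier A" "x \<in> carrier M" for c x
    using that by (intro word_span_monomial) auto
  have sub: "a \<ominus>\<^bsub>T\<^esub> b \<in> word_span A (carrier M) S" if "a \<in> word_span A (carrier M) S" "b \<in> word_span A (carrier M) S" for a b S
    unfolding T.minus_eq using that by (intro word_span_add word_span_uminus)
  have sq: "monomial A \<one>\<^bsub>A\<^esub> [x] \<otimes>\<^bsub>T\<^esub> monomial A \<one>\<^bsub>A\<^esub> [x] \<in> word_span A (carrier M) {w. length w = 2}"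
    if "x \<in> carrier M" for x
    by (rule word_span_mult[OF m m]) (use that in auto)
  show ?thesis
    unfolding exterior_relations_def Let_def
  proof (intro Un_least subsetI)
    fix r assume "r \<in> {monomial A \<one>\<^bsub>A\<^esub> [x \<oplus>\<^bsub>M\<^esub> y] \<ominus>\<^bsub>T\<^esub> (monomial A \<one>\<^bsub>A\<^esub> [x] \<oplus>\<^bsub>T\<^esub> monomial A \<one>\<^bsub>A\<^esub> [y]) |x y.
        x \<in> carrier M \<and> y \<in> carrier M}"
    then show "r \<in> word_span A (carrier M) {w. length w = 1} \<union> word_span A (carrier M) {w. length w = 2}"
      by (elim CollectE exE conjE, hypsubst) (intro UnI1 sub word_span_add m; simp)
  next
    fix r assume "r \<in> {monomial A \<one>\<^bsub>A\<^esub> [c \<odot>\<^bsub>M\<^esub> x] \<ominus>\<^bsub>T\<^esub> monomial A c [x] |c x.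
        c \<in> carrier A \<and> x \<in> carrier M}"
    then show "r \<in> word_span A (carrier M) {w. length w = 1} \<union> word_span A (carrier M) {w. length w = 2}"
      by (elim CollectE exE conjE, hypsubst) (intro UnI1 sub m; simp)
  next
    fix r assume "r \<in> {monomial A \<one>\<^bsub>A\<^esub> [x] \<otimes>\<^bsub>T\<^esub> monomial A \<one>\<^bsub>A\<^esub> [x] |x. x \<in> carrier M}"
    then show "r \<in> word_span A (carrier M) {w. length w = 1} \<union> word_span A (carrier M) {w. length w = 2}"
      by (elim CollectE exE conjE, hypsubst) (intro UnI2 sq; simp)
  qed
qed

text \<open>The elements of the ideal whose even part stays in it form an ideal themselves. It
  contains the generators because each of them has a definite parity, and minimality makes it the
  whole ideal.\<close>

lemma exterior_ideal_homogeneous: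
  assumes "a \<in> exterior_ideal A M"
  shows "ppart True a \<in> exterior_ideal A M"
proof -
  let ?I = "exterior_ideal A M"
  define H where "H = {a \<in> ?I. ppart True a \<in> ?I}"
  have HI: "a \<in> ?I" "ppart True a \<in> ?I" "a \<in> carrier T" if "a \<in> H" for a
    using that I.Icarr by (auto simp: H_def)
  \<comment> \<open>The even part of a product involves the odd parts of the factors, so closure of
    \<open>H\<close> under multiplication also uses this.\<close>
  have odd: "ppart False a \<in> ?I" if "a \<in> H" for a
  proof -
    have "ppart False a = \<ominus>\<^bsub>T\<^esub> ppart True a \<oplus>\<^bsub>T\<^esub> a"
      using part_split[OF HI(3)[OF that]] part_closed[OF HI(3)[OF that]] T.r_neg1 by metis
    then show ?thesis
      using HI[OF that] by simp
  qed
  have "ideal H T"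
  proof (rule idealI[OF T.ring_axioms])
    show "subgroup H (add_monoid T)"
    proof (rule T.add.subgroupI)
      show "H \<subseteq> carrier T" using HI by blast
      have "ppart True \<zero>\<^bsub>T\<^esub> = \<zero>\<^bsub>T\<^esub>"
        by (auto simp: parity_part_def T_zero)
      then have "\<zero>\<^bsub>T\<^esub> \<in> H"
        by (simp add: H_def)
      then show "H \<noteq> {}" by blast
      show "\<ominus>\<^bsub>T\<^esub> a \<in> H" if "a \<in> H" for a
        using HI[OF that] by (simp add: H_def part_uminus)
      show "a \<oplus>\<^bsub>T\<^esub> b \<in> H" if "a \<in> H" "b \<in> H" for a b
        using HI[OF that(1)] HI[OF that(2)] by (simp add: H_def part_add)
    qed
    show "x \<otimes>\<^bsub>T\<^esub> a \<in> H" "a \<otimes>\<^bsub>T\<^esub> x \<in> H" if "a \<in> H" "x \<in> carrier T" for a x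
      using HI[OF that(1)] odd[OF that(1)] that(2)
      by (auto simp: H_def part_mult part_closed I.I_l_closed I.I_r_closed)
  qed
  moreover have "exterior_relations A M \<subseteq> H"
  proof
    fix r assume r: "r \<in> exterior_relations A M"
    then have rI: "r \<in> ?I"
      using exterior_relations_in_ideal by blast
    have "r \<in> word_span A (carrier M) {w. even (length w) \<noteq> True} \<or>
        r \<in> word_span A (carrier M) {w. even (length w) = True}"
      using r exterior_relations_homogeneous
        word_span_mono[of "{w. length w = 1}" "{w. even (length w) \<noteq> True}"]
        word_span_mono[of "{w. length w = 2}" "{w. even (length w) = True}"]
      by fastforce
    then have "ppart True r = \<zero>\<^bsub>T\<^esub> \<or> ppart True r = r"
      using part_span_same part_span_other by blast
    then show "r \<in> H"
      using rI by (auto simp: H_def)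
  qed
  ultimately have "?I \<subseteq> H"
    by (rule exterior_ideal_minimal)
  then show ?thesis
    using assms by (auto simp: H_def)
qed

text \<open>The words of positive length span an ideal, the kernel of the augmentation, and it
  contains the generators. Hence the constant coefficient is well defined on classes.\<close>

lemma exterior_ideal_augmentation: "exterior_ideal A M \<subseteq> word_span A (carrier M) {w. w \<noteq> []}"
proof (rule exterior_ideal_minimal)
  have carr: "carrier T = word_span A (carrier M) UNIV"
    by (simp add: word_span_def)
  show "ideal (word_span A (carrier M) {w. w \<noteq> []}) T"
  proof (rule idealI[OF T.ring_axioms])
    show "subgroup (word_span A (carrier M) {w. w \<noteq> []}) (add_monoid T)"
      using word_span_subgroup by (rule additive_subgroup.a_subgroup)
    show "x \<otimes>\<^bsub>T\<^esub> a \<in> word_span A (carrier M) {w. w \<noteq> []}"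
      if "a \<in> word_span A (carrier M) {w. w \<noteq> []}" "x \<in> carrier T" for a x
      using that(2,1) unfolding carr by (rule word_span_mult) simp
    show "a \<otimes>\<^bsub>T\<^esub> x \<in> word_span A (carrier M) {w. w \<noteq> []}"
      if "a \<in> word_span A (carrier M) {w. w \<noteq> []}" "x \<in> carrier T" for a x
      using that unfolding carr by (rule word_span_mult) simp
  qed
  show "exterior_relations A M \<subseteq> word_span A (carrier M) {w. w \<noteq> []}"
    using exterior_relations_homogeneous
      word_span_mono[of "{w. length w = 1}" "{w. w \<noteq> []}"]
      word_span_mono[of "{w. length w = 2}" "{w. w \<noteq> []}"]
    by fastforce
qed

section \<open>The superring structure of the exterior algebra\<close>

abbreviation "R0 \<equiv> exterior_even A M"
abbreviation "R1 \<equiv> exterior_odd A M"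

lemma R0_def: "R0 = cls ` word_span A (carrier M) {w. even (length w)}"
  by (simp add: exterior_even_def word_span_def)

lemma R1_def: "R1 = cls ` word_span A (carrier M) {w. odd (length w)}"
  by (simp add: exterior_odd_def word_span_def)

lemma cls_span_subgroup: "additive_subgroup (cls ` word_span A (carrier M) S) E"
proof (intro additive_subgroup.intro E.add.subgroupI)
  have c: "a \<in> carrier T" if "a \<in> word_span A (carrier M) S" for a
    using that by (rule word_spanD)
  show "cls ` word_span A (carrier M) S \<subseteq> carrier E"
    by (auto dest: c)
  show "cls ` word_span A (carrier M) S \<noteq> {}"
    using word_span_zero by blast
  show "\<ominus>\<^bsub>E\<^esub> x \<in> cls ` word_span A (carrier M) S" if x: "x \<in> cls ` word_span A (carrier M) S" for x
  proof -
    obtain a where a: "a \<in> word_span A (carrier M) S" "x = cls a"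
      using x by blast
    show ?thesis
      by (rule image_eqI[OF _ word_span_uminus[OF a(1)]]) (simp add: a(2) c[OF a(1)])
  qed
  show "x \<oplus>\<^bsub>E\<^esub> y \<in> cls ` word_span A (carrier M) S"
    if xy: "x \<in> cls ` word_span A (carrier M) S" "y \<in> cls ` word_span A (carrier M) S" for x y
  proof -
    obtain a b where ab: "a \<in> word_span A (carrier M) S" "x = cls a" "b \<in> word_span A (carrier M) S" "y = cls b"
      using xy by blast
    show ?thesis
      by (rule image_eqI[OF _ word_span_add[OF ab(1,3)]]) (simp add: ab(2,4) c[OF ab(1)] c[OF ab(3)])
  qed
qed

lemma cls_span_mult:
  assumes "x \<in> cls ` word_span A (carrier M) S" "y \<in> cls ` word_span A (carrier M) S'"
    and S: "\<And>u v. u \<in> S \<Longrightarrow> v \<in> S' \<Longrightarrow> u @ v \<in> S''"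
  shows "x \<otimes>\<^bsub>E\<^esub> y \<in> cls ` word_span A (carrier M) S''"
proof -
  obtain a b where ab: "a \<in> word_span A (carrier M) S" "x = cls a" "b \<in> word_span A (carrier M) S'" "y = cls b"
    using assms by blast
  show ?thesis
    by (rule image_eqI[OF _ word_span_mult[OF ab(1,3) S]]) (simp_all add: ab(2,4) word_spanD[OF ab(1)] word_spanD[OF ab(3)])
qed

lemma monomial_commute:
  assumes "c \<in> carrier A" "d \<in> carrier A" "v \<in> lists (carrier M)" "w \<in> lists (carrier M)"
  shows "cls (monomial A c v) \<otimes>\<^bsub>E\<^esub> cls (monomial A d w) =
    sg (length v * length w) (cls (monomial A d w) \<otimes>\<^bsub>E\<^esub> cls (monomial A c v))"
proof -
  let ?V = "ext_word v" and ?W = "ext_word w" and ?c = "scal c" and ?d = "scal d"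
  have cl: "?V \<in> carrier E" "?W \<in> carrier E" "?c \<in> carrier E" "?d \<in> carrier E"
    using assms by (auto intro: ext_word_closed scal_closed)
  have move: "scal c \<otimes>\<^bsub>E\<^esub> V \<otimes>\<^bsub>E\<^esub> (scal d \<otimes>\<^bsub>E\<^esub> W) = scal c \<otimes>\<^bsub>E\<^esub> scal d \<otimes>\<^bsub>E\<^esub> (V \<otimes>\<^bsub>E\<^esub> W)"
    if "V \<in> carrier E" "W \<in> carrier E" "c \<in> carrier A" "d \<in> carrier A" for V W c d
  proof -
    have "scal c \<in> carrier E" "scal d \<in> carrier E"
      using that by (auto intro: scal_closed)
    then have "scal c \<otimes>\<^bsub>E\<^esub> V \<otimes>\<^bsub>E\<^esub> (scal d \<otimes>\<^bsub>E\<^esub> W) = scal c \<otimes>\<^bsub>E\<^esub> ((V \<otimes>\<^bsub>E\<^esub> scal d) \<otimes>\<^bsub>E\<^esub> W)"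
      using that by (simp add: E.m_assoc)
    also have "V \<otimes>\<^bsub>E\<^esub> scal d = scal d \<otimes>\<^bsub>E\<^esub> V"
      using scal_central that by simp
    finally show ?thesis
      using that \<open>scal c \<in> carrier E\<close> \<open>scal d \<in> carrier E\<close> by (simp add: E.m_assoc)
  qed
  have "cls (monomial A c v) \<otimes>\<^bsub>E\<^esub> cls (monomial A d w) = ?c \<otimes>\<^bsub>E\<^esub> ?d \<otimes>\<^bsub>E\<^esub> (?V \<otimes>\<^bsub>E\<^esub> ?W)"
    using assms cl by (simp add: cls_monomial move)
  also have "\<dots> = sg (length v * length w) (?d \<otimes>\<^bsub>E\<^esub> ?c \<otimes>\<^bsub>E\<^esub> (?W \<otimes>\<^bsub>E\<^esub> ?V))"
    using assms cl ext_word_commute[OF assms(4,3)] scal_central[of c ?d] by (simp add: sg_mult)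
  also have "?d \<otimes>\<^bsub>E\<^esub> ?c \<otimes>\<^bsub>E\<^esub> (?W \<otimes>\<^bsub>E\<^esub> ?V) = cls (monomial A d w) \<otimes>\<^bsub>E\<^esub> cls (monomial A c v)"
    using assms cl by (simp add: cls_monomial move)
  finally show ?thesis .
qed

lemma sg_cong: "even m = even n \<Longrightarrow> sg m r = sg n r"
  by (simp add: sg_def)

lemma sg_zero: "sg n \<zero>\<^bsub>E\<^esub> = \<zero>\<^bsub>E\<^esub>"
  by (simp add: sg_def)

text \<open>A bilinear reduction to scaled words works only if all pairs of words commute with the
  same sign; the parity condition on \<open>S\<close> and \<open>S'\<close> ensures this, and
  \<open>n\<close> stands for the common parity.\<close>

lemma cls_span_commute:
  assumes a: "a \<in> word_span A (carrier M) S" and b: "b \<in> word_span A (carrier M) S'"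
    and S: "\<And>v w. v \<in> S \<Longrightarrow> w \<in> S' \<Longrightarrow> even (length v * length w) = even n"
  shows "cls a \<otimes>\<^bsub>E\<^esub> cls b = sg n (cls b \<otimes>\<^bsub>E\<^esub> cls a)"
  using a
proof (induction rule: word_span_induct)
  case zero
  then show ?case using word_spanD[OF b] by (simp add: sg_zero)
next
  case (add a c v)
  let ?v = "monomial A c v"
  have v: "?v \<in> carrier T" and aT: "a \<in> carrier T" and bT: "b \<in> carrier T"
    using add b by (auto intro: monomial_closed word_spanD)
  have "cls ?v \<otimes>\<^bsub>E\<^esub> cls b = sg n (cls b \<otimes>\<^bsub>E\<^esub> cls ?v)"
    using b
  proof (induction rule: word_span_induct)
    case zero
    then show ?case using v by (simp add: sg_zero)
  next
    case (add b d w)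
    have w: "monomial A d w \<in> carrier T" and bT: "b \<in> carrier T"
      using add by (auto intro: monomial_closed word_spanD)
    have "cls ?v \<otimes>\<^bsub>E\<^esub> cls (monomial A d w) = sg n (cls (monomial A d w) \<otimes>\<^bsub>E\<^esub> cls ?v)"
      using monomial_commute[of c d v w] add.hyps \<open>c \<in> carrier A\<close> \<open>v \<in> lists (carrier M)\<close>
        sg_cong[OF S[OF \<open>v \<in> S\<close> \<open>w \<in> S'\<close>]] by simp
    then show ?case
      using add.IH v w bT by (simp add: E.l_distr E.r_distr sg_add)
  qed
  then show ?case
    using add.IH v aT bT by (simp add: E.l_distr E.r_distr sg_add)
qed

lemma exterior_superring: "superring E R0 R1"
proof (intro superring.intro superring_axioms.intro)
  let ?W = "word_span A (carrier M)"
  show "ring E" by (rule E.ring_axioms)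
  show "additive_subgroup R0 E" "additive_subgroup R1 E"
    unfolding R0_def R1_def by (rule cls_span_subgroup)+
  show "\<exists>a\<in>R0. \<exists>b\<in>R1. x = a \<oplus>\<^bsub>E\<^esub> b" if x: "x \<in> carrier E" for x
  proof -
    obtain a where a: "a \<in> carrier T" "x = cls a"
      using x by (auto simp: E_carrier)
    have "x = cls (ppart True a) \<oplus>\<^bsub>E\<^esub> cls (ppart False a)"
      using part_split[OF a(1)] part_closed[OF a(1)] a(2) cls.hom_add by metis
    moreover have "cls (ppart True a) \<in> R0" "cls (ppart False a) \<in> R1"
      using part_span[OF a(1), of True] part_span[OF a(1), of False] by (simp_all add: R0_def R1_def)
    ultimately show ?thesis by blast
  qed
  show "R0 \<inter> R1 = {\<zero>\<^bsub>E\<^esub>}"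
  proof
    show "R0 \<inter> R1 \<subseteq> {\<zero>\<^bsub>E\<^esub>}"
    proof
      fix x assume "x \<in> R0 \<inter> R1"
      then obtain a b where a: "a \<in> ?W {w. even (length w) = True}" "x = cls a"
        and b: "b \<in> ?W {w. even (length w) \<noteq> True}" "x = cls b"
        by (auto simp: R0_def R1_def)
      have ab: "a \<in> carrier T" "b \<in> carrier T"
        using a(1) b(1) by (auto intro: word_spanD)
      \<comment> \<open>An even and an odd representative of the same class differ by an element of
        the ideal, and the even part of that difference is \<open>a\<close>.\<close>
      then have "ppart True (a \<ominus>\<^bsub>T\<^esub> b) \<in> exterior_ideal A M"
        using cls_eq_iff[OF ab] a(2) b(2) by (intro exterior_ideal_homogeneous) simp
      moreover have "ppart True (a \<ominus>\<^bsub>T\<^esub> b) = a"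
        using ab part_span_same[OF a(1)] part_span_other[OF b(1)]
        by (simp add: T.minus_eq part_add part_uminus)
      ultimately show "x \<in> {\<zero>\<^bsub>E\<^esub>}"
        using a(2) ab cls_eq_zero_iff by simp
    qed
    show "{\<zero>\<^bsub>E\<^esub>} \<subseteq> R0 \<inter> R1"
      using word_span_zero cls.hom_zero unfolding R0_def R1_def by (metis IntI empty_subsetI image_eqI insert_subset)
  qed
  show "x \<otimes>\<^bsub>E\<^esub> y \<in> R0" if "x \<in> R0" "y \<in> R0" for x y
    using that unfolding R0_def by (rule cls_span_mult) simp
  show "x \<otimes>\<^bsub>E\<^esub> y \<in> R1" if "x \<in> R0" "y \<in> R1" for x y
    using that unfolding R0_def R1_def by (rule cls_span_mult) simp
  show "x \<otimes>\<^bsub>E\<^esub> y \<in> R1" if "x \<in> R1" "y \<in> R0" for x y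
    using that unfolding R0_def R1_def by (rule cls_span_mult) simp
  show "x \<otimes>\<^bsub>E\<^esub> y \<in> R0" if "x \<in> R1" "y \<in> R1" for x y
    using that unfolding R0_def R1_def by (rule cls_span_mult) simp
  show "x \<otimes>\<^bsub>E\<^esub> y = y \<otimes>\<^bsub>E\<^esub> x" if xy: "x \<in> R0" "y \<in> R0" for x y
  proof -
    obtain a b where "x = cls a" "y = cls b" "a \<in> ?W {w. even (length w)}" "b \<in> ?W {w. even (length w)}"
      using xy by (auto simp: R0_def)
    then show ?thesis using cls_span_commute[of a "{w. even (length w)}" b "{w. even (length w)}" 0] by (simp add: sg_def)
  qed
  show "x \<otimes>\<^bsub>E\<^esub> y = y \<otimes>\<^bsub>E\<^esub> x" if xy: "x \<in> R0" "y \<in> R1" for x y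
  proof -
    obtain a b where "x = cls a" "y = cls b" "a \<in> ?W {w. even (length w)}" "b \<in> ?W {w. odd (length w)}"
      using xy by (auto simp: R0_def R1_def)
    then show ?thesis using cls_span_commute[of a "{w. even (length w)}" b "{w. odd (length w)}" 0] by (simp add: sg_def)
  qed
  show "x \<otimes>\<^bsub>E\<^esub> y = \<ominus>\<^bsub>E\<^esub> (y \<otimes>\<^bsub>E\<^esub> x)" if xy: "x \<in> R1" "y \<in> R1" for x y
  proof -
    obtain a b where "x = cls a" "y = cls b" "a \<in> ?W {w. odd (length w)}" "b \<in> ?W {w. odd (length w)}"
      using xy by (auto simp: R1_def)
    then show ?thesis using cls_span_commute[of a "{w. odd (length w)}" b "{w. odd (length w)}" 1] by (simp add: sg_def)
  qed
qed

end

text \<open>Multi-indices of length n+1 are partitioned by their last entry, the one that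
  \<open>pdiffs\<close> applies to \<open>h\<close> first. Its factor \<open>N j\<close> ends the
  product and is brought to the front by commutativity.\<close>

lemma (in smooth_hom) coef_eq_finsum:
  assumes N: "\<And>j. N j \<in> carrier B"
  shows "h \<in> smooth k \<Longrightarrow> coef N n h = (\<Oplus>js\<in>{js \<in> lists {..<k}. length js = n}.
    e (pdiffs js h) \<otimes> foldr (\<lambda>j P. N j \<otimes> P) js \<one>)"
proof (induction n arbitrary: h)
  case 0
  have "{js \<in> lists {..<k}. length js = 0} = {[]}" by auto
  then show ?case using 0 by simp
next
  case (Suc n)
  let ?L = "\<lambda>n. {js \<in> lists {..<k}. length js = n}"
  let ?F = "\<lambda>js. foldr (\<lambda>j P. N j \<otimes> P) js \<one>"
  have F_closed: "?F js \<in> carrier B" for js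
    by (induction js) (auto simp: N)
  have F_snoc: "?F (js @ [j]) = N j \<otimes> ?F js" for js j
    by (induction js) (use F_closed N in \<open>auto simp: m_lcomm\<close>)
  have fin: "finite (?L n)" for n
    using finite_lists_length_eq[of "{..<k}" n] by (simp add: lists_eq_set conj_commute)
  have img: "?L (Suc n) = (\<Union>j\<in>{..<k}. (\<lambda>js. js @ [j]) ` ?L n)"
  proof (intro equalityI subsetI)
    fix ls assume "ls \<in> ?L (Suc n)"
    then show "ls \<in> (\<Union>j\<in>{..<k}. (\<lambda>js. js @ [j]) ` ?L n)"
      by (cases ls rule: rev_cases) auto
  qed auto
  have e_cl: "e (pdiffs js (pdiff j h)) \<in> carrier B" if "js \<in> ?L n" "j < k" for js j
    using that Suc.prems by (intro e_closed smooth_pdiffs smooth_pdiff) auto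
  have step: "(\<Oplus>js\<in>(\<lambda>js. js @ [j]) ` ?L n. e (pdiffs js h) \<otimes> ?F js) = N j \<otimes> coef N n (pdiff j h)"
    if "j < k" for j
  proof -
    have "(\<Oplus>js\<in>(\<lambda>js. js @ [j]) ` ?L n. e (pdiffs js h) \<otimes> ?F js) =
        (\<Oplus>js\<in>?L n. e (pdiffs (js @ [j]) h) \<otimes> ?F (js @ [j]))"
    proof (rule finsum_reindex)
      show "(\<lambda>js. e (pdiffs js h) \<otimes> ?F js) \<in> (\<lambda>js. js @ [j]) ` ?L n \<rightarrow> carrier B"
        by (rule Pi_I, erule imageE) (simp only: pdiffs_snoc m_closed[OF e_cl[OF _ that] F_closed])
    qed (simp add: inj_on_def)
    also have "\<dots> = (\<Oplus>js\<in>?L n. N j \<otimes> (e (pdiffs js (pdiff j h)) \<otimes> ?F js))"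
    proof (rule finsum_cong')
      show "e (pdiffs (js @ [j]) h) \<otimes> ?F (js @ [j]) = N j \<otimes> (e (pdiffs js (pdiff j h)) \<otimes> ?F js)"
        if "js \<in> ?L n" for js
        unfolding pdiffs_snoc F_snoc by (rule m_lcomm[OF e_cl[OF that \<open>j < k\<close>] N F_closed])
      show "(\<lambda>js. N j \<otimes> (e (pdiffs js (pdiff j h)) \<otimes> ?F js)) \<in> ?L n \<rightarrow> carrier B"
        by (rule Pi_I) (simp only: m_closed N e_cl[OF _ that] F_closed)
    qed simp
    also have "\<dots> = N j \<otimes> coef N n (pdiff j h)"
      unfolding Suc.IH[OF smooth_pdiff[OF Suc.prems that]]
      by (rule finsum_rdistr[symmetric, OF fin N], rule Pi_I) (simp only: m_closed e_cl[OF _ that] F_closed)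
    finally show ?thesis .
  qed
  have "(\<Oplus>js\<in>?L (Suc n). e (pdiffs js h) \<otimes> ?F js) =
      (\<Oplus>j\<in>{..<k}. \<Oplus>js\<in>(\<lambda>js. js @ [j]) ` ?L n. e (pdiffs js h) \<otimes> ?F js)"
    unfolding img
  proof (rule add.finprod_UN_disjoint)
    show "pairwise (\<lambda>i j. disjnt ((\<lambda>js. js @ [i]) ` ?L n) ((\<lambda>js. js @ [j]) ` ?L n)) {..<k}"
      by (auto simp: pairwise_def disjnt_def)
    show "e (pdiffs js h) \<otimes> ?F js \<in> carrier B" if "j \<in> {..<k}" "js \<in> (\<lambda>js. js @ [j]) ` ?L n" for j js
    proof -
      obtain ls where "js = ls @ [j]" "ls \<in> ?L n" "j < k"
        using \<open>j \<in> {..<k}\<close> \<open>js \<in> _\<close> by auto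
      then show ?thesis
        by (simp only: pdiffs_snoc m_closed[OF e_cl F_closed])
    qed
  qed (use fin in auto)
  also have "\<dots> = coef N (Suc n) h"
    unfolding taylor_coeff.simps using step N Suc.prems
    by (intro finsum_cong') (auto simp: smooth_pdiff)
  finally show ?case by simp
qed

section \<open>The even subring and the ideal generated by products of odd elements\<close>

context exterior
begin

abbreviation "B \<equiv> E\<lparr>carrier := R0\<rparr>"
abbreviation "J \<equiv> odd_square E R0 R1"

sublocale S: superring E R0 R1
  by (rule exterior_superring)

lemma R0_sub: "x \<in> R0 \<Longrightarrow> x \<in> carrier E"
  using additive_subgroup.a_Hcarr[OF S.even_subgroup] .

lemma R0_one: "\<one>\<^bsub>E\<^esub> \<in> R0"
proof -
  have "monomial A \<one>\<^bsub>A\<^esub> [] \<in> word_span A (carrier M) {w. even (length w)}"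
    by (intro word_span_monomial) auto
  then have "cls (monomial A \<one>\<^bsub>A\<^esub> []) \<in> R0"
    unfolding R0_def by (rule imageI)
  then show ?thesis
    using ext_word_Nil by (simp add: ext_word_def)
qed

lemma even_cring: "cring B"
proof -
  interpret R0: additive_subgroup R0 E
    by (rule S.even_subgroup)
  have "subring R0 E"
    by (rule E.subringI) (auto simp: R0_one R0_sub S.even_even R0.a_inv_closed R0.a_closed)
  then have "ring B"
    by (rule E.subring_is_ring)
  then show ?thesis
    by (intro cring.intro comm_monoid.intro comm_monoid_axioms.intro ring.is_monoid)
      (simp_all add: S.even_even_commute)
qed

sublocale B: cring B
  by (rule even_cring)

text \<open>The operations are defined by sums in \<open>E\<close>, while the Taylor argument runs
  in the commutative ring \<open>B\<close>. Over an infinite index set both sums are zero by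
  convention.\<close>

lemma B_finsum:
  assumes "f \<in> K \<rightarrow> R0"
  shows "finsum B f K = finsum E f K"
proof (cases "finite K")
  case True
  then show ?thesis using assms
  proof (induction K rule: finite_induct)
    case empty
    show ?case using B.finsum_empty[of f] by simp
  next
    case (insert x K)
    have "finsum B f (insert x K) = f x \<oplus>\<^bsub>E\<^esub> finsum B f K"
      using B.finsum_insert[of K x f] insert by auto
    also have "\<dots> = finsum E f (insert x K)"
      using insert R0_sub by (subst E.finsum_insert) auto
    finally show ?case .
  qed
next
  case False
  then show ?thesis
    using B.finsum_infinite[of K f] by simp
qed

lemma scal_in_R0: "c \<in> carrier A \<Longrightarrow> scal c \<in> R0"
  unfolding R0_def exterior_scalar_def by (intro imageI word_span_monomial) auto

text \<open>Splitting off the first letter leaves a word of odd length; the coefficient goes with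
  the first factor.\<close>

lemma monomial_in_square: "c \<in> carrier A \<Longrightarrow> w \<in> lists (carrier M) \<Longrightarrow> even (length w) \<Longrightarrow> w \<noteq> [] \<Longrightarrow>
  cls (monomial A c w) \<in> {x \<otimes>\<^bsub>E\<^esub> y | x y. x \<in> R1 \<and> y \<in> R1}"
proof -
  assume *: "c \<in> carrier A" "w \<in> lists (carrier M)" "even (length w)" "w \<noteq> []"
  then obtain x v where w: "w = x # v" "x \<in> carrier M" "v \<in> lists (carrier M)" "odd (length v)"
    by (cases w) auto
  have m: "monomial A c [x] \<in> word_span A (carrier M) {w. odd (length w)}"
    "monomial A \<one>\<^bsub>A\<^esub> v \<in> word_span A (carrier M) {w. odd (length w)}"
    using w * by (auto intro!: word_span_monomial)
  have "cls (monomial A c w) = cls (monomial A c [x]) \<otimes>\<^bsub>E\<^esub> cls (monomial A \<one>\<^bsub>A\<^esub> v)"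
    using m[THEN word_spanD] w * monomial_mult[of c "\<one>\<^bsub>A\<^esub>" "[x]" v] by (simp flip: cls.hom_mult)
  moreover have "cls (monomial A c [x]) \<in> R1" "cls (monomial A \<one>\<^bsub>A\<^esub> v) \<in> R1"
    using m by (auto simp: R1_def)
  ultimately show ?thesis by blast
qed

text \<open>The classes on the right form an ideal of the even ring that contains all products of
  two odd elements; conversely each scaled word of positive even length is such a product. This form
  gives access to generators, word lengths and constant coefficients.\<close>

lemma J_eq: "J = cls ` word_span A (carrier M) {w. even (length w) \<and> w \<noteq> []}"
proof
  let ?P = "{x \<otimes>\<^bsub>E\<^esub> y | x y. x \<in> R1 \<and> y \<in> R1}"
  let ?S = "{w. even (length w) \<and> w \<noteq> []}"
  have P: "?P \<subseteq> R0" using S.odd_odd by auto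
  show "J \<subseteq> cls ` word_span A (carrier M) ?S"
    unfolding odd_square_def
  proof (rule B.genideal_minimal)
    show "ideal (cls ` word_span A (carrier M) ?S) B"
    proof (rule idealI)
      show "ring B" by (rule B.ring_axioms)
      interpret G: additive_subgroup "cls ` word_span A (carrier M) ?S" E
        by (rule cls_span_subgroup)
      have sub: "cls ` word_span A (carrier M) ?S \<subseteq> R0"
        unfolding R0_def by (intro image_mono word_span_mono) auto
      show "subgroup (cls ` word_span A (carrier M) ?S) (add_monoid B)"
      proof (rule B.add.subgroupI)
        show "cls ` word_span A (carrier M) ?S \<subseteq> carrier B"
          using sub by simp
        show "cls ` word_span A (carrier M) ?S \<noteq> {}"
          using G.zero_closed by blast
        show "x \<oplus>\<^bsub>B\<^esub> y \<in> cls ` word_span A (carrier M) ?S"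
          if "x \<in> cls ` word_span A (carrier M) ?S" "y \<in> cls ` word_span A (carrier M) ?S" for x y
          using G.a_closed[OF that] by simp
        show "\<ominus>\<^bsub>B\<^esub> x \<in> cls ` word_span A (carrier M) ?S" if x: "x \<in> cls ` word_span A (carrier M) ?S" for x
        proof -
          have m: "\<ominus>\<^bsub>E\<^esub> x \<in> cls ` word_span A (carrier M) ?S"
            using x by (rule G.a_inv_closed)
          \<comment> \<open>Negation in a ring record depends on the carrier, so the negatives in
            \<open>B\<close> and \<open>E\<close> have to be compared.\<close>
          have "\<ominus>\<^bsub>B\<^esub> x = \<ominus>\<^bsub>E\<^esub> x"
            using sub x m E.l_neg[of x] R0_sub by (intro B.minus_equality) auto
          then show ?thesis using m by simp
        qed
      qed
      show "x \<otimes>\<^bsub>B\<^esub> a \<in> cls ` word_span A (carrier M) ?S"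
        if "a \<in> cls ` word_span A (carrier M) ?S" "x \<in> carrier B" for a x
        using cls_span_mult[of x "{w. even (length w)}" a ?S ?S] that by (simp add: R0_def)
      show "a \<otimes>\<^bsub>B\<^esub> x \<in> cls ` word_span A (carrier M) ?S"
        if "a \<in> cls ` word_span A (carrier M) ?S" "x \<in> carrier B" for a x
        using cls_span_mult[of a ?S x "{w. even (length w)}" ?S] that by (simp add: R0_def)
    qed
    have "x \<otimes>\<^bsub>E\<^esub> y \<in> cls ` word_span A (carrier M) ?S" if "x \<in> R1" "y \<in> R1" for x y
      using that unfolding R1_def by (rule cls_span_mult) auto
    then show "?P \<subseteq> cls ` word_span A (carrier M) ?S" by blast
  qed
  show "cls ` word_span A (carrier M) ?S \<subseteq> J"
  proof
    have J: "ideal J B"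
      unfolding odd_square_def by (rule B.genideal_ideal) (simp add: P)
    fix x assume "x \<in> cls ` word_span A (carrier M) ?S"
    then obtain a where a: "a \<in> word_span A (carrier M) ?S" "x = cls a" by blast
    have "cls a \<in> J"
      using a(1)
    proof (induction rule: word_span_induct)
      case zero
      show ?case
        using additive_subgroup.zero_closed[OF ideal.axioms(1)[OF J]] by simp
    next
      case (add a c w)
      have "cls (monomial A c w) \<in> J"
        unfolding odd_square_def
        using B.genideal_self[of ?P] P monomial_in_square[OF add.hyps(2,3)] add.hyps(4) by auto
      then show ?case
        using additive_subgroup.a_closed[OF ideal.axioms(1)[OF J] add.IH] add.hyps
        by (simp add: monomial_closed word_spanD[OF add.hyps(1)])
    qed
    then show "x \<in> J" using a by simp
  qed
qed

lemma J_ideal: "ideal J B"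
  unfolding odd_square_def by (rule B.genideal_ideal) (auto intro: S.odd_odd)

lemma J_sub_R0: "x \<in> J \<Longrightarrow> x \<in> R0"
  using ideal.Icarr[OF J_ideal] by simp

text \<open>The coefficient of the empty word is the body; deleting it leaves only words of positive
  even length.\<close>

lemma even_decomp:
  assumes "F \<in> R0"
  shows "\<exists>f\<in>carrier A. \<exists>N\<in>J. F = scal f \<oplus>\<^bsub>E\<^esub> N"
proof -
  obtain a where a: "a \<in> word_span A (carrier M) {w. even (length w)}" "F = cls a"
    using assms by (auto simp: R0_def)
  have aT: "a \<in> carrier T"
    using a(1) by (rule word_spanD)
  note [simp] = T_coeff[OF aT]
  let ?b = "a([] := \<zero>\<^bsub>A\<^esub>)"
  have bT: "?b \<in> carrier T"
    by (rule T_support_closed[of _ a a]) (use aT in auto)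
  have b: "?b \<in> word_span A (carrier M) {w. even (length w) \<and> w \<noteq> []}"
    using a(1) bT by (auto simp: word_span_def)
  have m: "monomial A (a []) [] \<in> carrier T"
    by (intro monomial_closed) auto
  have "a = monomial A (a []) [] \<oplus>\<^bsub>T\<^esub> ?b"
    by (auto simp: fun_eq_iff T_add monomial_def)
  then have "F = scal (a []) \<oplus>\<^bsub>E\<^esub> cls ?b"
    using m bT a(2) cls.hom_add unfolding exterior_scalar_def by metis
  moreover have "cls ?b \<in> J"
    using b unfolding J_eq by (rule imageI)
  ultimately show ?thesis by force
qed

lemma even_decomp_unique:
  assumes "f \<in> carrier A" "f' \<in> carrier A" "N \<in> J" "N' \<in> J"
    and eq: "scal f \<oplus>\<^bsub>E\<^esub> N = scal f' \<oplus>\<^bsub>E\<^esub> N'"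
  shows "f = f'" "N = N'"
proof -
  obtain a where a: "a \<in> word_span A (carrier M) {w. even (length w) \<and> w \<noteq> []}" "N = cls a"
    using assms(3) unfolding J_eq by blast
  obtain b where b: "b \<in> word_span A (carrier M) {w. even (length w) \<and> w \<noteq> []}" "N' = cls b"
    using assms(4) unfolding J_eq by blast
  let ?f = "monomial A f []" and ?g = "monomial A f' []"
  have T: "a \<in> carrier T" "b \<in> carrier T" "?f \<in> carrier T" "?g \<in> carrier T"
    using a b assms by (auto intro!: monomial_closed dest: word_spanD)
  have "cls (?f \<oplus>\<^bsub>T\<^esub> a) = cls (?g \<oplus>\<^bsub>T\<^esub> b)"
    using eq a b T by (simp add: exterior_scalar_def)
  then have "(?f \<oplus>\<^bsub>T\<^esub> a) \<ominus>\<^bsub>T\<^esub> (?g \<oplus>\<^bsub>T\<^esub> b) \<in> exterior_ideal A M"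
    using cls_eq_iff[of "?f \<oplus>\<^bsub>T\<^esub> a" "?g \<oplus>\<^bsub>T\<^esub> b"] T by simp
  \<comment> \<open>An element of the ideal has no constant term, so the coefficients at the empty
    word agree.\<close>
  then have "((?f \<oplus>\<^bsub>T\<^esub> a) \<ominus>\<^bsub>T\<^esub> (?g \<oplus>\<^bsub>T\<^esub> b)) [] = \<zero>\<^bsub>A\<^esub>"
    using exterior_ideal_augmentation unfolding word_span_def by blast
  moreover have "a [] = \<zero>\<^bsub>A\<^esub>" "b [] = \<zero>\<^bsub>A\<^esub>"
    using a b by (auto simp: word_span_def)
  ultimately have "f \<ominus>\<^bsub>A\<^esub> f' = \<zero>\<^bsub>A\<^esub>"
    using T assms by (simp add: T_minus T_add monomial_def)
  then show "f = f'"
    using assms(1,2) by simp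
  with eq have "scal f' \<oplus>\<^bsub>E\<^esub> N = scal f' \<oplus>\<^bsub>E\<^esub> N'"
    by simp
  then show "N = N'"
    using E.r_neg1 scal_closed[OF assms(2)] R0_sub J_sub_R0 assms(3,4) by metis
qed

text \<open>The increments are scaled words of positive even length. Scalars are central and a word
  followed by itself repeats its first letter, so the squares vanish.\<close>

lemma square_zero_induct:
  assumes "x \<in> J" and zero: "P \<zero>\<^bsub>E\<^esub>"
    and add: "\<And>x d. \<lbrakk>x \<in> J; P x; d \<in> J; d \<otimes>\<^bsub>E\<^esub> d = \<zero>\<^bsub>E\<^esub>\<rbrakk> \<Longrightarrow> P (x \<oplus>\<^bsub>E\<^esub> d)"
  shows "P x"
proof -
  obtain a where a: "a \<in> word_span A (carrier M) {w. even (length w) \<and> w \<noteq> []}" "x = cls a"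
    using assms(1) unfolding J_eq by blast
  have "P (cls a)"
    using a(1)
  proof (induction rule: word_span_induct)
    case zero
    then show ?case using assms(2) by simp
  next
    case (add a c w)
    let ?m = "monomial A c w"
    have m: "?m \<in> word_span A (carrier M) {w. even (length w) \<and> w \<noteq> []}"
      using add.hyps by (intro word_span_monomial) auto
    have W: "ext_word w \<in> carrier E" "scal c \<in> carrier E"
      using add.hyps by (auto intro: ext_word_closed scal_closed)
    have "cls ?m \<otimes>\<^bsub>E\<^esub> cls ?m = scal c \<otimes>\<^bsub>E\<^esub> ((ext_word w \<otimes>\<^bsub>E\<^esub> scal c) \<otimes>\<^bsub>E\<^esub> ext_word w)"
      using add.hyps W by (simp add: cls_monomial E.m_assoc)
    also have "ext_word w \<otimes>\<^bsub>E\<^esub> scal c = scal c \<otimes>\<^bsub>E\<^esub> ext_word w"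
      using add.hyps W scal_central by simp
    also have "scal c \<otimes>\<^bsub>E\<^esub> (scal c \<otimes>\<^bsub>E\<^esub> ext_word w \<otimes>\<^bsub>E\<^esub> ext_word w) = \<zero>\<^bsub>E\<^esub>"
      using add.hyps W ext_word_self[of w] by (simp add: E.m_assoc)
    finally have "P (cls a \<oplus>\<^bsub>E\<^esub> cls ?m)"
      using add.IH add.hyps(1) m by (intro assms(3)) (auto simp: J_eq)
    then show ?case
      using m[THEN word_spanD] add.hyps(1)[THEN word_spanD] by simp
  qed
  then show ?thesis using a by simp
qed

text \<open>Each factor is built from words of length at least 2. A lower bound on the length is
  kept instead of an exact degree because elements of \<open>J\<close> may mix several
  lengths.\<close>

lemma foldr_J:
  "set xs \<subseteq> J \<Longrightarrow> foldr (\<otimes>\<^bsub>E\<^esub>) xs \<one>\<^bsub>E\<^esub> \<in> cls ` word_span A (carrier M) {w. 2 * length xs \<le> length w}"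
proof (induction xs)
  case Nil
  have "monomial A \<one>\<^bsub>A\<^esub> [] \<in> word_span A (carrier M) {w. 2 * length [] \<le> length w}"
    by (intro word_span_monomial) auto
  from imageI[OF this, of cls] show ?case
    using ext_word_Nil by (simp add: ext_word_def)
next
  case (Cons x xs)
  have x: "x \<in> cls ` word_span A (carrier M) {w. even (length w) \<and> w \<noteq> []}"
    using Cons.prems J_eq by auto
  have "x \<otimes>\<^bsub>E\<^esub> foldr (\<otimes>\<^bsub>E\<^esub>) xs \<one>\<^bsub>E\<^esub> \<in> cls ` word_span A (carrier M) {w. 2 * length (x # xs) \<le> length w}"
  proof (rule cls_span_mult[OF x Cons.IH])
    show "u @ v \<in> {w. 2 * length (x # xs) \<le> length w}"
      if "u \<in> {w. even (length w) \<and> w \<noteq> []}" "v \<in> {w. 2 * length xs \<le> length w}" for u v :: "'m list"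
    proof -
      \<comment> \<open>The case rule separates the empty list, one-element lists and longer ones;
        evenness and nonemptiness exclude the first two.\<close>
      have "2 \<le> length u"
        using that(1) by (cases u rule: remdups_adj.cases) auto
      then show ?thesis using that(2) by simp
    qed
  qed (use Cons.prems in auto)
  then show ?case by simp
qed

end

section \<open>Nilpotency from a finite basis\<close>

locale free_exterior = exterior A M
  for A :: "('c, 'z) ring_scheme" and M :: "('c, 'm, 'y) module_scheme" +
  fixes q :: nat and \<theta> :: "nat \<Rightarrow> 'm"
  assumes basis: "free_basis A M q \<theta>"
begin

lemma long_words_vanish:
  assumes "x \<in> cls ` word_span A (carrier M) {w. q < length w}"
  shows "x = \<zero>\<^bsub>E\<^esub>"
proof -
  have \<theta>: "\<theta> \<in> {1..q} \<rightarrow> carrier M"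
    using basis by (simp add: free_basis_def)
  have span: "\<exists>c. c \<in> {1..q} \<rightarrow> carrier A \<and> x = (\<Oplus>\<^bsub>M\<^esub>i\<in>{1..q}. c i \<odot>\<^bsub>M\<^esub> \<theta> i)" if "x \<in> carrier M" for x
  proof -
    have "\<exists>!c. c \<in> {1..q} \<rightarrow>\<^sub>E carrier A \<and> x = (\<Oplus>\<^bsub>M\<^esub>i\<in>{1..q}. c i \<odot>\<^bsub>M\<^esub> \<theta> i)"
      using basis that unfolding free_basis_def by blast
    then show ?thesis
      by (elim ex1E conjE) (auto simp: PiE_def)
  qed
  obtain a where a: "a \<in> word_span A (carrier M) {w. q < length w}" "x = cls a"
    using assms by blast
  have "cls a = \<zero>\<^bsub>E\<^esub>"
    using a(1)
  proof (induction rule: word_span_induct)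
    case zero
    show ?case by simp
  next
    case (add a c w)
    have "ext_word w = \<zero>\<^bsub>E\<^esub>"
      using ext_word_vanish[OF \<theta> span, of w "[]"] add.hyps ext_word_closed[of w] by (simp add: ext_word_Nil)
    then have "cls (monomial A c w) = \<zero>\<^bsub>E\<^esub>"
      using add.hyps by (simp add: cls_monomial scal_closed)
    then show ?case
      using add.IH add.hyps word_spanD[OF add.hyps(1)] by (simp add: monomial_closed)
  qed
  then show ?thesis using a by simp
qed

text \<open>More than \<open>q div 2\<close> factors of word length at least 2 exceed length q, even
  for odd q; this fixes the degree at which Taylor sums stop.\<close>

lemma J_nilpotent:
  assumes "set xs \<subseteq> J" "q div 2 < length xs"
  shows "foldr (\<otimes>\<^bsub>E\<^esub>) xs \<one>\<^bsub>E\<^esub> = \<zero>\<^bsub>E\<^esub>"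
proof (rule long_words_vanish)
  have "{w. 2 * length xs \<le> length w} \<subseteq> {w. q < length (w :: 'm list)}"
    using assms(2) by auto
  then show "foldr (\<otimes>\<^bsub>E\<^esub>) xs \<one>\<^bsub>E\<^esub> \<in> cls ` word_span A (carrier M) {w. q < length w}"
    using foldr_J[OF assms(1)] word_span_mono by blast
qed

lemma even_nil_ideal: "nil_ideal B J (q div 2)"
proof (intro nil_ideal.intro nil_ideal_axioms.intro B.cring_axioms J_ideal)
  show "foldr (\<otimes>\<^bsub>B\<^esub>) xs \<one>\<^bsub>B\<^esub> = \<zero>\<^bsub>B\<^esub>" if "set xs \<subseteq> J" "q div 2 < length xs" for xs
    using J_nilpotent[OF that] by simp
  show "P x" if "x \<in> J" "P \<zero>\<^bsub>B\<^esub>"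
    "\<And>x d. \<lbrakk>x \<in> J; P x; d \<in> J; d \<otimes>\<^bsub>B\<^esub> d = \<zero>\<^bsub>B\<^esub>\<rbrakk> \<Longrightarrow> P (x \<oplus>\<^bsub>B\<^esub> d)" for P x
    by (rule square_zero_induct[OF that(1)]) (use that(2,3) in auto)
qed

end

section \<open>The smooth operations on the even part\<close>

locale cinf_exterior = cinf_ring C \<phi> + free_exterior "cinf_cring C \<phi>" \<xi> q \<theta>
  for C :: "'c set" and \<phi> and \<xi> :: "('c, 'm, 'y) module_scheme" and q and \<theta>
begin

abbreviation "body \<equiv> ext_body (cinf_cring C \<phi>) \<xi>"
abbreviation "soul \<equiv> ext_soul (cinf_cring C \<phi>) \<xi>"

lemma carrier_cinf_cring [simp]: "carrier (cinf_cring C \<phi>) = C"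
  by (simp add: cinf_cring_def)

lemma body_sum:
  assumes "f \<in> C" "N \<in> J"
  shows "body (scal f \<oplus>\<^bsub>E\<^esub> N) = f"
  unfolding ext_body_def exterior_nil_def
proof (rule the_equality)
  show "f \<in> carrier (cinf_cring C \<phi>) \<and> (\<exists>N'\<in>J. scal f \<oplus>\<^bsub>E\<^esub> N = scal f \<oplus>\<^bsub>E\<^esub> N')"
    using assms by auto
  show "g = f" if "g \<in> carrier (cinf_cring C \<phi>) \<and> (\<exists>N'\<in>J. scal f \<oplus>\<^bsub>E\<^esub> N = scal g \<oplus>\<^bsub>E\<^esub> N')" for g
    using that assms even_decomp_unique(1)[of f g N] by auto
qed

lemma soul_sum:
  assumes "f \<in> C" "N \<in> J"
  shows "soul (scal f \<oplus>\<^bsub>E\<^esub> N) = N"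
  unfolding ext_soul_def exterior_nil_def
proof (rule the_equality)
  show "N \<in> J \<and> (\<exists>f'\<in>carrier (cinf_cring C \<phi>). scal f \<oplus>\<^bsub>E\<^esub> N = scal f' \<oplus>\<^bsub>E\<^esub> N)"
    using assms by auto
  show "N' = N" if "N' \<in> J \<and> (\<exists>f'\<in>carrier (cinf_cring C \<phi>). scal f \<oplus>\<^bsub>E\<^esub> N = scal f' \<oplus>\<^bsub>E\<^esub> N')" for N'
    using that assms even_decomp_unique(2)[of f _ N N'] by auto
qed

lemma body_soul_decomp:
  assumes "F \<in> R0"
  shows "body F \<in> C" "soul F \<in> J" "F = scal (body F) \<oplus>\<^bsub>E\<^esub> soul F"
proof -
  obtain f N where "f \<in> C" "N \<in> J" "F = scal f \<oplus>\<^bsub>E\<^esub> N"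
    using even_decomp[OF assms] by auto
  then show "body F \<in> C" "soul F \<in> J" "F = scal (body F) \<oplus>\<^bsub>E\<^esub> soul F"
    by (simp_all add: body_sum soul_sum)
qed

lemma cinf_split: "cinf_split_extension B J (q div 2) C \<phi> scal body soul"
proof (intro cinf_split_extension.intro cinf_nil_extension.intro
    cinf_nil_extension_axioms.intro cinf_split_extension_axioms.intro)
  show "nil_ideal B J (q div 2)" by (rule even_nil_ideal)
  show "cinf_ring C \<phi>" by (rule cinf_ring_axioms)
  show "scal c \<in> carrier B" if "c \<in> C" for c
    using that scal_in_R0 by simp
  show "scal (\<phi> (\<lambda>x. x 0 + x 1) [c, d]) = scal c \<oplus>\<^bsub>B\<^esub> scal d" if "c \<in> C" "d \<in> C" for c d
    using that scal_add[of c d] by (simp add: cinf_cring_def)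
  show "scal (\<phi> (\<lambda>x. x 0 * x 1) [c, d]) = scal c \<otimes>\<^bsub>B\<^esub> scal d" if "c \<in> C" "d \<in> C" for c d
    using that scal_mult[of c d] by (simp add: cinf_cring_def)
  show "scal (\<phi> (\<lambda>_. 1) []) = \<one>\<^bsub>B\<^esub>"
    using scal_one by (simp add: cinf_cring_def)
qed (use body_soul_decomp body_sum soul_sum in auto)

sublocale N: cinf_split_extension B J "q div 2" C \<phi> scal body soul
  by (rule cinf_split)

text \<open>By the composition axiom, \<open>r\<close> times the unit of \<open>C\<close> is the
  operation of the constant function \<open>r\<close> on no arguments, the form in which scalars
  occur in the Taylor construction.\<close>

lemma ext_scale_eq:
  "ext_scale C \<phi> \<xi> r F = scal (\<phi> (\<lambda>_. r) []) \<otimes>\<^bsub>E\<^esub> F"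
proof -
  have lin: "(\<lambda>x. r * x 0) \<in> smooth 1"
    by (intro smooth_mult smooth_const smooth_coord) simp
  have "\<phi> (\<lambda>x. r * x 0) [\<phi> (\<lambda>_. 1) []] = \<phi> (\<lambda>_. r) []"
    using op_comp[OF lin, of "\<lambda>_ _. 1" "[]"] by (simp add: smooth_const)
  then show ?thesis
    by (simp add: ext_scale_def Let_def cinf_scale_def) (simp add: cinf_cring_def)
qed

definition list_vec :: "('m list \<Rightarrow> 'c) set list \<Rightarrow> nat \<Rightarrow> ('m list \<Rightarrow> 'c) set" where
  "list_vec Ns = (\<lambda>j. if j < length Ns then Ns ! j else \<zero>\<^bsub>E\<^esub>)"

lemma list_vec_in_J: "Ns \<in> lists J \<Longrightarrow> list_vec Ns j \<in> J"
  using N.J.zero_closed by (auto simp: list_vec_def)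

text \<open>Two views are reconciled: sums and products in \<open>E\<close> are taken in the
  commutative even subring, and the sum over multi-indices becomes the recursive
  coefficient.\<close>

lemma taylor_term_eq:
  assumes fs: "fs \<in> lists C" and Ns: "Ns \<in> lists J" and len: "length Ns = length fs"
    and h: "h \<in> smooth (length fs)"
  shows "taylor_term C \<phi> \<xi> h fs Ns n =
    N.ev fs (\<lambda>_. 1 / fact n) \<otimes>\<^bsub>B\<^esub> taylor_coeff B (length fs) (N.ev fs) (list_vec Ns) n h"
proof -
  interpret H: nil_smooth_hom B J "q div 2" "length fs" "N.ev fs"
    using fs by (rule N.ev_hom)
  let ?L = "{js \<in> lists {..<length fs}. length js = n}"
  let ?t = "\<lambda>js. scal (\<phi> (pdiffs js h) fs) \<otimes>\<^bsub>E\<^esub> foldr (\<lambda>j P. list_vec Ns j \<otimes>\<^bsub>E\<^esub> P) js \<one>\<^bsub>E\<^esub>"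
  have vec: "list_vec Ns j \<in> carrier B" for j
    using list_vec_in_J[OF Ns] J_sub_R0 by simp
  have F: "foldr (\<lambda>j P. list_vec Ns j \<otimes>\<^bsub>E\<^esub> P) js \<one>\<^bsub>E\<^esub> \<in> R0" for js
    by (induction js) (use vec in \<open>auto simp: R0_one intro!: S.even_even\<close>)
  have t: "?t \<in> ?L \<rightarrow> R0"
  proof
    fix js assume "js \<in> ?L"
    then have "\<phi> (pdiffs js h) fs \<in> C"
      using h fs by (intro op_closed smooth_pdiffs) auto
    then show "?t js \<in> R0"
      using F by (intro S.even_even scal_in_R0) auto
  qed
  have "(\<Oplus>\<^bsub>E\<^esub>js\<in>?L. scal (\<phi> (pdiffs js h) fs) \<otimes>\<^bsub>E\<^esub> foldr (\<lambda>j P. Ns ! j \<otimes>\<^bsub>E\<^esub> P) js \<one>\<^bsub>E\<^esub>) = (\<Oplus>\<^bsub>E\<^esub>js\<in>?L. ?t js)"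
  proof (rule E.finsum_cong')
    show "scal (\<phi> (pdiffs js h) fs) \<otimes>\<^bsub>E\<^esub> foldr (\<lambda>j P. Ns ! j \<otimes>\<^bsub>E\<^esub> P) js \<one>\<^bsub>E\<^esub> = ?t js" if "js \<in> ?L" for js
    proof -
      \<comment> \<open>All entries of \<open>js\<close> are below the length of \<open>Ns\<close>,
        so the extension by zero is not seen.\<close>
      have "foldr (\<lambda>j P. Ns ! j \<otimes>\<^bsub>E\<^esub> P) js \<one>\<^bsub>E\<^esub> = foldr (\<lambda>j P. list_vec Ns j \<otimes>\<^bsub>E\<^esub> P) js \<one>\<^bsub>E\<^esub>"
        using that len by (intro foldr_cong) (auto simp: list_vec_def)
      then show ?thesis by simp
    qed
  qed (use t R0_sub in auto)
  also have "\<dots> = (\<Oplus>\<^bsub>B\<^esub>js\<in>?L. ?t js)"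
    using B_finsum[OF t] by simp
  also have "\<dots> = H.coef (list_vec Ns) n h"
    using H.coef_eq_finsum[OF vec h, where n = n] by (simp add: N.ev_def)
  finally have sum: "(\<Oplus>\<^bsub>E\<^esub>js\<in>?L. scal (\<phi> (pdiffs js h) fs) \<otimes>\<^bsub>E\<^esub> foldr (\<lambda>j P. Ns ! j \<otimes>\<^bsub>E\<^esub> P) js \<one>\<^bsub>E\<^esub>) =
    H.coef (list_vec Ns) n h" .
  have "taylor_term C \<phi> \<xi> h fs Ns n = ext_scale C \<phi> \<xi> (1 / fact n) (H.coef (list_vec Ns) n h)"
    unfolding taylor_term_def Let_def sum ..
  also have "\<dots> = N.ev fs (\<lambda>_. 1 / fact n) \<otimes>\<^bsub>B\<^esub> H.coef (list_vec Ns) n h"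
    using N.op_const[OF fs] by (simp add: ext_scale_eq N.ev_def)
  finally show ?thesis .
qed

lemma taylor_term_in_R0:
  assumes fs: "fs \<in> lists C" and Ns: "Ns \<in> lists J" and len: "length Ns = length fs"
    and h: "h \<in> smooth (length fs)"
  shows "taylor_term C \<phi> \<xi> h fs Ns n \<in> R0"
proof -
  interpret H: nil_smooth_hom B J "q div 2" "length fs" "N.ev fs"
    using fs by (rule N.ev_hom)
  have "N.ev fs (\<lambda>_. 1 / fact n) \<otimes>\<^bsub>B\<^esub> H.coef (list_vec Ns) n h \<in> carrier B"
    using H.coef_closed[OF N.J.Icarr[OF list_vec_in_J[OF Ns]] h] H.e_const_closed by (intro B.m_closed)
  then show ?thesis
    unfolding taylor_term_eq[OF assms] by simp
qed

lemma taylor_term_zero: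
  assumes fs: "fs \<in> lists C" and Ns: "Ns \<in> lists J" and len: "length Ns = length fs"
    and h: "h \<in> smooth (length fs)" and n: "q div 2 < n"
  shows "taylor_term C \<phi> \<xi> h fs Ns n = \<zero>\<^bsub>E\<^esub>"
proof -
  interpret H: nil_smooth_hom B J "q div 2" "length fs" "N.ev fs"
    using fs by (rule N.ev_hom)
  have "H.coef (list_vec Ns) n h = \<zero>\<^bsub>B\<^esub>"
    using list_vec_in_J[OF Ns] n h by (rule H.coef_eq_0)
  then show ?thesis
    using H.e_const_closed[of "1 / fact n"] R0_sub by (simp add: taylor_term_eq[OF fs Ns len h])
qed

text \<open>The nonzero terms have degree at most \<open>q div 2\<close>, so the defining sum is a
  genuine finite one and the zero terms in that range may be added. \<open>Fs\<close> is described
  only by its bodies and souls, which serves both prescribed parts and given even elements.\<close>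

lemma ext_op_eq_sum:
  assumes fs: "fs \<in> lists C" and Ns: "Ns \<in> lists J" and len: "length Ns = length fs"
    and h: "h \<in> smooth (length fs)"
    and body: "map body Fs = fs" and soul: "map soul Fs = Ns"
  shows "ext_op C \<phi> \<xi> h Fs = (\<Oplus>\<^bsub>E\<^esub>n\<in>{..q div 2}. taylor_term C \<phi> \<xi> h fs Ns n)"
proof -
  let ?t = "taylor_term C \<phi> \<xi> h fs Ns"
  have "{n. ?t n \<noteq> \<zero>\<^bsub>E\<^esub>} \<subseteq> {..q div 2}"
    using taylor_term_zero[OF fs Ns len h] not_le by blast
  then have "(\<Oplus>\<^bsub>E\<^esub>n\<in>{n. ?t n \<noteq> \<zero>\<^bsub>E\<^esub>}. ?t n) = (\<Oplus>\<^bsub>E\<^esub>n\<in>{..q div 2}. ?t n)"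
    using R0_sub[OF taylor_term_in_R0[OF fs Ns len h]]
    by (intro E.add.finprod_mono_neutral_cong_left) auto
  then show ?thesis
    unfolding ext_op_def Let_def body soul .
qed

lemma ext_op_sum:
  assumes fs: "fs \<in> lists C" and Ns: "Ns \<in> lists J" and len: "length Ns = length fs"
    and h: "h \<in> smooth (length fs)"
  shows "ext_op C \<phi> \<xi> h (map2 (\<lambda>f N. scal f \<oplus>\<^bsub>E\<^esub> N) fs Ns) =
    (\<Oplus>\<^bsub>E\<^esub>n\<in>{..q div 2}. taylor_term C \<phi> \<xi> h fs Ns n)"
proof (rule ext_op_eq_sum[OF assms])
  have "fs ! i \<in> C" "Ns ! i \<in> J" if "i < length fs" for i
    using that fs Ns len by auto
  then show "map body (map2 (\<lambda>f N. scal f \<oplus>\<^bsub>E\<^esub> N) fs Ns) = fs"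
    "map soul (map2 (\<lambda>f N. scal f \<oplus>\<^bsub>E\<^esub> N) fs Ns) = Ns"
    using len by (auto intro!: nth_equalityI simp: body_sum soul_sum)
qed

text \<open>The axioms are established for the abstract operation and carried over by this equality.
  It concerns smooth \<open>h\<close> of matching arity, hence the smoothness checks wherever it is
  applied.\<close>

lemma ext_op_nil_op:
  assumes Fs: "Fs \<in> lists R0" and h: "h \<in> smooth (length Fs)"
  shows "ext_op C \<phi> \<xi> h Fs = N.nil_op h Fs"
proof -
  let ?fs = "map body Fs" and ?Ns = "map soul Fs"
  have fs: "?fs \<in> lists C" and Ns: "?Ns \<in> lists J"
    using Fs body_soul_decomp by (auto simp: in_lists_conv_set)
  have len: "length ?Ns = length ?fs" and h': "h \<in> smooth (length ?fs)"
    using h by auto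
  have vec: "list_vec ?Ns = N.soul_vec Fs"
    by (rule ext) (simp add: list_vec_def N.soul_vec_def)
  have "ext_op C \<phi> \<xi> h Fs = (\<Oplus>\<^bsub>E\<^esub>n\<in>{..q div 2}. taylor_term C \<phi> \<xi> h ?fs ?Ns n)"
    by (rule ext_op_eq_sum[OF fs Ns len h']) simp_all
  also have "\<dots> = (\<Oplus>\<^bsub>B\<^esub>n\<in>{..q div 2}. taylor_term C \<phi> \<xi> h ?fs ?Ns n)"
    using taylor_term_in_R0[OF fs Ns len h'] by (intro B_finsum[symmetric]) auto
  also have "\<dots> = N.nil_op h Fs"
    unfolding N.nil_op_def taylor_sum_def taylor_term_eq[OF fs Ns len h'] vec ..
  finally show ?thesis .
qed

section \<open>The smooth ring axioms and compatibility with the superring\<close>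

lemma ext_op_cinf_ring: "cinf_ring R0 (ext_op C \<phi> \<xi>)"
proof
  show "ext_op C \<phi> \<xi> f cs \<in> R0" if "f \<in> smooth (length cs)" "cs \<in> lists R0" for f cs
    using N.nil_op_closed[of cs f] that by (simp add: ext_op_nil_op)
  show "ext_op C \<phi> \<xi> (\<lambda>x. x i) cs = cs ! i" if "cs \<in> lists R0" "i < length cs" for i cs
    using N.nil_op_proj[of cs i] that by (simp add: ext_op_nil_op smooth_coord)
  show "ext_op C \<phi> \<xi> (\<lambda>x. g (\<lambda>i. h i x)) cs = ext_op C \<phi> \<xi> g (map (\<lambda>i. ext_op C \<phi> \<xi> (h i) cs) [0..<n])"
    if g: "g \<in> smooth n" and h: "\<And>i. i < n \<Longrightarrow> h i \<in> smooth (length cs)" and cs: "cs \<in> lists R0" for n g h cs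
  proof -
    have gh: "(\<lambda>x. g (\<lambda>i. h i x)) \<in> smooth (length cs)"
      using g h by (rule smooth_comp)
    have csB: "cs \<in> lists (carrier B)"
      using cs by simp
    have inner: "map (\<lambda>i. ext_op C \<phi> \<xi> (h i) cs) [0..<n] = map (\<lambda>i. N.nil_op (h i) cs) [0..<n]"
      by (rule map_cong[OF refl]) (simp add: ext_op_nil_op[OF cs h])
    have "N.nil_op (h i) cs \<in> R0" if "i < n" for i
      using N.nil_op_closed[OF csB h[OF that]] by simp
    then have lst: "map (\<lambda>i. N.nil_op (h i) cs) [0..<n] \<in> lists R0"
      by auto
    have "ext_op C \<phi> \<xi> (\<lambda>x. g (\<lambda>i. h i x)) cs = N.nil_op (\<lambda>x. g (\<lambda>i. h i x)) cs"
      using cs gh by (rule ext_op_nil_op)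
    also have "\<dots> = N.nil_op g (map (\<lambda>i. N.nil_op (h i) cs) [0..<n])"
      using csB g h by (rule N.nil_op_comp)
    also have "\<dots> = ext_op C \<phi> \<xi> g (map (\<lambda>i. N.nil_op (h i) cs) [0..<n])"
      using lst by (rule ext_op_nil_op[symmetric]) (simp add: g)
    finally show ?thesis
      unfolding inner .
  qed
qed

lemma ext_op_add: "F \<in> R0 \<Longrightarrow> G \<in> R0 \<Longrightarrow> ext_op C \<phi> \<xi> (\<lambda>x. x 0 + x 1) [F, G] = F \<oplus>\<^bsub>E\<^esub> G"
  by (subst ext_op_nil_op) (use N.nil_op_plus[of F G] in \<open>auto intro!: smooth_add smooth_coord\<close>)

lemma ext_op_mult: "F \<in> R0 \<Longrightarrow> G \<in> R0 \<Longrightarrow> ext_op C \<phi> \<xi> (\<lambda>x. x 0 * x 1) [F, G] = F \<otimes>\<^bsub>E\<^esub> G"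
  by (subst ext_op_nil_op) (use N.nil_op_times[of F G] in \<open>auto intro!: smooth_mult smooth_coord\<close>)

lemma ext_op_scale: "F \<in> R0 \<Longrightarrow> ext_op C \<phi> \<xi> (\<lambda>x. r * x 0) [F] = ext_scale C \<phi> \<xi> r F"
  by (subst ext_op_nil_op)
    (use N.nil_op_scale[of F r] in \<open>auto intro!: smooth_mult smooth_coord smooth_const simp: ext_scale_eq\<close>)

lemma ext_cinf_superring: "cinf_superring E R0 R1 (ext_op C \<phi> \<xi>)"
  by (intro cinf_superring.intro cinf_superring_axioms.intro exterior_superring ext_op_cinf_ring
      ext_op_add ext_op_mult)

end

theorem proposition3p13:
  fixes C :: "'c set"
    and \<phi> :: "rfun \<Rightarrow> 'c list \<Rightarrow> 'c"
    and \<xi> :: "('c, 'm) module"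
    and q :: nat
    and \<theta> :: "nat \<Rightarrow> 'm"
  assumes "cinf_ring C \<phi>"
    and "Module.module (cinf_cring C \<phi>) \<xi>"
    and "free_basis (cinf_cring C \<phi>) \<xi> q \<theta>"
  shows "let A = cinf_cring C \<phi>;
             R = exterior_algebra A \<xi>;
             R0 = exterior_even A \<xi>;
             R1 = exterior_odd A \<xi>;
             J = odd_square R R0 R1;
             \<iota> = exterior_scalar A \<xi>;
             T = taylor_term C \<phi> \<xi>;
             \<Phi> = ext_op C \<phi> \<xi>
         in
           superring R R0 R1 \<and>
           (\<forall>f\<in>C. \<forall>N\<in>J. \<iota> f \<oplus>\<^bsub>R\<^esub> N \<in> R0) \<and>
           (\<forall>F\<in>R0. \<exists>!(f, N). f \<in> C \<and> N \<in> J \<and> F = \<iota> f \<oplus>\<^bsub>R\<^esub> N) \<and>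
           (\<forall>k. \<forall>h\<in>smooth k. \<forall>fs\<in>lists C. \<forall>Ns\<in>lists J.
              length fs = k \<longrightarrow> length Ns = k \<longrightarrow>
                (\<forall>n. n > q div 2 \<longrightarrow> T h fs Ns n = \<zero>\<^bsub>R\<^esub>) \<and>
                \<Phi> h (map2 (\<lambda>f N. \<iota> f \<oplus>\<^bsub>R\<^esub> N) fs Ns) =
                  (\<Oplus>\<^bsub>R\<^esub>n\<in>{..q div 2}. T h fs Ns n)) \<and>
           cinf_ring R0 \<Phi> \<and>
           (\<forall>F\<in>R0. \<forall>G\<in>R0. \<Phi> (\<lambda>x. x 0 + x 1) [F, G] = F \<oplus>\<^bsub>R\<^esub> G) \<and>
           (\<forall>F\<in>R0. \<forall>G\<in>R0. \<Phi> (\<lambda>x. x 0 * x 1) [F, G] = F \<otimes>\<^bsub>R\<^esub> G) \<and>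
           (\<forall>r. \<forall>F\<in>R0. \<Phi> (\<lambda>x. r * x 0) [F] = ext_scale C \<phi> \<xi> r F) \<and>
           cinf_superring R R0 R1 \<Phi>"
proof -
  interpret module "cinf_cring C \<phi>" \<xi>
    by (rule assms(2))
  interpret cinf_exterior C \<phi> \<xi> q \<theta>
    by (intro cinf_exterior.intro free_exterior.intro free_exterior_axioms.intro exterior.intro
        words.intro assms is_cring)
  have sum_closed: "scal f \<oplus>\<^bsub>E\<^esub> N \<in> R0" if "f \<in> C" "N \<in> J" for f N
    using additive_subgroup.a_closed[OF S.even_subgroup scal_in_R0 J_sub_R0[OF that(2)]] that(1) by simp
  have unique: "\<exists>!(f, N). f \<in> C \<and> N \<in> J \<and> F = scal f \<oplus>\<^bsub>E\<^esub> N" if "F \<in> R0" for F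
  proof (rule ex1I[of _ "(body F, soul F)"])
    show "case (body F, soul F) of (f, N) \<Rightarrow> f \<in> C \<and> N \<in> J \<and> F = scal f \<oplus>\<^bsub>E\<^esub> N"
      using body_soul_decomp[OF that] by simp
    show "p = (body F, soul F)" if "case p of (f, N) \<Rightarrow> f \<in> C \<and> N \<in> J \<and> F = scal f \<oplus>\<^bsub>E\<^esub> N" for p
      using that by (auto simp: body_sum soul_sum)
  qed
  show ?thesis
    unfolding Let_def
    by (intro conjI allI ballI impI exterior_superring sum_closed unique taylor_term_zero ext_op_sum
        ext_op_cinf_ring ext_op_add ext_op_mult ext_op_scale ext_cinf_superring; simp)
qed

end
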